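(* Let $\Delta_{S^7}$ be the Laplace–Beltrami operator of $S^7$ with respect to the usual Riemannian structure, and let $\Delta_{sR}=\sum_{a=2}^7X_a^2$ be the intrinsic sub-Laplacian of $S^7$ with its contact distribution. The sub-Riemannian heat operator $e^{-t\Delta_{sR}}$ is given by $$e^{-t\Delta_{sR}}=e^{-t\Delta_{S^7}}\,e^{tX_1^2}.$$
   Context: On $S^7\subset\mathbb{R}^8$ with coordinates $x=(x_0,\ldots,x_7)$, consider the following vector fields, which form an orthonormal frame of $TS^7$ for the usual (round) Riemannian metric, written as coefficient vectors with respect to $(\partial_{x_0},\ldots,\partial_{x_7})$: $X_1=(-x_1,x_0,-x_3,x_2,-x_5,x_4,-x_7,x_6)$, $X_2=(-x_2,x_3,x_0,-x_1,-x_6,x_7,x_4,-x_5)$, $X_3=(-x_3,-x_2,x_1,x_0,x_7,x_6,-x_5,-x_4)$, $X_4=(-x_4,x_5,x_6,-x_7,x_0,-x_1,-x_2,x_3)$, $X_5=(-x_5,-x_4,-x_7,-x_6,x_1,x_0,x_3,x_2)$, $X_6=(-x_6,x_7,-x_4,x_5,x_2,-x_3,x_0,-x_1)$, $X_7=(-x_7,-x_6,x_5,x_4,-x_3,-x_2,x_1,x_0)$. The contact distribution is $\mathcal{H}=\mathrm{span}\{X_2,\ldots,X_7\}$, with sub-Riemannian metric the restriction of the usual Riemannian metric. The Laplace–Beltrami operator has the sign convention $\Delta_{S^7}=\mathrm{div}\,\nabla$, so that $\Delta_{S^7}=\Delta_{sR}+X_1^2$. Let $\mu_{sR}$ be Popp's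 volume form, which here is the Riemannian volume form of $S^7$. The symbol $e^{-t\Delta_{sR}}$ denotes the semigroup of operators acting on $L^2_{\mu_{sR}}$ (the $L^2$ space of $S^7$ with respect to $\mu_{sR}$) with infinitesimal generator $\Delta_{sR}$; it is called the sub-Riemannian heat operator. The same exponential notation is used for $e^{-t\Delta_{S^7}}$ and $e^{-tX_1^2}$, and $e^{tX_1^2}$ is the exponential obtained from $e^{-tX_1^2}$ by replacing $t$ with $-t$.
   Formalization: For t > 0 the operator e^{tX_1^2} is unbounded, defined only on a dense subspace as the inverse of e^{-tX_1^2}, so the product is not defined on all of L^2; the identity is stated with the closure of the product, which includes equality wherever the product is defined. *)

theory Defs
  imports "HOL-Analysis.Analysis"
begin

section \<open>The frame on the seven-sphere\<close>

text \<open>The elements of the index type \<^typ>\<open>8\<close> are \<open>0, \<dots>, 7\<close>, so \<open>x $ 0, \<dots>, x $ 7\<close> are the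
  coordinates \<open>x\<^sub>0, \<dots>, x\<^sub>7\<close>. (The library function \<^const>\<open>vector\<close> starts at index \<open>1\<close> and would
  put its last entry at index \<open>8 = 0\<close>.)\<close>

definition vec8 :: "real list \<Rightarrow> real ^ 8" where
  "vec8 c = (\<Sum>k<8. axis (of_nat k) (c ! k))"

definition X :: "nat \<Rightarrow> real ^ 8 \<Rightarrow> real ^ 8" where
  "X a x =
    [vec8 [- x $ 1,   x $ 0, - x $ 3,   x $ 2, - x $ 5,   x $ 4, - x $ 7,   x $ 6],
     vec8 [- x $ 2,   x $ 3,   x $ 0, - x $ 1, - x $ 6,   x $ 7,   x $ 4, - x $ 5],
     vec8 [- x $ 3, - x $ 2,   x $ 1,   x $ 0,   x $ 7,   x $ 6, - x $ 5, - x $ 4],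
     vec8 [- x $ 4,   x $ 5,   x $ 6, - x $ 7,   x $ 0, - x $ 1, - x $ 2,   x $ 3],
     vec8 [- x $ 5, - x $ 4, - x $ 7, - x $ 6,   x $ 1,   x $ 0,   x $ 3,   x $ 2],
     vec8 [- x $ 6,   x $ 7, - x $ 4,   x $ 5,   x $ 2, - x $ 3,   x $ 0, - x $ 1],
     vec8 [- x $ 7, - x $ 6,   x $ 5,   x $ 4, - x $ 3, - x $ 2,   x $ 1,   x $ 0]] ! (a - 1)"


section \<open>Smooth functions and differential operators on the seven-sphere\<close>

fun Ck :: "nat \<Rightarrow> (real ^ 8 \<Rightarrow> real) \<Rightarrow> bool" where
  "Ck 0 F \<longleftrightarrow> continuous_on UNIV F"
| "Ck (Suc k) F \<longleftrightarrow>
     (\<forall>x. F differentiable (at x)) \<and> (\<forall>v. Ck k (\<lambda>x. frechet_derivative F (at x) v))"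

definition smooth :: "(real ^ 8 \<Rightarrow> real) \<Rightarrow> bool" where
  "smooth F \<longleftrightarrow> (\<forall>k. Ck k F)"

text \<open>As \<open>S\<^sup>7\<close> is a closed submanifold of \<open>\<real>\<^sup>8\<close>, its smooth functions are exactly the restrictions
  of smooth functions on \<open>\<real>\<^sup>8\<close>. The operators below are written in terms of such an extension \<open>F\<close>;
  at points of \<open>S\<^sup>7\<close> they only differentiate in tangential directions, so their values there
  depend on \<open>F\<close> restricted to \<open>S\<^sup>7\<close> only.\<close>

definition X_deriv :: "nat \<Rightarrow> (real ^ 8 \<Rightarrow> real) \<Rightarrow> real ^ 8 \<Rightarrow> real" where
  "X_deriv a F x = frechet_derivative F (at x) (X a x)"

definition X_square :: "nat \<Rightarrow> (real ^ 8 \<Rightarrow> real) \<Rightarrow> real ^ 8 \<Rightarrow> real" where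
  "X_square a F = X_deriv a (X_deriv a F)"

definition sub_laplacian :: "(real ^ 8 \<Rightarrow> real) \<Rightarrow> real ^ 8 \<Rightarrow> real" where
  "sub_laplacian F x = (\<Sum>a = 2..7. X_square a F x)"

text \<open>For \<open>x\<close> in \<open>S\<^sup>7\<close>, \<open>tangential x\<close> is the orthogonal projection onto the tangent space at \<open>x\<close>.
  The Levi-Civita derivative of a tangent field \<open>V\<close> is the tangential part of the Euclidean
  derivative, and the divergence is the trace of \<open>w \<mapsto> \<nabla>\<^sub>w V\<close> over the tangent space.\<close>

definition tangential :: "real ^ 8 \<Rightarrow> real ^ 8 \<Rightarrow> real ^ 8" where
  "tangential x v = v - (x \<bullet> v) *\<^sub>R x"

definition sphere_grad :: "(real ^ 8 \<Rightarrow> real) \<Rightarrow> real ^ 8 \<Rightarrow> real ^ 8" where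
  "sphere_grad F x = tangential x (\<Sum>b\<in>Basis. frechet_derivative F (at x) b *\<^sub>R b)"

definition sphere_div :: "(real ^ 8 \<Rightarrow> real ^ 8) \<Rightarrow> real ^ 8 \<Rightarrow> real" where
  "sphere_div V x =
     (\<Sum>b\<in>Basis. tangential x (frechet_derivative V (at x) (tangential x b)) \<bullet> b)"

definition laplace_beltrami :: "(real ^ 8 \<Rightarrow> real) \<Rightarrow> real ^ 8 \<Rightarrow> real" where
  "laplace_beltrami F = sphere_div (sphere_grad F)"


section \<open>The Riemannian volume and the space of square-integrable functions\<close>

text \<open>By polar coordinates, a Borel set \<open>A\<close> in \<open>S\<^sup>7\<close> has Riemannian volume \<open>8\<close> times the Lebesgue
  measure of the part of the unit ball consisting of the \<open>r x\<close> with \<open>0 < r < 1\<close>, \<open>x\<close> in \<open>A\<close>.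
  Note that \<open>sgn y = y /\<^sub>R norm y\<close>.\<close>

definition S7_volume :: "(real ^ 8) measure" where
  "S7_volume = scale_measure 8
     (distr (restrict_space lborel (ball 0 1 - {0})) (restrict_space borel (sphere 0 1)) sgn)"

definition L2_fun :: "(real ^ 8 \<Rightarrow> real) \<Rightarrow> bool" where
  "L2_fun f \<longleftrightarrow> f \<in> borel_measurable S7_volume \<and> integrable S7_volume (\<lambda>x. (f x)\<^sup>2)"

definition L2_eq :: "(real ^ 8 \<Rightarrow> real) \<Rightarrow> (real ^ 8 \<Rightarrow> real) \<Rightarrow> bool" where
  "L2_eq f g \<longleftrightarrow> L2_fun f \<and> L2_fun g \<and> (AE x in S7_volume. f x = g x)"

lemma L2_fun_zero: "L2_fun (\<lambda>_. 0)"
  by (simp add: L2_fun_def)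

lemma L2_fun_mult:
  assumes "L2_fun f" "L2_fun g"
  shows "integrable S7_volume (\<lambda>x. f x * g x)"
proof (rule Bochner_Integration.integrable_bound[where f = "\<lambda>x. (f x)\<^sup>2 + (g x)\<^sup>2"])
  show "integrable S7_volume (\<lambda>x. (f x)\<^sup>2 + (g x)\<^sup>2)"
    using assms by (simp add: L2_fun_def)
  show "(\<lambda>x. f x * g x) \<in> borel_measurable S7_volume"
    using assms by (auto simp: L2_fun_def)
  have "\<bar>a * b\<bar> \<le> a\<^sup>2 + b\<^sup>2" for a b :: real
  proof -
    have "2 * (\<bar>a\<bar> * \<bar>b\<bar>) \<le> a\<^sup>2 + b\<^sup>2"
      using sum_squares_bound[of "\<bar>a\<bar>" "\<bar>b\<bar>"] by simp
    moreover have "0 \<le> \<bar>a\<bar> * \<bar>b\<bar>"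
      by simp
    ultimately show ?thesis
      unfolding abs_mult by linarith
  qed
  then show "AE x in S7_volume. norm (f x * g x) \<le> norm ((f x)\<^sup>2 + (g x)\<^sup>2)"
    by simp
qed

lemma L2_fun_add:
  assumes "L2_fun f" "L2_fun g"
  shows "L2_fun (\<lambda>x. f x + g x)"
  using assms L2_fun_mult[OF assms]
  by (auto simp: L2_fun_def power2_sum mult.assoc)

lemma L2_fun_scale: "L2_fun f \<Longrightarrow> L2_fun (\<lambda>x. c * f x)"
  by (auto simp: L2_fun_def power_mult_distrib)

quotient_type L2_S7 = "real ^ 8 \<Rightarrow> real" / partial: L2_eq
  morphisms L2_rep L2_class
proof (rule part_equivpI)
  show "\<exists>f. L2_eq f f"
    using L2_fun_zero by (auto simp: L2_eq_def)
  show "symp L2_eq"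
    by (auto simp: symp_def L2_eq_def)
  show "transp L2_eq"
    unfolding transp_def L2_eq_def by (auto elim: AE_mp)
qed

instantiation L2_S7 :: real_inner
begin

lift_definition zero_L2_S7 :: L2_S7 is "\<lambda>_. 0"
  by (simp add: L2_eq_def L2_fun_zero)

lift_definition plus_L2_S7 :: "L2_S7 \<Rightarrow> L2_S7 \<Rightarrow> L2_S7" is "\<lambda>f g x. f x + g x"
  by (auto simp: L2_eq_def L2_fun_add)

lift_definition uminus_L2_S7 :: "L2_S7 \<Rightarrow> L2_S7" is "\<lambda>f x. - f x"
  by (auto simp: L2_eq_def L2_fun_def)

lift_definition scaleR_L2_S7 :: "real \<Rightarrow> L2_S7 \<Rightarrow> L2_S7" is "\<lambda>c f x. c * f x"
  by (auto simp: L2_eq_def L2_fun_scale)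

lift_definition inner_L2_S7 :: "L2_S7 \<Rightarrow> L2_S7 \<Rightarrow> real"
  is "\<lambda>f g. LINT x|S7_volume. f x * g x"
  by (rule integral_cong_AE) (auto simp: L2_eq_def L2_fun_def)

definition minus_L2_S7 :: "L2_S7 \<Rightarrow> L2_S7 \<Rightarrow> L2_S7" where
  "minus_L2_S7 f g = f + - g"

definition norm_L2_S7 :: "L2_S7 \<Rightarrow> real" where
  "norm_L2_S7 f = sqrt (f \<bullet> f)"

definition sgn_L2_S7 :: "L2_S7 \<Rightarrow> L2_S7" where
  "sgn_L2_S7 f = inverse (norm f) *\<^sub>R f"

definition dist_L2_S7 :: "L2_S7 \<Rightarrow> L2_S7 \<Rightarrow> real" where
  "dist_L2_S7 f g = norm (f - g)"

definition uniformity_L2_S7 :: "(L2_S7 \<times> L2_S7) filter" where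
  "uniformity_L2_S7 = (INF e\<in>{0<..}. principal {(f, g). dist f g < e})"

definition open_L2_S7 :: "L2_S7 set \<Rightarrow> bool" where
  "open_L2_S7 U \<longleftrightarrow> (\<forall>f\<in>U. \<forall>\<^sub>F (f', g) in uniformity. f' = f \<longrightarrow> g \<in> U)"

instance
proof
  fix f g h :: L2_S7 and r s :: real
  show "f - g = f + - g"
    by (rule minus_L2_S7_def)
  show "dist f g = norm (f - g)"
    by (rule dist_L2_S7_def)
  show "sgn f = inverse (norm f) *\<^sub>R f"
    by (rule sgn_L2_S7_def)
  show "uniformity = (INF e\<in>{0<..}. principal {(f, g). dist f (g :: L2_S7) < e})"
    by (rule uniformity_L2_S7_def)
  show "open U \<longleftrightarrow> (\<forall>f\<in>U. \<forall>\<^sub>F (f', g) in uniformity. f' = f \<longrightarrow> g \<in> U)" for U :: "L2_S7 set"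
    by (rule open_L2_S7_def)
  show "norm f = sqrt (f \<bullet> f)"
    by (rule norm_L2_S7_def)
  show "f + g + h = f + (g + h)"
    by transfer (auto simp: L2_eq_def L2_fun_add algebra_simps)
  show "f + g = g + f"
    by transfer (auto simp: L2_eq_def L2_fun_add algebra_simps)
  show "0 + f = f"
    by transfer (auto simp: L2_eq_def)
  show "- f + f = 0"
    by transfer (auto simp: L2_eq_def L2_fun_zero)
  show "r *\<^sub>R (f + g) = r *\<^sub>R f + r *\<^sub>R g"
    by transfer (auto simp: L2_eq_def L2_fun_add L2_fun_scale algebra_simps
        dest: L2_fun_scale[of _ r] intro!: L2_fun_add)
  show "(r + s) *\<^sub>R f = r *\<^sub>R f + s *\<^sub>R f"
    by transfer (auto simp: L2_eq_def L2_fun_add L2_fun_scale distrib_right)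
  show "r *\<^sub>R s *\<^sub>R f = (r * s) *\<^sub>R f"
    by transfer (auto simp: L2_eq_def L2_fun_scale mult.assoc)
  show "1 *\<^sub>R f = f"
    by transfer (auto simp: L2_eq_def)
  show "f \<bullet> g = g \<bullet> f"
    by transfer (simp add: mult.commute)
  show "(f + g) \<bullet> h = f \<bullet> h + g \<bullet> h"
    by transfer (auto simp: L2_eq_def distrib_right L2_fun_mult)
  show "(r *\<^sub>R f) \<bullet> g = r * (f \<bullet> g)"
    by transfer (auto simp: L2_eq_def mult.assoc)
  show "0 \<le> f \<bullet> f"
    by transfer (auto simp: L2_eq_def)
  show "f \<bullet> f = 0 \<longleftrightarrow> f = 0"
  proof transfer
    fix f assume "L2_eq f f"
    then have int: "integrable S7_volume (\<lambda>x. f x * f x)" and f: "L2_fun f"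
      by (auto simp: L2_eq_def L2_fun_mult)
    have "(LINT x|S7_volume. f x * f x) = 0 \<longleftrightarrow> (AE x in S7_volume. f x * f x = 0)"
      by (rule integral_nonneg_eq_0_iff_AE[OF int]) simp
    then show "(LINT x|S7_volume. f x * f x) = 0 \<longleftrightarrow> L2_eq f (\<lambda>_. 0)"
      using f by (simp add: L2_eq_def L2_fun_zero)
  qed
qed

end


section \<open>Semigroups of operators\<close>

text \<open>Possibly unbounded operators are represented by their graphs.\<close>

definition C0_semigroup :: "(real \<Rightarrow> 'a \<Rightarrow> 'a :: real_normed_vector) \<Rightarrow> bool" where
  "C0_semigroup T \<longleftrightarrow>
     (\<forall>t\<ge>0. bounded_linear (T t)) \<and>
     (\<forall>f. T 0 f = f) \<and>
     (\<forall>s\<ge>0. \<forall>t\<ge>0. \<forall>f. T (s + t) f = T s (T t f)) \<and>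
     (\<forall>f. ((\<lambda>t. T t f) \<longlongrightarrow> f) (at_right 0))"

definition generator :: "(real \<Rightarrow> 'a \<Rightarrow> 'a :: real_normed_vector) \<Rightarrow> ('a \<times> 'a) set" where
  "generator T = {(f, g). ((\<lambda>t. (T t f - f) /\<^sub>R t) \<longlongrightarrow> g) (at_right 0)}"

text \<open>A differential operator \<open>D\<close> on smooth functions, seen as a densely defined operator on \<open>L\<^sup>2\<close>.
  It is not closed; a semigroup has infinitesimal generator \<open>D\<close> if its generator is the closure
  of this graph.\<close>

definition smooth_graph ::
  "((real ^ 8 \<Rightarrow> real) \<Rightarrow> real ^ 8 \<Rightarrow> real) \<Rightarrow> (L2_S7 \<times> L2_S7) set" where
  "smooth_graph D = {(L2_class F, L2_class (D F)) | F. smooth F}"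

text \<open>The graph of the operator written \<open>e\<^sup>-\<^sup>t\<^sup>D\<close>. In spite of the sign in that notation, the
  infinitesimal generator of the semigroup is \<open>D\<close> itself, with \<open>D\<close> a nonpositive operator such as
  \<open>div \<nabla>\<close>. For \<open>t < 0\<close> it is the (in general unbounded, densely defined) inverse of the operator
  at time \<open>-t\<close>; in particular the operator \<open>e\<^sup>t\<^sup>D\<close> obtained by replacing \<open>t\<close> with \<open>-t\<close> is
  \<open>exp_minus (-t) D\<close>.\<close>

definition exp_minus ::
  "real \<Rightarrow> ((real ^ 8 \<Rightarrow> real) \<Rightarrow> real ^ 8 \<Rightarrow> real) \<Rightarrow> (L2_S7 \<times> L2_S7) set" where
  "exp_minus t D =
     {(f, g). \<exists>T. C0_semigroup T \<and> generator T = closure (smooth_graph D) \<and>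
        (if 0 \<le> t then g = T t f else f = T (- t) g)}"

end

theory Submission
  imports Defs
begin

text \<open>Every \<open>X\<^sub>a\<close> is a linear vector field whose flow is by rotations, so it maps polynomials of degree
  at most \<open>n\<close> to such polynomials and is skew-symmetric in \<open>L\<^sup>2\<close>. On these finite-dimensional spaces
  \<open>X\<^sub>1\<^sup>2\<close> and \<open>X\<^sub>2\<^sup>2 + \<dots> + X\<^sub>7\<^sup>2\<close> are symmetric, nonpositive and commute, because the sum \<open>L\<close> of all
  seven squares agrees with the Laplace-Beltrami operator on the sphere and commutes with \<open>X\<^sub>1\<close>.
  Joint diagonalisation yields an orthonormal basis of \<open>L\<^sup>2\<close> consisting of polynomials, in which
  all three operators are diagonal. The closure of each smooth graph is then the maximal diagonal
  operator, it generates exactly one semigroup, namely the diagonal one, and the asserted identity holds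
  on each basis vector. As the semigroup of \<open>X\<^sub>1\<^sup>2\<close> has dense range, taking the closure gives the whole graph.\<close>

section \<open>Eigenvectors of the generator of a semigroup\<close>

text \<open>\<open>exp_minus\<close> quantifies over every semigroup with the given generator, so
  uniqueness has to be proved along with existence. \<open>C0_semigroup\<close> asks only for
  bounded operators and strong continuity at 0; a bound that is uniform on \<open>[0, t]\<close>
  must be derived, hence the uniform boundedness argument on a Banach space and the later proof that
  \<open>L2_S7\<close> is complete. Uniqueness is then obtained eigenvector by eigenvector: the
  generator fixes the semigroup on each of its eigenvectors, and bounded operators that agree on an
  orthonormal basis are equal. Commutation with \<open>X 1\<close> is proved for polynomials by
  induction on their linear factors. It rests on \<open>X_deriv 1\<close> turning
  \<open>x \<bullet> u\<close> into \<open>x \<bullet> (- X 1 u)\<close> and on the frame giving the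
  expression \<open>(norm x)\<^sup>2 * (u \<bullet> v) - (x \<bullet> u) * (x \<bullet> v)\<close>,
  which does not depend on the choice of frame. Distinct polynomials may agree on the sphere, so the
  operators on classes of polynomials first have to be shown well defined.\<close>

lemma has_real_derivative_at_right_quotient:
  assumes "(f has_real_derivative D) (at 0)"
  shows "((\<lambda>h. (f h - f 0) / h) \<longlongrightarrow> D) (at_right 0)"
  using has_field_derivative_at_within[OF assms, of "{0<..}"]
  by (simp add: has_field_derivative_iff)

text \<open>Take \<open>v\<close> of norm \<open>r\<close> on which \<open>T\<close> nearly attains
  its norm. As \<open>2 T v = T (x + v) - T (x - v)\<close>, one of \<open>x + v\<close> and
  \<open>x - v\<close> has an image at least as large as that of \<open>v\<close>, wherever
  \<open>x\<close> lies.\<close>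

lemma exists_far_value:
  fixes T :: "'a::real_normed_vector \<Rightarrow> 'b::real_normed_vector"
  assumes T: "bounded_linear T" and r: "0 < r" and pos: "0 < onorm T"
  shows "\<exists>y. norm (y - x) \<le> r \<and> 2 / 3 * r * onorm T \<le> norm (T y)"
proof -
  interpret T: bounded_linear T by fact
  have "\<exists>u. 2 / 3 * onorm T * norm u < norm (T u)"
  proof (rule ccontr)
    assume "\<not> ?thesis"
    then have "norm (T u) \<le> 2 / 3 * onorm T * norm u" for u
      by (simp add: not_less)
    then have "onorm T \<le> 2 / 3 * onorm T"
      using pos by (intro onorm_bound) auto
    then show False using pos by simp
  qed
  then obtain u where u: "2 / 3 * onorm T * norm u < norm (T u)" by blast
  then have u0: "0 < norm u"
    by (cases "u = 0") (auto simp: T.zero)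
  define v where "v = (r / norm u) *\<^sub>R u"
  have nv: "norm v = r" using u0 r by (simp add: v_def)
  have "norm (T v) = (r / norm u) * norm (T u)"
    using r by (simp add: v_def T.scaleR)
  moreover have "(r / norm u) * (2 / 3 * onorm T * norm u) \<le> (r / norm u) * norm (T u)"
    using u r u0 by (intro mult_left_mono) auto
  moreover have "(r / norm u) * (2 / 3 * onorm T * norm u) = 2 / 3 * r * onorm T"
    using u0 by simp
  ultimately have Tv: "2 / 3 * r * onorm T \<le> norm (T v)" by linarith
  have "2 *\<^sub>R T v = T (x + v) - T (x - v)"
    by (simp add: T.add T.diff scaleR_2)
  then have "2 * norm (T v) \<le> norm (T (x + v)) + norm (T (x - v))"
    by (metis norm_triangle_ineq4 norm_scaleR abs_numeral)
  then have "norm (T v) \<le> norm (T (x + v)) \<or> norm (T v) \<le> norm (T (x - v))"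
    by linarith
  then show ?thesis
  proof
    assume "norm (T v) \<le> norm (T (x + v))"
    then show ?thesis using Tv nv by (intro exI[of _ "x + v"]) auto
  next
    assume "norm (T v) \<le> norm (T (x - v))"
    then show ?thesis using Tv nv by (intro exI[of _ "x - v"]) auto
  qed
qed

text \<open>A gliding hump: each point is moved by at most a third of the previous step, so the limit
  stays within half a step of the point at which the \<open>n\<close>-th operator is large.\<close>

lemma unbounded_on_some_vector:
  fixes T :: "nat \<Rightarrow> 'a::banach \<Rightarrow> 'b::real_normed_vector"
  assumes T: "\<And>n. bounded_linear (T n)" and big: "\<And>n. 4 ^ n \<le> onorm (T n)"
  shows "\<exists>x. \<forall>n. (4 / 3) ^ n / 6 \<le> norm (T n x)"
proof -
  have pos: "0 < onorm (T n)" for n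
    using big[of n] by (rule less_le_trans[rotated]) simp
  obtain x where near: "norm (x (Suc n) - x n) \<le> (1 / 3) ^ n"
    and far: "2 / 3 * (1 / 3) ^ n * onorm (T n) \<le> norm (T n (x (Suc n)))" for n
  proof -
    have "\<exists>y. norm (y - x) \<le> (1 / 3) ^ n \<and> 2 / 3 * (1 / 3) ^ n * onorm (T n) \<le> norm (T n y)" for x n
      by (rule exists_far_value[OF T _ pos]) simp
    then show thesis
      using dependent_nat_choice[of "\<lambda>_ _. True" "\<lambda>n x y. norm (y - x) \<le> (1 / 3) ^ n \<and>
          2 / 3 * (1 / 3) ^ n * onorm (T n) \<le> norm (T n y)"] that by auto
  qed
  \<comment> \<open>Partial sum of the geometric series with ratio 1/3; its full sum is
    \<open>3 / 2 * (1 / 3) ^ m\<close>.\<close>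
  have step: "norm (x (m + k) - x m) \<le> 3 / 2 * (1 / 3) ^ m * (1 - (1 / 3) ^ k)" for m k
  proof (induction k)
    case (Suc k)
    have "norm (x (m + Suc k) - x m) \<le> norm (x (Suc (m + k)) - x (m + k)) + norm (x (m + k) - x m)"
      by (metis add_Suc_right norm_diff_triangle_le order_refl)
    also have "\<dots> \<le> (1 / 3) ^ (m + k) + 3 / 2 * (1 / 3) ^ m * (1 - (1 / 3) ^ k)"
      using near[of "m + k"] Suc by simp
    also have "\<dots> = 3 / 2 * (1 / 3) ^ m * (1 - (1 / 3) ^ Suc k)"
      by (simp add: power_add field_simps)
    finally show ?case .
  qed simp
  have step': "norm (x n - x m) \<le> 3 / 2 * (1 / 3) ^ m" if "m \<le> n" for m n
  proof -
    have "norm (x n - x m) \<le> 3 / 2 * (1 / 3) ^ m * (1 - (1 / 3) ^ (n - m))"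
      using step[of m "n - m"] that by simp
    also have "\<dots> \<le> 3 / 2 * (1 / 3) ^ m * 1"
      by (intro mult_left_mono) auto
    finally show ?thesis by simp
  qed
  have "Cauchy x"
  proof (rule metric_CauchyI)
    fix e :: real assume e: "0 < e"
    have "(\<lambda>m. 3 / 2 * (1 / 3 :: real) ^ m) \<longlonglongrightarrow> 3 / 2 * 0"
      by (intro tendsto_intros LIMSEQ_realpow_zero) auto
    then have "\<forall>\<^sub>F m in sequentially. 3 / 2 * (1 / 3 :: real) ^ m < e / 2"
      by (rule order_tendstoD) (use e in simp)
    then obtain M where M: "3 / 2 * (1 / 3 :: real) ^ M < e / 2"
      by (auto simp: eventually_sequentially)
    show "\<exists>M. \<forall>m\<ge>M. \<forall>n\<ge>M. dist (x m) (x n) < e"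
    proof (intro exI[of _ M] allI impI)
      fix m n assume "M \<le> m" "M \<le> n"
      then have "norm (x m - x M) < e / 2" "norm (x n - x M) < e / 2"
        using step' M by (meson le_less_trans)+
      then show "dist (x m) (x n) < e"
        unfolding dist_norm using norm_triangle_ineq4[of "x m - x M" "x n - x M"] by simp
    qed
  qed
  then obtain l where l: "x \<longlonglongrightarrow> l"
    by (meson Cauchy_convergent_iff convergent_def)
  have lim: "norm (l - x m) \<le> 3 / 2 * (1 / 3) ^ m" for m
  proof (rule tendsto_upperbound)
    show "(\<lambda>n. norm (x n - x m)) \<longlonglongrightarrow> norm (l - x m)"
      using l by (intro tendsto_intros)
    show "\<forall>\<^sub>F n in sequentially. norm (x n - x m) \<le> 3 / 2 * (1 / 3) ^ m"
      using step' by (auto simp: eventually_sequentially)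
  qed simp
  have "(4 / 3) ^ n / 6 \<le> norm (T n l)" for n
  proof -
    interpret T: bounded_linear "T n" by (rule T)
    have "norm (T n (l - x (Suc n))) \<le> onorm (T n) * norm (l - x (Suc n))"
      by (rule onorm[OF T])
    also have "\<dots> \<le> onorm (T n) * (3 / 2 * (1 / 3) ^ Suc n)"
      using pos[of n] by (intro mult_left_mono lim) auto
    finally have "norm (T n (x (Suc n)) - T n l) \<le> 1 / 2 * ((1 / 3) ^ n * onorm (T n))"
      by (simp add: T.diff norm_minus_commute mult_ac)
    \<comment> \<open>The limit is within
      \<open>3 / 2 * (1 / 3) ^ Suc n = 1 / 2 * (1 / 3) ^ n\<close> of \<open>x (Suc n)\<close>, so
      2/3 loses at most 1/2 and keeps 1/6. Norms growing like \<open>4 ^ n\<close> outrun the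
      shrinking steps.\<close>
    then have "1 / 6 * ((1 / 3) ^ n * onorm (T n)) \<le> norm (T n l)"
      using far[of n] norm_triangle_ineq2[of "T n (x (Suc n))" "T n l"] by (simp add: algebra_simps)
    moreover have "(1 / 3) ^ n * 4 ^ n \<le> (1 / 3) ^ n * onorm (T n)"
      by (intro mult_left_mono big) auto
    then have "(4 / 3) ^ n \<le> (1 / 3) ^ n * onorm (T n)"
      by (simp flip: power_mult_distrib)
    ultimately show ?thesis by simp
  qed
  then show ?thesis by blast
qed

text \<open>Otherwise there are times \<open>s n \<le> 1 / Suc n\<close> with norms at least
  \<open>4 ^ n\<close>, and one vector \<open>x\<close> on which \<open>T (s n) x\<close> is
  unbounded, against \<open>T (s n) x\<close> tending to \<open>x\<close>.\<close>

lemma C0_semigroup_locally_bounded: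
  fixes T :: "real \<Rightarrow> 'a::banach \<Rightarrow> 'a"
  assumes T: "C0_semigroup T"
  obtains d C where "0 < d" "\<And>s f. 0 \<le> s \<Longrightarrow> s \<le> d \<Longrightarrow> norm (T s f) \<le> C * norm f"
proof (rule ccontr)
  assume *: "\<not> thesis"
  have lin: "bounded_linear (T s)" if "0 \<le> s" for s
    using T that by (simp add: C0_semigroup_def)
  have "\<exists>s. 0 \<le> s \<and> s \<le> 1 / Suc n \<and> 4 ^ n \<le> onorm (T s)" for n
  proof (rule ccontr)
    assume "\<nexists>s. 0 \<le> s \<and> s \<le> 1 / Suc n \<and> 4 ^ n \<le> onorm (T s)"
    then have b: "onorm (T s) \<le> 4 ^ n" if "0 \<le> s" "s \<le> 1 / Suc n" for s
      using that by (meson linear)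
    have "norm (T s f) \<le> 4 ^ n * norm f" if "0 \<le> s" "s \<le> 1 / Suc n" for s f
      using onorm[OF lin[OF that(1)], of f] b[OF that] mult_right_mono[of _ _ "norm f"]
      by (meson norm_ge_zero order_trans)
    then show False
      using * that[of "1 / Suc n" "4 ^ n"] by simp
  qed
  then obtain s where s: "\<And>n. 0 \<le> s n" "\<And>n. s n \<le> 1 / Suc n" "\<And>n. 4 ^ n \<le> onorm (T (s n))"
    by metis
  obtain x where x: "\<And>n. (4 / 3) ^ n / 6 \<le> norm (T (s n) x)"
    using unbounded_on_some_vector[of "\<lambda>n. T (s n)"] lin s by blast
  have "s \<longlonglongrightarrow> 0"
    using s LIMSEQ_inverse_real_of_nat
    by (intro tendsto_sandwich[of "\<lambda>_. 0" s sequentially "\<lambda>n. inverse (Suc n)"])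
      (auto simp: inverse_eq_divide simp del: of_nat_Suc)
  \<comment> \<open>Some \<open>s n\<close> may be 0, which \<open>at_right 0\<close> excludes;
    \<open>T 0 x = x\<close> extends the limit to \<open>{0..}\<close>.\<close>
  have T0: "((\<lambda>t. T t x) \<longlongrightarrow> x) (at 0 within {0..})"
  proof -
    have "((\<lambda>t. T t x) \<longlongrightarrow> x) (at_right 0)" "T 0 x = x"
      using T by (auto simp: C0_semigroup_def)
    then show ?thesis
      by (metis at_within_Ici_at_right)
  qed
  have "(\<lambda>n. T (s n) x) \<longlonglongrightarrow> x"
  proof -
    have "continuous (at 0 within {0..}) (\<lambda>t. T t x)"
      using T0 T by (simp add: continuous_within C0_semigroup_def)
    then show ?thesis
      using s(1) \<open>s \<longlonglongrightarrow> 0\<close> T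
      by (auto simp: continuous_within_sequentially o_def C0_semigroup_def)
  qed
  then have "Bseq (\<lambda>n. T (s n) x)"
    by (intro convergent_imp_Bseq convergentI)
  then obtain K where K: "\<And>n. norm (T (s n) x) \<le> K"
    by (auto simp: Bseq_def)
  obtain n where "6 * K < (4 / 3 :: real) ^ n"
    using real_arch_pow[of "4 / 3" "6 * K"] by auto
  then show False
    using x[of n] K[of n] by linarith
qed

text \<open>The semigroup law cuts a time up to \<open>Suc n * d\<close> into at most
  \<open>Suc n\<close> pieces of length at most \<open>d\<close>, each costing one factor
  \<open>K\<close>.\<close>

lemma C0_semigroup_bounded_on_interval:
  fixes T :: "real \<Rightarrow> 'a::banach \<Rightarrow> 'a"
  assumes T: "C0_semigroup T"
  obtains C where "\<And>s f. 0 \<le> s \<Longrightarrow> s \<le> t \<Longrightarrow> norm (T s f) \<le> C * norm f"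
proof -
  obtain d C where d: "0 < d" and C: "\<And>s f. 0 \<le> s \<Longrightarrow> s \<le> d \<Longrightarrow> norm (T s f) \<le> C * norm f"
    using C0_semigroup_locally_bounded[OF T] by metis
  define K where "K = max C 1"
  have K: "norm (T s f) \<le> K * norm f" if "0 \<le> s" "s \<le> d" for s f
    using C[OF that, of f] mult_right_mono[of C K "norm f"] by (simp add: K_def)
  have K0: "0 \<le> K" by (simp add: K_def)
  have bound: "norm (T s f) \<le> K ^ Suc n * norm f" if "0 \<le> s" "s \<le> Suc n * d" for n s f
    using that
  proof (induction n arbitrary: s f)
    case 0
    then show ?case using K[of s f] by simp
  next
    case (Suc n)
    define r where "r = min s d"
    have r: "0 \<le> r" "r \<le> d" "0 \<le> s - r" "s - r \<le> Suc n * d"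
      using Suc.prems d by (auto simp: r_def algebra_simps min_def)
    have "T (r + (s - r)) f = T r (T (s - r) f)"
      using T r unfolding C0_semigroup_def by blast
    then have "T s f = T r (T (s - r) f)" by simp
    then have "norm (T s f) \<le> K * norm (T (s - r) f)"
      using K r by simp
    also have "\<dots> \<le> K * (K ^ Suc n * norm f)"
      using Suc.IH[OF r(3,4)] K0 by (intro mult_left_mono)
    finally show ?case by (simp add: mult.assoc)
  qed
  obtain n where "t < of_nat n * d"
    using reals_Archimedean3[OF d] by blast
  then have "t \<le> Suc n * d" using d by (simp add: algebra_simps)
  then show ?thesis
    using bound[of _ n] that by (meson order_trans)
qed

text \<open>Telescoping \<open>T t e - e\<close> over \<open>n\<close> steps of length \<open>t / n\<close> leaves \<open>n\<close> increments, each of which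
  is \<open>o (1 / n)\<close>.\<close>

lemma C0_semigroup_kernel:
  fixes T :: "real \<Rightarrow> 'a::banach \<Rightarrow> 'a"
  assumes T: "C0_semigroup T" and e: "(e, 0) \<in> generator T" and t: "0 \<le> t"
  shows "T t e = e"
proof (cases "t = 0")
  case True
  then show ?thesis using T by (simp add: C0_semigroup_def)
next
  case False
  with t have t0: "0 < t" by simp
  have lin: "linear (T s)" if "0 \<le> s" for s
    using T that by (simp add: C0_semigroup_def bounded_linear.linear)
  have add: "T (s + r) f = T s (T r f)" if "0 \<le> s" "0 \<le> r" for s r f
    using T that by (simp add: C0_semigroup_def)
  obtain C where C: "\<And>s f. 0 \<le> s \<Longrightarrow> s \<le> t \<Longrightarrow> norm (T s f) \<le> C * norm f"
    using C0_semigroup_bounded_on_interval[OF T] by metis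
  have telescope: "norm (T (k * h) e - e) \<le> k * (C * norm (T h e - e))"
    if "0 \<le> h" "k * h \<le> t" for h :: real and k :: nat
    using that
  proof (induction k)
    case 0
    then show ?case using T by (simp add: C0_semigroup_def)
  next
    case (Suc k)
    have kh: "0 \<le> k * h" "k * h \<le> t" using Suc.prems by (auto simp: algebra_simps)
    have "T (Suc k * h) e - T (k * h) e = T (k * h) (T h e - e)"
      using add[of "k * h" h e] Suc.prems(1) linear_diff[OF lin[OF kh(1)]]
      by (simp add: algebra_simps)
    then have "norm (T (Suc k * h) e - T (k * h) e) \<le> C * norm (T h e - e)"
      using C[OF kh] by metis
    moreover have "norm (T (Suc k * h) e - e) \<le>
        norm (T (Suc k * h) e - T (k * h) e) + norm (T (k * h) e - e)"
      by (metis norm_diff_triangle_le order_refl)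
    ultimately show ?case
      using Suc.IH[OF Suc.prems(1) kh(2)] by (simp add: algebra_simps)
  qed
  have lim: "((\<lambda>h. (T h e - e) /\<^sub>R h) \<longlongrightarrow> 0) (at_right 0)"
    using e by (simp add: generator_def)
  have "(\<lambda>n. (T (t / Suc n) e - e) /\<^sub>R (t / Suc n)) \<longlonglongrightarrow> 0"
  proof (rule filterlim_compose[OF lim])
    have "(\<lambda>n. t / real (Suc n)) \<longlonglongrightarrow> t * 0"
      using LIMSEQ_inverse_real_of_nat unfolding divide_inverse by (intro tendsto_intros) 
    then show "filterlim (\<lambda>n. t / Suc n) (at_right 0) sequentially"
      using t0 by (auto simp: filterlim_at)
  qed
  then have "(\<lambda>n. C * t * norm ((T (t / Suc n) e - e) /\<^sub>R (t / Suc n))) \<longlonglongrightarrow> C * t * 0"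
    by (intro tendsto_intros tendsto_norm_zero)
  moreover have "norm (T t e - e) \<le> C * t * norm ((T (t / Suc n) e - e) /\<^sub>R (t / Suc n))" for n
  proof -
    have "norm ((T (t / Suc n) e - e) /\<^sub>R (t / Suc n)) = Suc n / t * norm (T (t / Suc n) e - e)"
      using t0 by (simp add: divide_inverse)
    moreover have "norm (T t e - e) \<le> Suc n * (C * norm (T (t / Suc n) e - e))"
      using telescope[of "t / Suc n" "Suc n"] t0 by simp
    ultimately show ?thesis
      using t0 by (simp add: mult_ac)
  qed
  ultimately have "norm (T t e - e) \<le> 0"
    by (intro tendsto_lowerbound) (auto)
  then show ?thesis by simp
qed

text \<open>The rescaled family \<open>exp (- s * c) *\<^sub>R T s f\<close> is again a semigroup,
  and its generator sends \<open>e\<close> to 0; this reduces the claim to the kernel case.\<close>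

lemma C0_semigroup_eigenvector:
  fixes T :: "real \<Rightarrow> 'a::banach \<Rightarrow> 'a"
  assumes T: "C0_semigroup T" and e: "(e, c *\<^sub>R e) \<in> generator T" and t: "0 \<le> t"
  shows "T t e = exp (t * c) *\<^sub>R e"
proof -
  define S where "S s f = exp (- s * c) *\<^sub>R T s f" for s f
  have "C0_semigroup S"
    unfolding C0_semigroup_def
  proof (intro conjI allI impI)
    fix s r :: real and f
    show "bounded_linear (S s)" if "0 \<le> s"
      using T that unfolding S_def C0_semigroup_def by (intro bounded_linear_compose[OF bounded_linear_scaleR_right]) auto
    show "S 0 f = f"
      using T by (simp add: S_def C0_semigroup_def)
    show "S (s + r) f = S s (S r f)" if "0 \<le> s" "0 \<le> r"
    proof -
      have "linear (T s)"
        using T that by (simp add: C0_semigroup_def bounded_linear.linear)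
      moreover have "T (s + r) f = T s (T r f)"
        using T that unfolding C0_semigroup_def by blast
      moreover have "exp (- (s + r) * c) = exp (- s * c) * exp (- r * c)"
        by (simp add: ring_distribs flip: exp_add)
      ultimately show ?thesis
        by (simp add: S_def linear_scale)
    qed
    have "((\<lambda>t. exp (- t * c) *\<^sub>R T t f) \<longlongrightarrow> exp (- 0 * c) *\<^sub>R f) (at_right 0)"
      using T by (intro tendsto_intros) (simp add: C0_semigroup_def)
    then show "((\<lambda>t. S t f) \<longlongrightarrow> f) (at_right 0)"
      by (simp add: S_def)
  qed
  moreover have "(e, 0) \<in> generator S"
  proof -
    have "((\<lambda>h. exp (- h * c)) has_real_derivative - c) (at 0)"
      by (auto intro!: derivative_eq_intros)
    then have quot_lim: "((\<lambda>h. (exp (- h * c) - 1) / h) \<longlongrightarrow> - c) (at_right 0)"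
      by (auto dest: has_real_derivative_at_right_quotient)
    have T_lim: "((\<lambda>h. (T h e - e) /\<^sub>R h) \<longlongrightarrow> c *\<^sub>R e) (at_right 0)"
      using e by (simp add: generator_def)
    have exp_lim: "((\<lambda>h. exp (- h * c)) \<longlongrightarrow> exp (- 0 * c)) (at_right 0)"
      by (intro tendsto_intros)
    \<comment> \<open>Product rule at the level of difference quotients; the two limits
      \<open>c *\<^sub>R e\<close> and \<open>- c *\<^sub>R e\<close> cancel.\<close>
    have "((\<lambda>h. exp (- h * c) *\<^sub>R ((T h e - e) /\<^sub>R h) + ((exp (- h * c) - 1) / h) *\<^sub>R e)
        \<longlongrightarrow> exp (- 0 * c) *\<^sub>R (c *\<^sub>R e) + (- c) *\<^sub>R e) (at_right 0)"
      by (rule tendsto_add[OF tendsto_scaleR[OF exp_lim T_lim] tendsto_scaleR[OF quot_lim tendsto_const]])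
    moreover have "exp (- h * c) *\<^sub>R ((T h e - e) /\<^sub>R h) + ((exp (- h * c) - 1) / h) *\<^sub>R e
        = (S h e - e) /\<^sub>R h" for h
      by (simp add: S_def algebra_simps divide_inverse)
    ultimately show ?thesis
      by (simp add: generator_def)
  qed
  ultimately have "S t e = e"
    using t by (rule C0_semigroup_kernel)
  then have "exp (t * c) *\<^sub>R (exp (- t * c) *\<^sub>R T t e) = exp (t * c) *\<^sub>R e"
    by (simp add: S_def)
  then show ?thesis
    by (simp flip: exp_add)
qed

section \<open>Semigroups that are diagonal in an orthonormal basis\<close>

lemma norm_sum_orthonormal:
  fixes F :: "'a::real_inner set"
  assumes "finite F" and norm: "\<And>e. e \<in> F \<Longrightarrow> norm e = 1"
    and orth: "\<And>d e. d \<in> F \<Longrightarrow> e \<in> F \<Longrightarrow> d \<noteq> e \<Longrightarrow> d \<bullet> e = 0"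
  shows "(norm (\<Sum>e\<in>F. c e *\<^sub>R e))\<^sup>2 = (\<Sum>e\<in>F. (c e)\<^sup>2)"
proof -
  have "(\<Sum>e\<in>F. c e *\<^sub>R e) \<bullet> d = c d" if "d \<in> F" for d
  proof -
    have "(\<Sum>e\<in>F. c e *\<^sub>R e) \<bullet> d = (\<Sum>e\<in>F. if e = d then c d else 0)"
      unfolding inner_sum_left
      by (intro sum.cong refl) (use orth norm that in \<open>auto simp: norm_eq_1\<close>)
    then show ?thesis
      using that \<open>finite F\<close> by simp
  qed
  then show ?thesis
    by (subst power2_norm_eq_inner, subst inner_sum_right) (auto simp: power2_eq_square intro!: sum.cong)
qed

lemma bessel_inequality:
  fixes F :: "'a::real_inner set"
  assumes "finite F" and norm: "\<And>e. e \<in> F \<Longrightarrow> norm e = 1"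
    and orth: "\<And>d e. d \<in> F \<Longrightarrow> e \<in> F \<Longrightarrow> d \<noteq> e \<Longrightarrow> d \<bullet> e = 0"
  shows "(\<Sum>e\<in>F. (f \<bullet> e)\<^sup>2) \<le> (norm f)\<^sup>2"
proof -
  define p where "p = (\<Sum>e\<in>F. (f \<bullet> e) *\<^sub>R e)"
  have pp: "p \<bullet> p = (\<Sum>e\<in>F. (f \<bullet> e)\<^sup>2)"
    using norm_sum_orthonormal[OF assms, of "\<lambda>e. f \<bullet> e"]
    by (simp add: p_def power2_norm_eq_inner)
  have "f \<bullet> p = (\<Sum>e\<in>F. (f \<bullet> e)\<^sup>2)"
    by (simp add: p_def inner_sum_right power2_eq_square)
  then have "0 \<le> (norm f)\<^sup>2 - (\<Sum>e\<in>F. (f \<bullet> e)\<^sup>2)"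
    using inner_ge_zero[of "f - p"] pp
    by (simp add: inner_diff_left inner_diff_right inner_commute power2_norm_eq_inner)
  then show ?thesis by simp
qed

text \<open>The basis is a set without enumeration, so its series are unordered sums. Completeness
  of the system is stated as totality, which lets \<open>eqI\<close> compare vectors by their
  coefficients.\<close>

locale orthonormal_basis =
  fixes E :: "'a::{real_inner,banach} set"
  assumes norm_E: "e \<in> E \<Longrightarrow> norm e = 1"
    and orthogonal_E: "d \<in> E \<Longrightarrow> e \<in> E \<Longrightarrow> d \<noteq> e \<Longrightarrow> d \<bullet> e = 0"
    and total: "(\<And>e. e \<in> E \<Longrightarrow> f \<bullet> e = 0) \<Longrightarrow> f = 0"
begin

lemma eqI: "(\<And>e. e \<in> E \<Longrightarrow> f \<bullet> e = g \<bullet> e) \<Longrightarrow> f = g"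
  using total[of "f - g"] by (simp add: inner_diff_left)

lemma norm_sum: "finite F \<Longrightarrow> F \<subseteq> E \<Longrightarrow> (norm (\<Sum>e\<in>F. c e *\<^sub>R e))\<^sup>2 = (\<Sum>e\<in>F. (c e)\<^sup>2)"
  using norm_E orthogonal_E by (intro norm_sum_orthonormal) (auto simp: subset_iff)

lemma bessel: "finite F \<Longrightarrow> F \<subseteq> E \<Longrightarrow> (\<Sum>e\<in>F. (f \<bullet> e)\<^sup>2) \<le> (norm f)\<^sup>2"
  using norm_E orthogonal_E by (intro bessel_inequality) (auto simp: subset_iff)

text \<open>Riesz-Fischer: by Pythagoras the squared norm of a finite block of the series is the
  corresponding block of the sum of squares, so the partial sums form a Cauchy net.\<close>

lemma summable_on_basis:
  assumes c: "(\<lambda>e. (c e)\<^sup>2) summable_on E"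
  shows "(\<lambda>e. c e *\<^sub>R e) summable_on E"
proof -
  have "\<exists>P. eventually P (finite_subsets_at_top E) \<and>
      (\<forall>F G. P F \<and> P G \<longrightarrow> dist (\<Sum>e\<in>F. c e *\<^sub>R e) (\<Sum>e\<in>G. c e *\<^sub>R e) < \<epsilon>)" if "0 < \<epsilon>" for \<epsilon>
  proof -
    define S where "S = infsum (\<lambda>e. (c e)\<^sup>2) E"
    have "((\<lambda>e. (c e)\<^sup>2) has_sum S) E"
      using c by (simp add: S_def)
    then obtain F0 where F0: "finite F0" "F0 \<subseteq> E" "dist (\<Sum>e\<in>F0. (c e)\<^sup>2) S \<le> (\<epsilon> / 3)\<^sup>2"
      using has_sum_finite_approximation[of "\<lambda>e. (c e)\<^sup>2" E S "(\<epsilon> / 3)\<^sup>2"] \<open>0 < \<epsilon>\<close> by auto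
    have close: "norm ((\<Sum>e\<in>F. c e *\<^sub>R e) - (\<Sum>e\<in>F0. c e *\<^sub>R e)) \<le> \<epsilon> / 3"
      if F: "finite F" "F0 \<subseteq> F" "F \<subseteq> E" for F
    proof -
      have "(\<Sum>e\<in>F. (c e)\<^sup>2) \<le> S"
        unfolding S_def using F c by (intro finite_sum_le_infsum) auto
      then have "(\<Sum>e\<in>F - F0. (c e)\<^sup>2) \<le> (\<epsilon> / 3)\<^sup>2"
        using F0(1,3) F(1,2) unfolding sum_diff[OF F(1,2)] dist_real_def by linarith
      then have "(norm (\<Sum>e\<in>F - F0. c e *\<^sub>R e))\<^sup>2 \<le> (\<epsilon> / 3)\<^sup>2"
        using F by (subst norm_sum) auto
      then have "norm (\<Sum>e\<in>F - F0. c e *\<^sub>R e) \<le> \<epsilon> / 3"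
        by (rule power2_le_imp_le) (use \<open>0 < \<epsilon>\<close> in simp)
      then show ?thesis
        unfolding sum_diff[OF F(1,2)] .
    qed
    show ?thesis
    proof (intro exI conjI allI impI)
      show "\<forall>\<^sub>F F in finite_subsets_at_top E. finite F \<and> F0 \<subseteq> F \<and> F \<subseteq> E"
        using F0 by (auto simp: eventually_finite_subsets_at_top)
      fix F G assume "(finite F \<and> F0 \<subseteq> F \<and> F \<subseteq> E) \<and> finite G \<and> F0 \<subseteq> G \<and> G \<subseteq> E"
      then show "dist (\<Sum>e\<in>F. c e *\<^sub>R e) (\<Sum>e\<in>G. c e *\<^sub>R e) < \<epsilon>"
        using close[of F] close[of G] \<open>0 < \<epsilon>\<close>
          dist_triangle2[of "\<Sum>e\<in>F. c e *\<^sub>R e" "\<Sum>e\<in>G. c e *\<^sub>R e" "\<Sum>e\<in>F0. c e *\<^sub>R e"]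
        by (simp add: dist_norm)
    qed
  qed
  then have "cauchy_filter (filtermap (sum (\<lambda>e. c e *\<^sub>R e)) (finite_subsets_at_top E))"
    by (simp add: cauchy_filter_metric_filtermap)
  moreover have "complete (UNIV :: 'a set)"
    by (rule complete_UNIV)
  moreover have "filtermap (sum (\<lambda>e. c e *\<^sub>R e)) (finite_subsets_at_top E) \<noteq> bot"
    by (simp add: filtermap_bot_iff)
  ultimately obtain L where "(sum (\<lambda>e. c e *\<^sub>R e) \<longlongrightarrow> L) (finite_subsets_at_top E)"
    unfolding complete_uniform filterlim_def by (metis principal_UNIV top_greatest)
  then show ?thesis
    using summable_on_def has_sum_def by blast
qed

text \<open>The diagonal operator with eigenvalue \<open>m e\<close> on \<open>e\<close>. Where the
  series diverges \<open>infsum\<close> returns 0, so facts about it are stated for contractive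
  multipliers.\<close>

definition mult_op :: "('a \<Rightarrow> real) \<Rightarrow> 'a \<Rightarrow> 'a" where
  "mult_op m f = infsum (\<lambda>e. (m e * (f \<bullet> e)) *\<^sub>R e) E"

definition contractive :: "('a \<Rightarrow> real) \<Rightarrow> bool" where
  "contractive m \<longleftrightarrow> (\<forall>e\<in>E. \<bar>m e\<bar> \<le> 1)"

lemma has_sum_mult_op:
  assumes m: "contractive m"
  shows "((\<lambda>e. (m e * (f \<bullet> e)) *\<^sub>R e) has_sum mult_op m f) E"
proof -
  have "(\<Sum>e\<in>F. (m e * (f \<bullet> e))\<^sup>2) \<le> (norm f)\<^sup>2" if "finite F" "F \<subseteq> E" for F
  proof -
    have "(m e * (f \<bullet> e))\<^sup>2 \<le> (f \<bullet> e)\<^sup>2" if "e \<in> F" for e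
    proof -
      have "(m e)\<^sup>2 \<le> 1"
        using m that \<open>F \<subseteq> E\<close> by (auto simp: contractive_def abs_square_le_1)
      then show ?thesis
        by (simp add: power_mult_distrib mult_left_le_one_le)
    qed
    then have "(\<Sum>e\<in>F. (m e * (f \<bullet> e))\<^sup>2) \<le> (\<Sum>e\<in>F. (f \<bullet> e)\<^sup>2)"
      by (rule sum_mono)
    also have "\<dots> \<le> (norm f)\<^sup>2"
      by (rule bessel) fact+
    finally show ?thesis .
  qed
  then have "(\<lambda>e. (m e * (f \<bullet> e))\<^sup>2) summable_on E"
    by (intro nonneg_bdd_above_summable_on) (auto intro!: bdd_aboveI)
  then show ?thesis
    unfolding mult_op_def by (intro has_sum_infsum summable_on_basis)
qed

lemma inner_mult_op:
  assumes "contractive m" "d \<in> E"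
  shows "mult_op m f \<bullet> d = m d * (f \<bullet> d)"
proof (rule has_sum_unique)
  show "((\<lambda>e. ((m e * (f \<bullet> e)) *\<^sub>R e) \<bullet> d) has_sum mult_op m f \<bullet> d) E"
    using has_sum_bounded_linear[OF bounded_linear_inner_left has_sum_mult_op[OF assms(1)]] .
  have "((\<lambda>e. ((m e * (f \<bullet> e)) *\<^sub>R e) \<bullet> d) has_sum (\<Sum>e\<in>{d}. ((m e * (f \<bullet> e)) *\<^sub>R e) \<bullet> d)) E"
    using assms(2) orthogonal_E by (intro has_sum_finite_neutralI[of "{d}"]) auto
  then show "((\<lambda>e. ((m e * (f \<bullet> e)) *\<^sub>R e) \<bullet> d) has_sum m d * (f \<bullet> d)) E"
    using norm_E[OF assms(2)] by (simp add: norm_eq_1)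
qed

lemma contractive_1: "contractive (\<lambda>_. 1)"
  by (simp add: contractive_def)

lemma mult_op_1: "mult_op (\<lambda>_. 1) f = f"
  by (rule eqI) (simp add: inner_mult_op contractive_1)

lemma basis_expansion: "((\<lambda>e. (f \<bullet> e) *\<^sub>R e) has_sum f) E"
  using has_sum_mult_op[OF contractive_1, of f] by (simp add: mult_op_1)

lemma norm_mult_op:
  assumes m: "contractive m"
  shows "norm (mult_op m f) \<le> norm f"
proof (rule tendsto_upperbound)
  show "((\<lambda>F. norm (\<Sum>e\<in>F. (m e * (f \<bullet> e)) *\<^sub>R e)) \<longlongrightarrow> norm (mult_op m f)) (finite_subsets_at_top E)"
    using has_sum_mult_op[OF m, of f] by (intro tendsto_norm) (simp add: has_sum_def)
  show "\<forall>\<^sub>F F in finite_subsets_at_top E. norm (\<Sum>e\<in>F. (m e * (f \<bullet> e)) *\<^sub>R e) \<le> norm f"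
  proof (rule eventually_finite_subsets_at_top_weakI)
    fix F assume F: "finite F" "F \<subseteq> E"
    have "(norm (\<Sum>e\<in>F. (m e * (f \<bullet> e)) *\<^sub>R e))\<^sup>2 = (\<Sum>e\<in>F. (m e * (f \<bullet> e))\<^sup>2)"
      by (rule norm_sum[OF F])
    also have "\<dots> \<le> (\<Sum>e\<in>F. (mult_op m f \<bullet> e)\<^sup>2)"
      using F by (intro sum_mono) (auto simp: inner_mult_op[OF m])
    also have "\<dots> \<le> (\<Sum>e\<in>F. (f \<bullet> e)\<^sup>2)"
    proof (intro sum_mono)
      fix e assume "e \<in> F"
      then have "e \<in> E" using F by auto
      moreover from this have "(m e)\<^sup>2 \<le> 1"
        using m by (auto simp: contractive_def abs_square_le_1)
      ultimately show "(mult_op m f \<bullet> e)\<^sup>2 \<le> (f \<bullet> e)\<^sup>2"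
        by (simp add: inner_mult_op[OF m] power_mult_distrib mult_left_le_one_le)
    qed
    also have "\<dots> \<le> (norm f)\<^sup>2"
      by (rule bessel[OF F])
    finally show "norm (\<Sum>e\<in>F. (m e * (f \<bullet> e)) *\<^sub>R e) \<le> norm f"
      by (rule power2_le_imp_le) simp
  qed
qed simp

lemma bounded_linear_mult_op:
  assumes m: "contractive m"
  shows "bounded_linear (mult_op m)"
proof (rule bounded_linear_intro[where K = 1])
  show "mult_op m (f + g) = mult_op m f + mult_op m g" for f g
    by (rule eqI) (simp add: inner_mult_op[OF m] inner_add_left distrib_left)
  show "mult_op m (c *\<^sub>R f) = c *\<^sub>R mult_op m f" for c f
    by (rule eqI) (simp add: inner_mult_op[OF m])
  show "norm (mult_op m f) \<le> norm f * 1" for f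
    using norm_mult_op[OF m] by simp
qed

lemma mult_op_basis:
  assumes m: "contractive m" and "e \<in> E"
  shows "mult_op m e = m e *\<^sub>R e"
  by (rule eqI) (use assms orthogonal_E in \<open>auto simp: inner_mult_op[OF m]\<close>)

lemma bounded_linear_eqI:
  assumes S: "bounded_linear S" and T: "bounded_linear T"
    and eq: "\<And>e. e \<in> E \<Longrightarrow> S e = T e"
  shows "S f = T f"
proof (rule has_sum_unique)
  interpret S: bounded_linear S by fact
  interpret T: bounded_linear T by fact
  show "((\<lambda>e. S ((f \<bullet> e) *\<^sub>R e)) has_sum S f) E"
    using has_sum_bounded_linear[OF S basis_expansion] .
  have "((\<lambda>e. T ((f \<bullet> e) *\<^sub>R e)) has_sum T f) E"
    using has_sum_bounded_linear[OF T basis_expansion] .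
  then show "((\<lambda>e. S ((f \<bullet> e) *\<^sub>R e)) has_sum T f) E"
    by (rule has_sum_cong[THEN iffD1, rotated]) (simp add: S.scaleR T.scaleR eq)
qed

text \<open>On a finite partial sum \<open>g\<close> of the expansion of \<open>f\<close>,
  convergence of finitely many multipliers suffices. Contractivity, uniform in \<open>t\<close>,
  controls the image of the remainder \<open>f - g\<close>, so each of the three errors costs a
  quarter of \<epsilon>.\<close>

lemma tendsto_mult_op:
  assumes m: "\<forall>\<^sub>F t in \<F>. contractive (m t)"
    and lim: "\<And>e. e \<in> E \<Longrightarrow> ((\<lambda>t. m t e) \<longlongrightarrow> 1) \<F>"
  shows "((\<lambda>t. mult_op (m t) f) \<longlongrightarrow> f) \<F>"
proof (rule tendstoI)
  fix \<epsilon> :: real assume "0 < \<epsilon>"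
  then obtain F where F: "finite F" "F \<subseteq> E" "dist (\<Sum>e\<in>F. (f \<bullet> e) *\<^sub>R e) f \<le> \<epsilon> / 4"
    using has_sum_finite_approximation[OF basis_expansion[of f], of "\<epsilon> / 4"] by auto
  define g where "g = (\<Sum>e\<in>F. (f \<bullet> e) *\<^sub>R e)"
  have "((\<lambda>t. \<Sum>e\<in>F. (f \<bullet> e) *\<^sub>R (m t e *\<^sub>R e)) \<longlongrightarrow> (\<Sum>e\<in>F. (f \<bullet> e) *\<^sub>R (1 *\<^sub>R e))) \<F>"
    using F by (intro tendsto_intros lim) auto
  then have "\<forall>\<^sub>F t in \<F>. dist (\<Sum>e\<in>F. (f \<bullet> e) *\<^sub>R (m t e *\<^sub>R e)) g < \<epsilon> / 4"
    using \<open>0 < \<epsilon>\<close> by (intro tendstoD) (auto simp: g_def)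
  then show "\<forall>\<^sub>F t in \<F>. dist (mult_op (m t) f) f < \<epsilon>"
    using m
  proof eventually_elim
    case (elim t)
    interpret bounded_linear "mult_op (m t)"
      using elim by (intro bounded_linear_mult_op)
    have "mult_op (m t) g = (\<Sum>e\<in>F. (f \<bullet> e) *\<^sub>R (m t e *\<^sub>R e))"
      unfolding g_def sum scaleR using F elim by (intro sum.cong) (auto simp: mult_op_basis)
    then have "dist (mult_op (m t) g) g < \<epsilon> / 4"
      using elim by simp
    moreover have "dist (mult_op (m t) f) (mult_op (m t) g) \<le> \<epsilon> / 4"
      using norm_mult_op[of "m t" "f - g"] elim F by (simp add: dist_norm diff g_def norm_minus_commute)
    moreover have "dist g f \<le> \<epsilon> / 4"
      using F by (simp add: g_def)
    ultimately show ?case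
      using \<open>0 < \<epsilon>\<close> dist_triangle[of "mult_op (m t) f" f "mult_op (m t) g"]
        dist_triangle[of "mult_op (m t) g" f g] by linarith
  qed
qed

section \<open>Diagonal semigroups and their generators\<close>

lemma contractive_exp:
  "\<lbrakk>\<And>e. e \<in> E \<Longrightarrow> 0 \<le> a e; 0 \<le> t\<rbrakk> \<Longrightarrow> contractive (\<lambda>e. exp (- t * a e))"
  by (auto simp: contractive_def)

definition diag_semigroup :: "('a \<Rightarrow> real) \<Rightarrow> real \<Rightarrow> 'a \<Rightarrow> 'a" where
  "diag_semigroup a t = mult_op (\<lambda>e. exp (- t * a e))"

text \<open>The maximal diagonal operator: \<open>f\<close> lies in its domain as soon as some
  vector has the coefficients \<open>- a e * (f \<bullet> e)\<close>. The sign is chosen so that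
  nonpositive generators have \<open>a \<ge> 0\<close>.\<close>

definition diag_graph :: "('a \<Rightarrow> real) \<Rightarrow> ('a \<times> 'a) set" where
  "diag_graph a = {(f, g). \<forall>e\<in>E. g \<bullet> e = - a e * (f \<bullet> e)}"

context
  fixes a :: "'a \<Rightarrow> real"
  assumes nonneg: "e \<in> E \<Longrightarrow> 0 \<le> a e"
begin

lemma inner_diag_semigroup:
  "0 \<le> t \<Longrightarrow> e \<in> E \<Longrightarrow> diag_semigroup a t f \<bullet> e = exp (- t * a e) * (f \<bullet> e)"
  unfolding diag_semigroup_def by (rule inner_mult_op[OF contractive_exp]) (use nonneg in auto)

lemma bounded_linear_diag_semigroup: "0 \<le> t \<Longrightarrow> bounded_linear (diag_semigroup a t)"
  unfolding diag_semigroup_def by (rule bounded_linear_mult_op[OF contractive_exp]) (use nonneg in auto)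

lemma diag_semigroup_basis:
  assumes "0 \<le> t" "e \<in> E"
  shows "diag_semigroup a t e = exp (- t * a e) *\<^sub>R e"
  unfolding diag_semigroup_def using assms nonneg by (intro mult_op_basis contractive_exp) auto

lemma C0_semigroup_diag: "C0_semigroup (diag_semigroup a)"
  unfolding C0_semigroup_def
proof (intro conjI allI impI)
  fix s t :: real and f
  show "bounded_linear (diag_semigroup a t)" if "0 \<le> t"
    using that by (rule bounded_linear_diag_semigroup)
  show "diag_semigroup a 0 f = f"
    by (simp add: diag_semigroup_def mult_op_1)
  show "diag_semigroup a (s + t) f = diag_semigroup a s (diag_semigroup a t f)" if "0 \<le> s" "0 \<le> t"
    by (rule eqI) (use that in \<open>simp add: inner_diag_semigroup ring_distribs exp_diff exp_minus divide_inverse\<close>)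
  show "((\<lambda>t. diag_semigroup a t f) \<longlongrightarrow> f) (at_right 0)"
    unfolding diag_semigroup_def
  proof (rule tendsto_mult_op)
    show "\<forall>\<^sub>F t in at_right 0. contractive (\<lambda>e. exp (- t * a e))"
      using eventually_at_right_less[of "0::real"] by eventually_elim (rule contractive_exp[OF nonneg], auto)
    show "((\<lambda>t. exp (- t * a e)) \<longlongrightarrow> 1) (at_right 0)" for e
      by (auto intro!: tendsto_eq_intros)
  qed
qed

text \<open>For \<open>(f, g)\<close> in the graph, the difference quotient of the semigroup at \<open>f\<close> is the multiplier
  \<open>(1 - exp (- t a)) / (t a)\<close> applied to \<open>g\<close>; it stays in \<open>[0, 1]\<close>.\<close>

lemma generator_diag: "generator (diag_semigroup a) = diag_graph a"
proof (intro set_eqI iffI; clarify)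
  fix f g assume "(f, g) \<in> generator (diag_semigroup a)"
  then have lim: "((\<lambda>t. (diag_semigroup a t f - f) /\<^sub>R t) \<longlongrightarrow> g) (at_right 0)"
    by (simp add: generator_def)
  have "g \<bullet> e = - a e * (f \<bullet> e)" if e: "e \<in> E" for e
  proof (rule tendsto_unique)
    show "((\<lambda>t. ((diag_semigroup a t f - f) /\<^sub>R t) \<bullet> e) \<longlongrightarrow> g \<bullet> e) (at_right 0)"
      by (intro tendsto_intros lim)
    have "((\<lambda>t. exp (- t * a e)) has_real_derivative - a e) (at 0)"
      by (auto intro!: derivative_eq_intros)
    then have "((\<lambda>t. (exp (- t * a e) - 1) / t) \<longlongrightarrow> - a e) (at_right 0)"
      by (auto dest: has_real_derivative_at_right_quotient)
    then have "((\<lambda>t. (exp (- t * a e) - 1) / t * (f \<bullet> e)) \<longlongrightarrow> - a e * (f \<bullet> e)) (at_right 0)"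
      by (intro tendsto_intros)
    moreover have "\<forall>\<^sub>F t in at_right 0. (exp (- t * a e) - 1) / t * (f \<bullet> e) =
        ((diag_semigroup a t f - f) /\<^sub>R t) \<bullet> e"
      using eventually_at_right_less[of "0::real"]
      by eventually_elim (use e in \<open>simp add: inner_diff_left inner_diag_semigroup divide_inverse algebra_simps\<close>)
    ultimately show "((\<lambda>t. ((diag_semigroup a t f - f) /\<^sub>R t) \<bullet> e) \<longlongrightarrow> - a e * (f \<bullet> e)) (at_right 0)"
      by (rule Lim_transform_eventually)
  qed simp
  then show "(f, g) \<in> diag_graph a"
    by (simp add: diag_graph_def)
next
  fix f g assume "(f, g) \<in> diag_graph a"
  then have g: "g \<bullet> e = - a e * (f \<bullet> e)" if "e \<in> E" for e
    using that by (simp add: diag_graph_def)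
  \<comment> \<open>The value 1 at 0 serves basis vectors with \<open>a e = 0\<close>: the quotient
    itself would evaluate to 0 there, while \<open>tendsto_mult_op\<close> wants every multiplier to
    tend to 1.\<close>
  define \<phi> where "\<phi> s = (if s = 0 then 1 else (1 - exp (- s)) / s)" for s :: real
  have \<phi>: "\<bar>\<phi> s\<bar> \<le> 1" if "0 \<le> s" for s
  proof (cases "s = 0")
    case False
    then have "0 \<le> 1 - exp (- s)" "1 - exp (- s) \<le> s"
      using that exp_ge_add_one_self[of "- s"] by auto
    then show ?thesis using False that by (simp add: \<phi>_def)
  qed (simp add: \<phi>_def)
  have lim\<phi>: "((\<lambda>t. \<phi> (t * c)) \<longlongrightarrow> 1) (at_right 0)" for c
  proof (cases "c = 0")
    case False
    have "((\<lambda>t. - exp (- t * c) / c) has_real_derivative 1) (at 0)"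
      using False by (auto intro!: derivative_eq_intros)
    then have "((\<lambda>t. (- exp (- t * c) / c + 1 / c) / t) \<longlongrightarrow> 1) (at_right 0)"
      by (auto dest: has_real_derivative_at_right_quotient)
    moreover have "\<forall>\<^sub>F t in at_right 0. (- exp (- t * c) / c + 1 / c) / t = \<phi> (t * c)"
      using eventually_at_right_less[of "0::real"]
      by eventually_elim (use False in \<open>simp add: \<phi>_def field_simps\<close>)
    ultimately show ?thesis
      by (rule Lim_transform_eventually)
  qed (simp add: \<phi>_def)
  have con: "contractive (\<lambda>e. \<phi> (t * a e))" if "0 < t" for t
    using \<phi> nonneg that by (simp add: contractive_def)
  have "((\<lambda>t. mult_op (\<lambda>e. \<phi> (t * a e)) g) \<longlongrightarrow> g) (at_right 0)"
  proof (rule tendsto_mult_op)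
    show "\<forall>\<^sub>F t in at_right 0. contractive (\<lambda>e. \<phi> (t * a e))"
      using eventually_at_right_less[of "0::real"] by eventually_elim (rule con)
  qed (rule lim\<phi>)
  moreover have "\<forall>\<^sub>F t in at_right 0. mult_op (\<lambda>e. \<phi> (t * a e)) g = (diag_semigroup a t f - f) /\<^sub>R t"
    using eventually_at_right_less[of "0::real"]
  proof eventually_elim
    case (elim t)
    show ?case
    proof (rule eqI)
      fix e assume e: "e \<in> E"
      have "mult_op (\<lambda>e. \<phi> (t * a e)) g \<bullet> e = - \<phi> (t * a e) * a e * (f \<bullet> e)"
        using con[OF elim] e by (simp add: inner_mult_op g)
      also have "\<dots> = (exp (- t * a e) - 1) / t * (f \<bullet> e)"
        using elim by (simp add: \<phi>_def field_simps)
      also have "\<dots> = ((diag_semigroup a t f - f) /\<^sub>R t) \<bullet> e"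
        using elim e by (simp add: inner_diff_left inner_diag_semigroup divide_inverse algebra_simps)
      finally show "mult_op (\<lambda>e. \<phi> (t * a e)) g \<bullet> e = ((diag_semigroup a t f - f) /\<^sub>R t) \<bullet> e" .
    qed
  qed
  ultimately have "((\<lambda>t. (diag_semigroup a t f - f) /\<^sub>R t) \<longlongrightarrow> g) (at_right 0)"
    by (rule Lim_transform_eventually)
  then show "(f, g) \<in> generator (diag_semigroup a)"
    by (simp add: generator_def)
qed

text \<open>Each pair \<open>(e, - a e *\<^sub>R e)\<close> lies in the generator of
  \<open>T\<close>, which determines \<open>T t\<close> on the basis; boundedness extends the
  equality to all vectors.\<close>

lemma semigroup_eq_diag:
  assumes T: "C0_semigroup T" and gen: "generator T = diag_graph a" and t: "0 \<le> t"
  shows "T t f = diag_semigroup a t f"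
proof (rule bounded_linear_eqI[where S = "T t" and T = "diag_semigroup a t"])
  show "bounded_linear (T t)"
    using T t by (simp add: C0_semigroup_def)
  show "bounded_linear (diag_semigroup a t)"
    using t by (rule bounded_linear_diag_semigroup)
  fix e assume e: "e \<in> E"
  have "(e, (- a e) *\<^sub>R e) \<in> generator T"
    unfolding gen diag_graph_def using orthogonal_E e by auto
  then have "T t e = exp (t * - a e) *\<^sub>R e"
    using C0_semigroup_eigenvector[OF T _ t] by blast
  then show "T t e = diag_semigroup a t e"
    using e t by (simp add: diag_semigroup_basis)
qed

text \<open>The diagonal graph is an intersection of closed conditions, one for each basis vector.
  Conversely, for \<open>(f, g)\<close> in it, the partial sums of both expansions over the same
  finite set combine pairs \<open>(e, - a e *\<^sub>R e)\<close> and so lie in \<open>S\<close>: the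
  basis spans a core.\<close>

lemma closure_eq_diag_graph:
  assumes S: "subspace S" and sub: "S \<subseteq> diag_graph a"
    and basis: "\<And>e. e \<in> E \<Longrightarrow> (e, - a e *\<^sub>R e) \<in> S"
  shows "closure S = diag_graph a"
proof
  have "closed (diag_graph a)"
  proof -
    have "diag_graph a = (\<Inter>e\<in>E. {x. snd x \<bullet> e = - a e * (fst x \<bullet> e)})"
      by (auto simp: diag_graph_def)
    moreover have "closed {x. snd x \<bullet> e = - a e * (fst x \<bullet> e)}" for e
      by (intro closed_Collect_eq continuous_intros)
    ultimately show ?thesis by auto
  qed
  then show "closure S \<subseteq> diag_graph a"
    using sub by (rule closure_minimal[rotated])
  show "diag_graph a \<subseteq> closure S"
  proof clarify
    fix f g assume "(f, g) \<in> diag_graph a"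
    then have g: "g \<bullet> e = - a e * (f \<bullet> e)" if "e \<in> E" for e
      using that by (simp add: diag_graph_def)
    have lim: "((\<lambda>F. (\<Sum>e\<in>F. (f \<bullet> e) *\<^sub>R e, \<Sum>e\<in>F. (g \<bullet> e) *\<^sub>R e)) \<longlongrightarrow> (f, g)) (finite_subsets_at_top E)"
      using basis_expansion by (intro tendsto_Pair) (auto simp: has_sum_def)
    show "(f, g) \<in> closure S"
    proof (rule Lim_in_closed_set[OF closed_closure _ _ lim])
      show "\<forall>\<^sub>F F in finite_subsets_at_top E.
          (\<Sum>e\<in>F. (f \<bullet> e) *\<^sub>R e, \<Sum>e\<in>F. (g \<bullet> e) *\<^sub>R e) \<in> closure S"
      proof (rule eventually_finite_subsets_at_top_weakI)
        fix F assume F: "finite F" "F \<subseteq> E"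
        have "(\<Sum>e\<in>F. (f \<bullet> e) *\<^sub>R (e, - a e *\<^sub>R e)) \<in> S"
          using F basis by (intro subspace_sum[OF S] subspace_scale[OF S]) auto
        also have "(\<Sum>e\<in>F. (f \<bullet> e) *\<^sub>R (e, - a e *\<^sub>R e)) =
            (\<Sum>e\<in>F. (f \<bullet> e) *\<^sub>R e, \<Sum>e\<in>F. (g \<bullet> e) *\<^sub>R e)"
          unfolding prod_eq_iff fst_sum snd_sum
          using F g by (auto intro!: sum.cong simp: subset_iff mult.commute)
        finally show "(\<Sum>e\<in>F. (f \<bullet> e) *\<^sub>R e, \<Sum>e\<in>F. (g \<bullet> e) *\<^sub>R e) \<in> closure S"
          using closure_subset by blast
      qed
    qed simp
  qed
qed

end

lemma diag_semigroup_compose: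
  fixes a b :: "'a \<Rightarrow> real"
  assumes a: "\<And>e. e \<in> E \<Longrightarrow> 0 \<le> a e" and b: "\<And>e. e \<in> E \<Longrightarrow> 0 \<le> b e" and t: "0 \<le> t"
  shows "diag_semigroup (\<lambda>e. a e + b e) t f = diag_semigroup a t (diag_semigroup b t f)"
  by (rule eqI) (use assms in \<open>simp add: inner_diag_semigroup ring_distribs exp_diff exp_minus divide_inverse\<close>)

text \<open>The exponentials never vanish, so the range of one semigroup contains the basis and is dense.\<close>

lemma diag_semigroup_graph_closure:
  fixes a b :: "'a \<Rightarrow> real"
  assumes a: "\<And>e. e \<in> E \<Longrightarrow> 0 \<le> a e" and b: "\<And>e. e \<in> E \<Longrightarrow> 0 \<le> b e" and t: "0 \<le> t"
  shows "closure {(diag_semigroup b t h, diag_semigroup (\<lambda>e. a e + b e) t h) | h. True}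
    = {(f, diag_semigroup a t f) | f. True}" (is "closure ?R = ?G")
proof
  interpret Ta: bounded_linear "diag_semigroup a t"
    using a t by (rule bounded_linear_diag_semigroup)
  interpret Tb: bounded_linear "diag_semigroup b t"
    using b t by (rule bounded_linear_diag_semigroup)
  have "closed ?G"
  proof -
    have "?G = {x. snd x = diag_semigroup a t (fst x)}"
      by auto
    then show ?thesis
      by (simp add: closed_Collect_eq Ta.continuous_on continuous_on_fst continuous_on_snd)
  qed
  moreover have "?R \<subseteq> ?G"
    using diag_semigroup_compose[of a b t, OF a b t] by auto
  ultimately show "closure ?R \<subseteq> ?G"
    by (rule closure_minimal[rotated])
  show "?G \<subseteq> closure ?R"
  proof clarify
    fix f
    have lim: "((\<lambda>F. (\<Sum>e\<in>F. (f \<bullet> e) *\<^sub>R e, diag_semigroup a t (\<Sum>e\<in>F. (f \<bullet> e) *\<^sub>R e))) \<longlongrightarrow>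
        (f, diag_semigroup a t f)) (finite_subsets_at_top E)"
      using basis_expansion by (intro tendsto_Pair Ta.tendsto) (auto simp: has_sum_def)
    show "(f, diag_semigroup a t f) \<in> closure ?R"
    proof (rule Lim_in_closed_set[OF closed_closure _ _ lim])
      show "\<forall>\<^sub>F F in finite_subsets_at_top E.
          (\<Sum>e\<in>F. (f \<bullet> e) *\<^sub>R e, diag_semigroup a t (\<Sum>e\<in>F. (f \<bullet> e) *\<^sub>R e)) \<in> closure ?R"
      proof (rule eventually_finite_subsets_at_top_weakI)
        fix F assume F: "finite F" "F \<subseteq> E"
        \<comment> \<open>The growing factors \<open>exp (t * b e)\<close> undo the semigroup of
          \<open>b\<close>; the sum is finite, so no convergence is at stake.\<close>
        define h where "h = (\<Sum>e\<in>F. (exp (t * b e) * (f \<bullet> e)) *\<^sub>R e)"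
        have "diag_semigroup b t h = (\<Sum>e\<in>F. (f \<bullet> e) *\<^sub>R e)"
          unfolding h_def Tb.sum Tb.scaleR using F b t
          by (intro sum.cong refl) (auto simp: diag_semigroup_basis subset_iff exp_minus)
        then have "(\<Sum>e\<in>F. (f \<bullet> e) *\<^sub>R e, diag_semigroup a t (\<Sum>e\<in>F. (f \<bullet> e) *\<^sub>R e)) \<in> ?R"
          unfolding mem_Collect_eq
          by (intro exI[of _ h]) (simp add: diag_semigroup_compose[of a b t h, OF a b t])
        then show "(\<Sum>e\<in>F. (f \<bullet> e) *\<^sub>R e, diag_semigroup a t (\<Sum>e\<in>F. (f \<bullet> e) *\<^sub>R e)) \<in> closure ?R"
          by (rule subsetD[OF closure_subset])
      qed
    qed simp
  qed
qed

end

section \<open>Joint eigenvectors of commuting symmetric operators\<close>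

definition orthonormal :: "'a::real_inner set \<Rightarrow> bool" where
  "orthonormal F \<longleftrightarrow> (\<forall>e\<in>F. norm e = 1) \<and> (\<forall>d\<in>F. \<forall>e\<in>F. d \<noteq> e \<longrightarrow> d \<bullet> e = 0)"

lemma orthonormal_residual:
  assumes "finite F" "orthonormal F" "d \<in> F"
  shows "(x - (\<Sum>e\<in>F. (x \<bullet> e) *\<^sub>R e)) \<bullet> d = 0"
proof -
  have "(\<Sum>e\<in>F. (x \<bullet> e) *\<^sub>R e) \<bullet> d = (\<Sum>e\<in>F. if e = d then x \<bullet> d else 0)"
    unfolding inner_sum_left
    by (intro sum.cong refl) (use assms in \<open>auto simp: orthonormal_def norm_eq_1\<close>)
  then show ?thesis
    using assms by (simp add: inner_diff_left)
qed

lemma orthogonal_to_span: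
  assumes "\<And>d. d \<in> F \<Longrightarrow> z \<bullet> d = 0" "x \<in> span F"
  shows "z \<bullet> x = 0"
  using assms(2,1) by (induction rule: span_induct_alt) (auto simp: inner_add_right)

lemma orthonormal_expansion:
  assumes F: "finite F" "orthonormal F" and x: "x \<in> span F"
  shows "x = (\<Sum>e\<in>F. (x \<bullet> e) *\<^sub>R e)"
proof -
  define z where "z = x - (\<Sum>e\<in>F. (x \<bullet> e) *\<^sub>R e)"
  have "z \<in> span F"
    unfolding z_def using x by (intro span_diff span_sum span_scale) (auto intro: span_base)
  moreover have "z \<bullet> d = 0" if "d \<in> F" for d
    unfolding z_def using orthonormal_residual[OF F that] .
  ultimately have "z \<bullet> z = 0"
    by (metis orthogonal_to_span)
  then show ?thesis by (simp add: z_def)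
qed

lemma orthonormal_independent: "orthonormal F \<Longrightarrow> independent F"
  by (rule pairwise_orthogonal_independent) (auto simp: orthonormal_def pairwise_def orthogonal_def)

lemma exists_orthonormal_basis:
  fixes V :: "'a::real_inner set"
  assumes V: "subspace V" and "finite B" "V \<subseteq> span B"
  obtains F where "finite F" "orthonormal F" "span F = V"
proof -
  obtain B' where B': "B' \<subseteq> V" "independent B'" "V \<subseteq> span B'"
    using maximal_independent_subset[of V] by blast
  have "finite B'"
    using independent_span_bound[OF \<open>finite B\<close> B'(2)] B'(1) assms(3) by blast
  then obtain C where C: "finite C" "span C = span B'" "pairwise orthogonal C"
    using basis_orthogonal[of B'] by blast
  \<comment> \<open>Pairwise orthogonality permits the zero vector in \<open>C\<close>; it is
    removed before normalising.\<close>
  define F where "F = (\<lambda>c. c /\<^sub>R norm c) ` (C - {0})"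
  show thesis
  proof
    show "finite F" using C by (simp add: F_def)
    show "orthonormal F"
      unfolding orthonormal_def
    proof safe
      show "norm e = 1" if "e \<in> F" for e
        using that by (auto simp: F_def field_simps split: if_splits)
      fix d e assume "d \<in> F" "e \<in> F" "d \<noteq> e"
      then obtain c c' where "c \<in> C" "c' \<in> C" "d = c /\<^sub>R norm c" "e = c' /\<^sub>R norm c'"
        by (auto simp: F_def)
      then show "d \<bullet> e = 0"
        using C(3) \<open>d \<noteq> e\<close> unfolding pairwise_def orthogonal_def by (metis inner_scaleR_left inner_scaleR_right mult_zero_right)
    qed
    have "C \<subseteq> span F"
    proof
      fix c assume c: "c \<in> C"
      show "c \<in> span F"
      proof (cases "c = 0")
        case True
        then show ?thesis by (simp add: span_zero)
      next
        case False
        then have "norm c *\<^sub>R (c /\<^sub>R norm c) \<in> span F"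
          using c by (intro span_scale span_base) (auto simp: F_def)
        then show ?thesis using False by simp
      qed
    qed
    moreover have "F \<subseteq> span C"
      by (auto simp: F_def intro: span_scale[OF span_base])
    ultimately have "span F = span C"
      by (meson span_minimal subset_antisym subspace_span)
    also have "\<dots> = V"
      using B' C V by (metis span_minimal subset_antisym)
    finally show "span F = V" .
  qed
qed

lemma exists_orthogonal_to_subspace:
  fixes V :: "'a::real_inner set"
  assumes W: "subspace W" "W \<subset> V" and V: "subspace V" "finite B" "V \<subseteq> span B"
  obtains z where "z \<in> V" "z \<noteq> 0" "\<And>w. w \<in> W \<Longrightarrow> z \<bullet> w = 0"
proof -
  have "W \<subseteq> span B" using W V by blast
  then obtain F where F: "finite F" "orthonormal F" "span F = W"
    using exists_orthonormal_basis[OF W(1) V(2)] by metis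
  obtain x where x: "x \<in> V" "x \<notin> W" using W by blast
  define z where "z = x - (\<Sum>e\<in>F. (x \<bullet> e) *\<^sub>R e)"
  have "(\<Sum>e\<in>F. (x \<bullet> e) *\<^sub>R e) \<in> W"
    unfolding F(3)[symmetric] by (intro span_sum span_scale span_base)
  then have "z \<in> V" "z \<noteq> 0"
    using x W(2) subspace_diff[OF V(1) x(1)] unfolding z_def by auto
  moreover have "z \<bullet> w = 0" if "w \<in> W" for w
  proof (rule orthogonal_to_span)
    show "w \<in> span F" using that F(3) by simp
    show "z \<bullet> d = 0" if "d \<in> F" for d
      unfolding z_def by (rule orthonormal_residual[OF F(1,2) that])
  qed
  ultimately show thesis using that by blast
qed

text \<open>Every condition, linearity included, is relative to \<open>V\<close>: the operators
  \<open>L2_op\<close> used later are controlled only on classes of polynomials and are arbitrary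
  choices elsewhere.\<close>

definition symmetric_on :: "'a::real_inner set \<Rightarrow> ('a \<Rightarrow> 'a) \<Rightarrow> bool" where
  "symmetric_on V A \<longleftrightarrow> (\<forall>u\<in>V. A u \<in> V) \<and> (\<forall>u\<in>V. \<forall>v\<in>V. A (u + v) = A u + A v) \<and>
     (\<forall>c. \<forall>u\<in>V. A (c *\<^sub>R u) = c *\<^sub>R A u) \<and> (\<forall>u\<in>V. \<forall>v\<in>V. A u \<bullet> v = u \<bullet> A v)"

lemma symmetric_onD:
  assumes "symmetric_on V A" "u \<in> V"
  shows "A u \<in> V" "v \<in> V \<Longrightarrow> A (u + v) = A u + A v" "A (c *\<^sub>R u) = c *\<^sub>R A u"
    "v \<in> V \<Longrightarrow> A u \<bullet> v = u \<bullet> A v"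
  using assms by (auto simp: symmetric_on_def)

lemma symmetric_on_sum:
  assumes A: "symmetric_on V A" and V: "subspace V" and "finite F" "F \<subseteq> V"
  shows "A (\<Sum>e\<in>F. c e *\<^sub>R e) = (\<Sum>e\<in>F. c e *\<^sub>R A e)"
  using assms(3,4)
proof (induction rule: finite_induct)
  case empty
  have "A (0 *\<^sub>R 0) = 0 *\<^sub>R A 0"
    using symmetric_onD(3)[OF A subspace_0[OF V]] .
  then show ?case by simp
next
  case (insert e F)
  have "(\<Sum>e\<in>F. c e *\<^sub>R e) \<in> V"
    using insert by (intro subspace_sum[OF V] subspace_scale[OF V]) auto
  moreover have "c e *\<^sub>R e \<in> V"
    using insert by (intro subspace_scale[OF V]) auto
  ultimately show ?case
    using insert symmetric_onD(2)[OF A] symmetric_onD(3)[OF A, of e] by simp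
qed

lemma symmetric_on_bounded:
  assumes A: "symmetric_on V A" and V: "subspace V" "finite B" "V \<subseteq> span B"
  obtains K where "0 < K" "\<And>u. u \<in> V \<Longrightarrow> norm (A u) \<le> K * norm u"
proof -
  obtain F where F: "finite F" "orthonormal F" "span F = V"
    using exists_orthonormal_basis[OF V] by metis
  have FV: "F \<subseteq> V" using F(3) span_superset by blast
  define K where "K = 1 + (\<Sum>e\<in>F. norm (A e))"
  have "0 < K" by (simp add: K_def add_pos_nonneg sum_nonneg)
  moreover have "norm (A u) \<le> K * norm u" if "u \<in> V" for u
  proof -
    have "u = (\<Sum>e\<in>F. (u \<bullet> e) *\<^sub>R e)"
      using orthonormal_expansion[OF F(1,2)] that F(3) by blast
    then have "A u = (\<Sum>e\<in>F. (u \<bullet> e) *\<^sub>R A e)"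
      using symmetric_on_sum[OF A V(1) F(1) FV] by metis
    also have "norm \<dots> \<le> (\<Sum>e\<in>F. norm u * norm (A e))"
    proof (rule sum_norm_le)
      fix e assume "e \<in> F"
      then have "\<bar>u \<bullet> e\<bar> \<le> norm u"
        using Cauchy_Schwarz_ineq2[of u e] F(2) by (simp add: orthonormal_def)
      then show "norm ((u \<bullet> e) *\<^sub>R A e) \<le> norm u * norm (A e)"
        by (simp add: mult_right_mono)
    qed
    also have "\<dots> \<le> K * norm u"
      by (simp add: K_def distrib_right flip: sum_distrib_left)
    finally show ?thesis .
  qed
  ultimately show thesis using that by blast
qed

text \<open>A maximiser of the Rayleigh quotient need not be exhibited: if \<open>\<mu> - A\<close>, with \<open>\<mu>\<close> the supremum of
  the quotient, had no kernel, it would be onto and hence bounded below, so that \<open>\<mu>\<close> could be lowered.\<close>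

lemma exists_eigenvector:
  assumes A: "symmetric_on V A" and V: "subspace V" "finite B" "V \<subseteq> span B" and "\<exists>v\<in>V. v \<noteq> 0"
  obtains v c where "v \<in> V" "v \<noteq> 0" "A v = c *\<^sub>R v"
proof -
  obtain F where F: "finite F" "orthonormal F" "span F = V"
    using exists_orthonormal_basis[OF V] by metis
  have FV: "F \<subseteq> V" using F(3) span_superset by blast
  obtain K0 where K0: "\<And>u. u \<in> V \<Longrightarrow> norm (A u) \<le> K0 * norm u"
    using symmetric_on_bounded[OF A V] by metis
  define U where "U = {u \<in> V. norm u = 1}"
  define \<mu> where "\<mu> = (SUP u\<in>U. A u \<bullet> u)"
  obtain v0 where "v0 \<in> V" "v0 \<noteq> 0" using assms(5) by blast
  then have "v0 /\<^sub>R norm v0 \<in> U"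
    using V(1) by (simp add: U_def subspace_scale)
  then have U: "U \<noteq> {}" by blast
  have "A u \<bullet> u \<le> K0" if "u \<in> U" for u
    using that K0[of u] norm_cauchy_schwarz[of "A u" u] by (auto simp: U_def)
  then have "bdd_above ((\<lambda>u. A u \<bullet> u) ` U)"
    by (intro bdd_aboveI2)
  then have le_\<mu>: "A u \<bullet> u \<le> \<mu>" if "u \<in> U" for u
    unfolding \<mu>_def using that by (intro cSUP_upper)
  define D where "D u = \<mu> *\<^sub>R u - A u" for u
  have D: "symmetric_on V D"
    using symmetric_onD[OF A] V(1) unfolding symmetric_on_def D_def
    by (auto simp: subspace_diff subspace_scale inner_diff_left inner_diff_right algebra_simps)
  have D_nonneg: "0 \<le> D u \<bullet> u" if "u \<in> V" for u
  proof (cases "u = 0")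
    case False
    define w where "w = u /\<^sub>R norm u"
    have "w \<in> U"
      using that False V(1) by (simp add: U_def w_def subspace_scale)
    then have "D w \<bullet> w \<ge> 0"
      using le_\<mu>[of w] by (simp add: D_def inner_diff_left norm_eq_1 U_def)
    moreover have "D w \<bullet> w = D u \<bullet> u / (norm u)\<^sup>2"
      unfolding w_def using symmetric_onD(3)[OF D that] by (simp add: power2_eq_square divide_inverse)
    ultimately show ?thesis
      using False by (simp add: zero_le_divide_iff)
  qed simp
  obtain K where K: "0 < K" "\<And>u. u \<in> V \<Longrightarrow> norm (D u) \<le> K * norm u"
    using symmetric_on_bounded[OF D V] by metis
  have form_bound: "(norm (D u))\<^sup>2 \<le> K * (D u \<bullet> u)" if u: "u \<in> V" for u
  proof -
    define w where "w = D u"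
    have w: "w \<in> V" unfolding w_def using symmetric_onD(1)[OF D u] .
    \<comment> \<open>The form of \<open>D\<close> at \<open>u + s *\<^sub>R w\<close> is at most
      \<open>w \<bullet> u + (2 * s + s\<^sup>2 * K) * (w \<bullet> w)\<close>; this
      \<open>s\<close> minimises that bound, and nonnegativity of the form gives the
      estimate.\<close>
    define s where "s = - 1 / K"
    have "D w \<bullet> w \<le> K * (w \<bullet> w)"
      using norm_cauchy_schwarz[of "D w" w] mult_right_mono[OF K(2)[OF w], of "norm w"]
      by (simp add: mult.assoc flip: power2_eq_square power2_norm_eq_inner)
    then have "s\<^sup>2 * (D w \<bullet> w) \<le> s\<^sup>2 * (K * (w \<bullet> w))"
      by (intro mult_left_mono) auto
    then have 1: "s\<^sup>2 * (D w \<bullet> w) \<le> (w \<bullet> w) / K"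
      using K(1) by (simp add: s_def power2_eq_square)
    have sw: "s *\<^sub>R w \<in> V" using w V(1) by (simp add: subspace_scale)
    have "D (u + s *\<^sub>R w) = w + s *\<^sub>R D w"
      using symmetric_onD(2)[OF D u sw] symmetric_onD(3)[OF D w] by (simp add: w_def)
    moreover have "D w \<bullet> u = w \<bullet> w"
      using symmetric_onD(4)[OF D w u] by (simp add: w_def)
    ultimately have "D (u + s *\<^sub>R w) \<bullet> (u + s *\<^sub>R w) = w \<bullet> u + 2 * s * (w \<bullet> w) + s\<^sup>2 * (D w \<bullet> w)"
      by (simp add: inner_add_left inner_add_right power2_eq_square algebra_simps)
    moreover have "0 \<le> D (u + s *\<^sub>R w) \<bullet> (u + s *\<^sub>R w)"
      using u sw V(1) by (intro D_nonneg subspace_add)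
    ultimately have "0 \<le> w \<bullet> u - (w \<bullet> w) / K"
      using 1 by (simp add: s_def)
    then show ?thesis
      using K(1) by (simp add: w_def power2_norm_eq_inner field_simps)
  qed
  have "\<exists>v\<in>V. v \<noteq> 0 \<and> D v = 0"
  proof (rule ccontr)
    assume no: "\<not> ?thesis"
    \<comment> \<open>By symmetry a vector \<open>z\<close> orthogonal to the image satisfies
      \<open>D z \<bullet> D z = z \<bullet> D (D z) = 0\<close>, so a proper image would produce a
      kernel.\<close>
    have img: "D ` V = V"
    proof (rule ccontr)
      assume "D ` V \<noteq> V"
      then have "D ` V \<subset> V" using symmetric_onD(1)[OF D] by blast
      moreover have "subspace (D ` V)"
        unfolding subspace_def
      proof (intro conjI ballI allI)
        have "D (0 *\<^sub>R 0) = 0 *\<^sub>R D 0"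
          using symmetric_onD(3)[OF D subspace_0[OF V(1)]] .
        then show "0 \<in> D ` V"
          using subspace_0[OF V(1)] by (metis image_eqI scaleR_zero_left)
        show "x + y \<in> D ` V" if "x \<in> D ` V" "y \<in> D ` V" for x y
        proof -
          obtain p q where "p \<in> V" "q \<in> V" "x = D p" "y = D q"
            using \<open>x \<in> D ` V\<close> \<open>y \<in> D ` V\<close> by blast
          then show ?thesis
            using symmetric_onD(2)[OF D, of p q] V(1) by (metis image_eqI subspace_add)
        qed
        show "c *\<^sub>R x \<in> D ` V" if "x \<in> D ` V" for c x
          using that symmetric_onD(3)[OF D] V(1) by (metis (no_types) imageE image_eqI subspace_scale)
      qed
      ultimately obtain z where z: "z \<in> V" "z \<noteq> 0" "\<And>w. w \<in> D ` V \<Longrightarrow> z \<bullet> w = 0"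
        using exists_orthogonal_to_subspace[OF _ _ V] by metis
      then have "D z \<bullet> D z = 0"
        using symmetric_onD(4)[OF D z(1) symmetric_onD(1)[OF D z(1)]] symmetric_onD(1)[OF D] by auto
      then show False using no z by auto
    qed
    have "\<exists>b\<in>V. D b = e" if "e \<in> F" for e
      using img FV that by (metis imageE subsetD)
    then obtain b where b: "\<And>e. e \<in> F \<Longrightarrow> b e \<in> V" "\<And>e. e \<in> F \<Longrightarrow> D (b e) = e"
      by metis
    \<comment> \<open>As \<open>u \<bullet> e = D u \<bullet> b e\<close>, the preimages
      \<open>b e\<close> bound a unit vector \<open>u\<close> by a multiple of \<open>D u\<close>.
      Through \<open>form_bound\<close> this keeps the form of \<open>D\<close> away from 0 on
      \<open>U\<close>.\<close>
    define L where "L = 1 + (\<Sum>e\<in>F. (norm (b e))\<^sup>2)"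
    have "0 < L" by (simp add: L_def add_pos_nonneg sum_nonneg)
    have gap: "1 \<le> L * (K * (D u \<bullet> u))" if "u \<in> U" for u
    proof -
      have u: "u \<in> V" "norm u = 1" using that by (auto simp: U_def)
      have "u = (\<Sum>e\<in>F. (u \<bullet> e) *\<^sub>R e)"
        using orthonormal_expansion[OF F(1,2)] u F(3) by blast
      then have "(norm u)\<^sup>2 = (\<Sum>e\<in>F. (u \<bullet> e)\<^sup>2)"
        using norm_sum_orthonormal[of F "\<lambda>e. u \<bullet> e"] F(1,2) by (simp add: orthonormal_def)
      also have "\<dots> \<le> (\<Sum>e\<in>F. (norm (D u))\<^sup>2 * (norm (b e))\<^sup>2)"
      proof (rule sum_mono)
        fix e assume "e \<in> F"
        then have "u \<bullet> e = D u \<bullet> b e"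
          using symmetric_onD(4)[OF D u(1) b(1)] b(2) by simp
        then have "\<bar>u \<bullet> e\<bar> \<le> norm (D u) * norm (b e)"
          using Cauchy_Schwarz_ineq2[of "D u" "b e"] by simp
        then have "\<bar>u \<bullet> e\<bar>\<^sup>2 \<le> (norm (D u) * norm (b e))\<^sup>2"
          by (intro power_mono) auto
        then show "(u \<bullet> e)\<^sup>2 \<le> (norm (D u))\<^sup>2 * (norm (b e))\<^sup>2"
          by (simp add: power_mult_distrib)
      qed
      also have "\<dots> \<le> L * (norm (D u))\<^sup>2"
        unfolding L_def sum_distrib_left[symmetric] by (subst mult.commute) (rule mult_right_mono, auto)
      also have "\<dots> \<le> L * (K * (D u \<bullet> u))"
        using form_bound[OF u(1)] \<open>0 < L\<close> by (intro mult_left_mono) auto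
      finally show ?thesis using u by simp
    qed
    have "A u \<bullet> u \<le> \<mu> - 1 / (L * K)" if "u \<in> U" for u
    proof -
      have "D u \<bullet> u = \<mu> - A u \<bullet> u"
        using that by (simp add: D_def inner_diff_left U_def norm_eq_1)
      then have "1 \<le> (L * K) * (\<mu> - A u \<bullet> u)"
        using gap[OF that] by (simp add: mult.assoc)
      then have "1 / (L * K) \<le> \<mu> - A u \<bullet> u"
        using \<open>0 < L\<close> \<open>0 < K\<close> by (simp add: divide_le_eq mult.commute)
      then show ?thesis by simp
    qed
    then have "\<mu> \<le> \<mu> - 1 / (L * K)"
      unfolding \<mu>_def using U by (intro cSUP_least)
    moreover have "0 < 1 / (L * K)"
      using \<open>0 < L\<close> \<open>0 < K\<close> by simp
    ultimately show False by simp
  qed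
  then obtain v where "v \<in> V" "v \<noteq> 0" "A v = \<mu> *\<^sub>R v"
    by (auto simp: D_def)
  then show thesis by (rule that)
qed

definition eigenvector :: "('a::real_vector \<Rightarrow> 'a) \<Rightarrow> 'a \<Rightarrow> bool" where
  "eigenvector A v \<longleftrightarrow> (\<exists>c. A v = c *\<^sub>R v)"

text \<open>Since \<open>B\<close> commutes with \<open>A\<close>, it preserves an eigenspace of
  \<open>A\<close> and remains symmetric on it; an eigenvector of \<open>B\<close> inside that
  eigenspace is a joint one.\<close>

lemma exists_joint_eigenvector:
  assumes A: "symmetric_on V A" and B: "symmetric_on V B" and comm: "\<And>u. u \<in> V \<Longrightarrow> A (B u) = B (A u)"
    and V: "subspace V" "finite S" "V \<subseteq> span S" and ne: "\<exists>v\<in>V. v \<noteq> 0"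
  obtains v where "v \<in> V" "norm v = 1" "eigenvector A v" "eigenvector B v"
proof -
  obtain v0 c where v0: "v0 \<in> V" "v0 \<noteq> 0" "A v0 = c *\<^sub>R v0"
    using exists_eigenvector[OF A V ne] by metis
  define W where "W = {v \<in> V. A v = c *\<^sub>R v}"
  have W: "subspace W"
    unfolding subspace_def
  proof (intro conjI ballI allI)
    show "0 \<in> W"
      using symmetric_onD(3)[OF A subspace_0[OF V(1)], of 0] subspace_0[OF V(1)] by (simp add: W_def)
    show "x + y \<in> W" if "x \<in> W" "y \<in> W" for x y
      using that symmetric_onD(2)[OF A] V(1) by (simp add: W_def subspace_add scaleR_right_distrib)
    show "r *\<^sub>R x \<in> W" if "x \<in> W" for r x
      using that symmetric_onD(3)[OF A] V(1) by (simp add: W_def subspace_scale)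
  qed
  moreover have "symmetric_on W B"
    unfolding symmetric_on_def
    using symmetric_onD[OF B] comm by (auto simp: W_def)
  moreover have "W \<subseteq> span S" "\<exists>v\<in>W. v \<noteq> 0"
    using V v0 by (auto simp: W_def)
  ultimately obtain v d where v: "v \<in> W" "v \<noteq> 0" "B v = d *\<^sub>R v"
    using exists_eigenvector[OF _ _ V(2)] by metis
  define w where "w = v /\<^sub>R norm v"
  have "v \<in> V" "A v = c *\<^sub>R v" using v by (auto simp: W_def)
  then have "w \<in> V" "norm w = 1" "A w = c *\<^sub>R w" "B w = d *\<^sub>R w"
    using v V(1) symmetric_onD(3)[OF A] symmetric_onD(3)[OF B] by (auto simp: w_def subspace_scale)
  then show thesis
    using that[of w] by (auto simp: eigenvector_def)
qed

text \<open>Take a joint orthonormal system above \<open>F0\<close> of maximal cardinality. If it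
  did not span \<open>V\<close>, its orthogonal complement in \<open>V\<close>, invariant under both
  symmetric operators, would contain another joint unit eigenvector.\<close>

lemma extend_joint_eigenbasis:
  assumes A: "symmetric_on V A" and B: "symmetric_on V B" and comm: "\<And>u. u \<in> V \<Longrightarrow> A (B u) = B (A u)"
    and V: "subspace V" "finite S" "V \<subseteq> span S"
    and F0: "finite F0" "F0 \<subseteq> V" "orthonormal F0" "\<And>e. e \<in> F0 \<Longrightarrow> eigenvector A e \<and> eigenvector B e"
  obtains F where "finite F" "F0 \<subseteq> F" "F \<subseteq> V" "orthonormal F"
    "\<And>e. e \<in> F \<Longrightarrow> eigenvector A e \<and> eigenvector B e" "V \<subseteq> span F"
proof -
  define P where "P F \<longleftrightarrow> finite F \<and> F0 \<subseteq> F \<and> F \<subseteq> V \<and> orthonormal F \<and>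
    (\<forall>e\<in>F. eigenvector A e \<and> eigenvector B e)" for F
  have "P F0" using F0 by (simp add: P_def)
  moreover have "card F < Suc (card S)" if "P F" for F
    \<comment> \<open>Orthonormal systems are independent, so the finite spanning set
      \<open>S\<close> bounds their size and a maximum exists.\<close>
    using independent_span_bound[OF V(2) orthonormal_independent, of F] that V(3)
    by (auto simp: P_def less_Suc_eq_le)
  ultimately obtain F where F: "P F" and max: "\<And>G. P G \<Longrightarrow> card G \<le> card F"
    using ex_has_greatest_nat[of P F0 card "Suc (card S)"] by blast
  have FV: "span F \<subseteq> V"
    using F V(1) by (intro span_minimal) (auto simp: P_def)
  have "V \<subseteq> span F"
  proof (rule ccontr)
    assume "\<not> V \<subseteq> span F"
    then obtain z where z: "z \<in> V" "z \<noteq> 0" "\<And>w. w \<in> span F \<Longrightarrow> z \<bullet> w = 0"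
      using exists_orthogonal_to_subspace[OF subspace_span _ V, of F] FV by blast
    define W where "W = {v \<in> V. \<forall>e\<in>F. v \<bullet> e = 0}"
    have W: "subspace W"
      using V(1) by (auto simp: W_def subspace_def inner_add_left)
    have sym: "symmetric_on W M" if M: "symmetric_on V M" "\<And>e. e \<in> F \<Longrightarrow> eigenvector M e" for M
    proof -
      have "M v \<bullet> e = 0" if "v \<in> V" "\<forall>e\<in>F. v \<bullet> e = 0" "e \<in> F" for v e
        using that M(2)[of e] symmetric_onD(4)[OF M(1), of v e] F
        by (auto simp: eigenvector_def P_def)
      then show ?thesis
        unfolding symmetric_on_def using symmetric_onD[OF M(1)] by (auto simp: W_def)
    qed
    have "symmetric_on W A" "symmetric_on W B"
      using F by (auto intro!: sym A B simp: P_def)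
    moreover have "W \<subseteq> span S" "z \<in> W" "\<And>u. u \<in> W \<Longrightarrow> A (B u) = B (A u)"
      using V(3) z comm by (auto simp: W_def span_base)
    ultimately obtain v where v: "v \<in> W" "norm v = 1" "eigenvector A v" "eigenvector B v"
      using exists_joint_eigenvector[of W A B S] W V(2) z(2) by blast
    have "v \<notin> F"
      using v(1,2) by (auto simp: W_def norm_eq_1)
    moreover have "P (insert v F)"
      using F v by (auto simp: P_def orthonormal_def W_def inner_commute)
    ultimately show False
      using max[of "insert v F"] F by (simp add: P_def)
  qed
  then show thesis
    using F that by (auto simp: P_def)
qed

text \<open>Each finite basis is obtained by extending the previous one; because earlier vectors are
  kept, any two vectors of the union lie in a common orthonormal system.\<close>

lemma exists_joint_eigenbasis:
  fixes V :: "nat \<Rightarrow> 'a::real_inner set"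
  assumes A: "\<And>n. symmetric_on (V n) A" and B: "\<And>n. symmetric_on (V n) B"
    and comm: "\<And>n u. u \<in> V n \<Longrightarrow> A (B u) = B (A u)"
    and V: "\<And>n. subspace (V n)" "\<And>n. \<exists>S. finite S \<and> V n \<subseteq> span S" "\<And>n. V n \<subseteq> V (Suc n)"
  obtains E where "E \<subseteq> (\<Union>n. V n)" "orthonormal E"
    "\<And>e. e \<in> E \<Longrightarrow> eigenvector A e \<and> eigenvector B e" "(\<Union>n. V n) \<subseteq> span E"
proof -
  define P where "P n F \<longleftrightarrow> finite F \<and> F \<subseteq> V n \<and> orthonormal F \<and>
    (\<forall>e\<in>F. eigenvector A e \<and> eigenvector B e) \<and> V n \<subseteq> span F" for n F
  have extend: "\<exists>F. P n F \<and> F0 \<subseteq> F"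
    if F0: "finite F0" "F0 \<subseteq> V n" "orthonormal F0" "\<forall>e\<in>F0. eigenvector A e \<and> eigenvector B e" for n F0
  proof -
    obtain S where S: "finite S" "V n \<subseteq> span S" using V(2) by blast
    obtain F where "finite F" "F0 \<subseteq> F" "F \<subseteq> V n" "orthonormal F"
      "\<And>e. e \<in> F \<Longrightarrow> eigenvector A e \<and> eigenvector B e" "V n \<subseteq> span F"
      using extend_joint_eigenbasis[of "V n" A B S F0, OF A B comm[of _ n] V(1) S F0(1-3)] F0(4)
      by blast
    then show ?thesis by (auto simp: P_def)
  qed
  have "\<exists>f. \<forall>n. P n (f n) \<and> f n \<subseteq> f (Suc n)"
  proof (rule dependent_nat_choice)
    show "\<exists>F. P 0 F"
      using extend[of "{}" 0] by (auto simp: orthonormal_def)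
    show "\<exists>G. P (Suc n) G \<and> F \<subseteq> G" if "P n F" for n F
      using that V(3)[of n] by (intro extend) (auto simp: P_def)
  qed
  then obtain f where f: "\<And>n. P n (f n)" "\<And>n. f n \<subseteq> f (Suc n)" by blast
  have mono: "f m \<subseteq> f n" if "m \<le> n" for m n
    using f(2) that by (rule lift_Suc_mono_le)
  show thesis
  proof
    show "(\<Union>n. f n) \<subseteq> (\<Union>n. V n)"
      using f(1) unfolding P_def by (intro UN_mono) auto
    show "orthonormal (\<Union>n. f n)"
      unfolding orthonormal_def
    proof safe
      show "norm e = 1" if "e \<in> f n" for e n
        using f(1)[of n] that by (auto simp: P_def orthonormal_def)
      fix d e m n assume "d \<in> f m" "e \<in> f n" "d \<noteq> e"
      then have "d \<in> f (max m n)" "e \<in> f (max m n)"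
        using mono[of m "max m n"] mono[of n "max m n"] by auto
      then show "d \<bullet> e = 0"
        using f(1)[of "max m n"] \<open>d \<noteq> e\<close> by (auto simp: P_def orthonormal_def)
    qed
    show "eigenvector A e \<and> eigenvector B e" if "e \<in> (\<Union>n. f n)" for e
      using that f(1) by (auto simp: P_def)
    show "(\<Union>n. V n) \<subseteq> span (\<Union>n. f n)"
    proof
      fix x assume "x \<in> (\<Union>n. V n)"
      then obtain n where "x \<in> span (f n)" using f(1) by (auto simp: P_def)
      then show "x \<in> span (\<Union>n. f n)"
        by (rule subsetD[OF span_mono, rotated]) auto
    qed
  qed
qed

section \<open>Integration over the seven-sphere\<close>

lemma space_S7 [simp]: "space S7_volume = sphere 0 1"
  by (simp add: S7_volume_def space_scale_measure space_restrict_space)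

lemma sets_S7 [measurable_cong]: "sets S7_volume = sets (restrict_space borel (sphere 0 1))"
  by (simp add: S7_volume_def)

lemma measurable_sgn_S7:
  "sgn \<in> restrict_space lborel (ball 0 1 - {0}) \<rightarrow>\<^sub>M restrict_space borel (sphere (0 :: real ^ 8) 1)"
proof (rule measurable_restrict_space2)
  show "sgn \<in> space (restrict_space lborel (ball 0 1 - {0})) \<rightarrow> sphere (0 :: real ^ 8) 1"
    by (auto simp: space_restrict_space norm_sgn)
  show "sgn \<in> restrict_space lborel (ball 0 1 - {0}) \<rightarrow>\<^sub>M (borel :: (real ^ 8) measure)"
    unfolding sgn_div_norm[abs_def] by (intro measurable_restrict_space1) measurable
qed

lemma emeasure_S7:
  assumes "A \<in> sets S7_volume"
  shows "emeasure S7_volume A = 8 * emeasure lborel {y \<in> ball 0 1 - {0}. sgn y \<in> A}"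
proof -
  have A: "A \<in> sets (restrict_space borel (sphere 0 1))"
    using assms by (simp add: sets_S7)
  have "emeasure S7_volume A = 8 * emeasure (restrict_space lborel (ball 0 1 - {0}))
      (sgn -` A \<inter> space (restrict_space lborel (ball 0 1 - {0})))"
    unfolding S7_volume_def by (simp add: emeasure_distr[OF measurable_sgn_S7 A])
  also have "sgn -` A \<inter> space (restrict_space lborel (ball 0 1 - {0})) = {y \<in> ball 0 1 - {0}. sgn y \<in> A}"
    by (auto simp: space_restrict_space)
  also have "emeasure (restrict_space lborel (ball 0 1 - {0})) \<dots> = emeasure lborel \<dots>"
    by (rule emeasure_restrict_space) auto
  finally show ?thesis .
qed

lemma sgn_vimage_borel:
  assumes "A \<in> sets S7_volume"
  shows "{y \<in> ball 0 1 - {0}. sgn y \<in> A} \<in> sets borel"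
proof -
  have "sgn -` A \<inter> space (restrict_space lborel (ball 0 1 - {0})) \<in> sets (restrict_space lborel (ball 0 1 - {0}))"
    using measurable_sets[OF measurable_sgn_S7] assms by (simp add: sets_S7)
  also have "sgn -` A \<inter> space (restrict_space lborel (ball 0 1 - {0})) = {y \<in> ball 0 1 - {0}. sgn y \<in> A}"
    by (auto simp: space_restrict_space)
  finally obtain B :: "(real ^ 8) set"
    where "{y \<in> ball 0 1 - {0}. sgn y \<in> A} = (ball 0 1 - {0}) \<inter> B" "B \<in> sets borel"
    unfolding sets_restrict_space by auto
  then show ?thesis by simp
qed

lemma finite_measure_S7: "finite_measure S7_volume"
proof
  have "emeasure S7_volume (space S7_volume) \<le> 8 * emeasure lborel (ball (0 :: real ^ 8) 1)"
    by (subst emeasure_S7[OF sets.top]) (auto intro!: mult_left_mono emeasure_mono)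
  also have "\<dots> < \<infinity>"
    using emeasure_bounded_finite[of "ball (0 :: real ^ 8) 1"] by (simp add: ennreal_mult_less_top)
  finally show "emeasure S7_volume (space S7_volume) \<noteq> \<infinity>"
    by simp
qed

section \<open>Invariance of the volume under orthogonal maps\<close>

lemma distr_lborel_orthogonal:
  fixes U :: "real ^ 8 \<Rightarrow> real ^ 8"
  assumes U: "orthogonal_transformation U"
  shows "distr lborel borel U = lborel"
proof (rule sym, rule lborel_eqI)
  have lin: "linear U" using U by (rule orthogonal_transformation_linear)
  have meas: "U \<in> borel_measurable lborel"
    using lin by (simp add: linear_continuous_on linear_linear borel_measurable_continuous_onI)
  have bij: "bij U" using U by (rule orthogonal_transformation_bij)
  have inv: "orthogonal_transformation (inv U)"
    using U by (rule orthogonal_transformation_inv)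
  fix l u :: "real ^ 8" assume lu: "\<And>b. b \<in> Basis \<Longrightarrow> l \<bullet> b \<le> u \<bullet> b"
  \<comment> \<open>The preimage of a box is its image under the inverse, again orthogonal.
    Invariance of the measure of such images is stated for the completion \<open>lebesgue\<close>,
    whence the passage through it.\<close>
  have "emeasure (distr lborel borel U) (box l u) = emeasure lborel (inv U ` box l u)"
    using meas by (simp add: emeasure_distr bij_vimage_eq_inv_image[OF bij])
  also have "\<dots> = emeasure lborel (box l u)"
  proof -
    have b: "box l u \<in> lmeasurable" by simp
    have lebesgue: "emeasure lborel S = emeasure lebesgue S" if "S \<in> sets borel" for S :: "(real ^ 8) set"
      using that by simp
    have "U -` box l u \<inter> space lborel \<in> sets lborel"
      using meas by (rule measurable_sets) simp
    then have "inv U ` box l u \<in> sets borel"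
      by (simp only: bij_vimage_eq_inv_image[OF bij] space_lborel space_borel Int_UNIV_right sets_lborel)
    then have "emeasure lborel (inv U ` box l u) = emeasure lebesgue (inv U ` box l u)"
      by (rule lebesgue)
    also have "\<dots> = ennreal (measure lebesgue (inv U ` box l u))"
      using measurable_orthogonal_image[OF inv b] by (rule emeasure_eq_measure2)
    also have "\<dots> = ennreal (measure lebesgue (box l u))"
      by (simp only: measure_orthogonal_image[OF inv b])
    also have "\<dots> = emeasure lebesgue (box l u)"
      using b by (rule emeasure_eq_measure2[symmetric])
    also have "\<dots> = emeasure lborel (box l u)"
      by (rule lebesgue[symmetric]) simp
    finally show ?thesis .
  qed
  also have "\<dots> = (\<Prod>b\<in>Basis. (u - l) \<bullet> b)"
    using lu by (rule emeasure_lborel_box)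
  finally show "emeasure (distr lborel borel U) (box l u) = (\<Prod>b\<in>Basis. (u - l) \<bullet> b)" .
qed simp

lemma orthogonal_measurable_S7:
  assumes U: "orthogonal_transformation U"
  shows "U \<in> S7_volume \<rightarrow>\<^sub>M S7_volume"
proof -
  have "U \<in> restrict_space borel (sphere 0 1) \<rightarrow>\<^sub>M restrict_space borel (sphere 0 1)"
  proof (rule measurable_restrict_space2)
    show "U \<in> space (restrict_space borel (sphere 0 1)) \<rightarrow> sphere 0 1"
      using orthogonal_transformation_norm[OF U] by (auto simp: space_restrict_space)
    have "U \<in> borel_measurable borel"
      using orthogonal_transformation_linear[OF U]
      by (simp add: linear_continuous_on linear_linear borel_measurable_continuous_onI)
    then show "U \<in> restrict_space borel (sphere 0 1) \<rightarrow>\<^sub>M borel"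
      by (rule measurable_restrict_space1)
  qed
  then show ?thesis
    by (simp cong: measurable_cong_sets[OF sets_S7 sets_S7])
qed

text \<open>An orthogonal map commutes with \<open>sgn\<close> and preserves the punctured ball, so
  the cone over a preimage is the preimage of the cone; the claim reduces to Lebesgue
  measure.\<close>

lemma distr_S7_orthogonal:
  assumes U: "orthogonal_transformation U"
  shows "distr S7_volume S7_volume U = S7_volume"
proof (rule measure_eqI)
  fix A assume "A \<in> sets (distr S7_volume S7_volume U)"
  then have A: "A \<in> sets S7_volume" by simp
  have meas: "U \<in> borel_measurable lborel"
    using orthogonal_transformation_linear[OF U]
    by (simp add: linear_continuous_on linear_linear borel_measurable_continuous_onI)
  have sgnU: "sgn (U y) = U (sgn y)" for y :: "real ^ 8"
    using orthogonal_transformation_norm[OF U, of y] orthogonal_transformation_linear[OF U]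
    by (simp add: sgn_div_norm linear_scale)
  have UA: "U -` A \<inter> sphere 0 1 \<in> sets S7_volume"
    using measurable_sets[OF orthogonal_measurable_S7[OF U] A] by simp
  have "emeasure (distr S7_volume S7_volume U) A = emeasure S7_volume (U -` A \<inter> sphere 0 1)"
    using A by (simp add: emeasure_distr[OF orthogonal_measurable_S7[OF U]])
  also have "\<dots> = 8 * emeasure lborel {y \<in> ball 0 1 - {0}. sgn y \<in> U -` A \<inter> sphere 0 1}"
    by (rule emeasure_S7[OF UA])
  also have "{y \<in> ball 0 1 - {0}. sgn y \<in> U -` A \<inter> sphere 0 1} = U -` {y \<in> ball 0 1 - {0}. sgn y \<in> A}"
  proof (intro set_eqI)
    fix y :: "real ^ 8"
    have "norm (sgn y) = 1" if "y \<noteq> 0" using that by (simp add: norm_sgn)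
    moreover have "U y = 0 \<longleftrightarrow> y = 0" "norm (U y) = norm y"
      using orthogonal_transformation_norm[OF U, of y] by (metis norm_eq_zero, simp)
    ultimately show "y \<in> {y \<in> ball 0 1 - {0}. sgn y \<in> U -` A \<inter> sphere 0 1} \<longleftrightarrow>
        y \<in> U -` {y \<in> ball 0 1 - {0}. sgn y \<in> A}"
      by (cases "y = 0") (simp_all add: sgnU)
  qed
  also have "emeasure lborel \<dots> = emeasure (distr lborel borel U) {y \<in> ball 0 1 - {0}. sgn y \<in> A}"
    using sgn_vimage_borel[OF A] meas by (simp add: emeasure_distr)
  also have "\<dots> = emeasure lborel {y \<in> ball 0 1 - {0}. sgn y \<in> A}"
    by (simp add: distr_lborel_orthogonal[OF U])
  also have "8 * \<dots> = emeasure S7_volume A"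
    by (simp add: emeasure_S7[OF A])
  finally show "emeasure (distr S7_volume S7_volume U) A = emeasure S7_volume A" .
qed simp

lemma integral_S7_orthogonal:
  fixes f :: "real ^ 8 \<Rightarrow> real"
  assumes U: "orthogonal_transformation U" and f: "f \<in> borel_measurable S7_volume"
  shows "(LINT x|S7_volume. f (U x)) = (LINT x|S7_volume. f x)"
  using integral_distr[OF orthogonal_measurable_S7[OF U] f] by (simp add: distr_S7_orthogonal[OF U])

section \<open>Continuous functions and polynomials in the space of square-integrable
  functions\<close>

lemma continuous_measurable_S7:
  fixes f :: "real ^ 8 \<Rightarrow> real"
  assumes "continuous_on (sphere 0 1) f"
  shows "f \<in> borel_measurable S7_volume"
  using borel_measurable_continuous_on_restrict[OF assms]
  by (simp cong: measurable_cong_sets[OF sets_S7 refl])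

lemma borel_measurable_indicator_S7:
  assumes "B \<in> sets borel"
  shows "(indicator B :: real ^ 8 \<Rightarrow> real) \<in> borel_measurable S7_volume"
proof -
  have "(indicator B :: real ^ 8 \<Rightarrow> real) \<in> borel_measurable (restrict_space borel (sphere 0 1))"
    using assms by (intro measurable_restrict_space1 borel_measurable_indicator)
  then show ?thesis
    by (simp cong: measurable_cong_sets[OF sets_S7 refl])
qed

lemma continuous_bounded_S7:
  fixes f :: "real ^ 8 \<Rightarrow> real"
  assumes "continuous_on (sphere 0 1) f"
  obtains K where "0 < K" "\<And>x. x \<in> sphere 0 1 \<Longrightarrow> \<bar>f x\<bar> \<le> K"
proof -
  have "bounded (f ` sphere 0 1)"
    using assms by (intro compact_imp_bounded compact_continuous_image) auto
  then show thesis
    using that unfolding bounded_pos by auto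
qed

lemma integrable_S7:
  fixes f :: "real ^ 8 \<Rightarrow> real"
  assumes "f \<in> borel_measurable S7_volume" "\<And>x. x \<in> sphere 0 1 \<Longrightarrow> \<bar>f x\<bar> \<le> K"
  shows "integrable S7_volume f"
proof -
  interpret finite_measure S7_volume by (rule finite_measure_S7)
  show ?thesis
    using assms by (intro integrable_const_bound[where B = K]) auto
qed

lemma continuous_L2_fun:
  assumes "continuous_on (sphere 0 1) f"
  shows "L2_fun f"
proof -
  have "continuous_on (sphere 0 1) (\<lambda>x. (f x)\<^sup>2)"
    using assms by (intro continuous_intros)
  then obtain K where "\<And>x. x \<in> sphere 0 1 \<Longrightarrow> \<bar>(f x)\<^sup>2\<bar> \<le> K"
    using continuous_bounded_S7 by metis
  then show ?thesis
    unfolding L2_fun_def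
    using continuous_measurable_S7[OF assms] by (intro conjI integrable_S7) auto
qed

lemma L2_eq_sphere:
  assumes "L2_fun f" "\<And>x. x \<in> sphere 0 1 \<Longrightarrow> f x = g x"
  shows "L2_eq f g"
proof -
  have "g \<in> borel_measurable S7_volume \<longleftrightarrow> f \<in> borel_measurable S7_volume"
    using assms(2) by (intro measurable_cong) simp
  moreover have "integrable S7_volume (\<lambda>x. (g x)\<^sup>2) \<longleftrightarrow> integrable S7_volume (\<lambda>x. (f x)\<^sup>2)"
    using assms(2) by (intro Bochner_Integration.integrable_cong) auto
  ultimately show ?thesis
    using assms by (auto simp: L2_eq_def L2_fun_def)
qed

lemma L2_fun_integrable:
  assumes "L2_fun f"
  shows "integrable S7_volume f"
proof -
  have "L2_fun (\<lambda>_. 1)" by (rule continuous_L2_fun) simp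
  then show ?thesis using L2_fun_mult[OF assms, of "\<lambda>_. 1"] by simp
qed

text \<open>The functions \<open>max 0 (1 - n d(x, C))\<close> decrease to the indicator of a closed set \<open>C\<close>, so a function
  orthogonal to all continuous ones has integral zero over closed sets, hence over Borel sets.\<close>

lemma L2_orthogonal_continuous:
  assumes f: "L2_fun f"
    and orth: "\<And>g. continuous_on UNIV g \<Longrightarrow> (LINT x|S7_volume. f x * g x) = 0"
  shows "AE x in S7_volume. f x = 0"
proof (rule density_unique_real)
  have int: "integrable S7_volume f" using f by (rule L2_fun_integrable)
  show "integrable S7_volume f" by fact
  show "integrable S7_volume (\<lambda>_. 0 :: real)" by simp
  have closed: "(LINT x|S7_volume. indicator C x * f x) = 0" if "closed C" for C :: "(real ^ 8) set"
  proof (cases "C = {}")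
    case False
    define g where "g n x = max 0 (1 - of_nat n * infdist x C)" for n and x :: "real ^ 8"
    have cont: "continuous_on UNIV (g n)" for n
      unfolding g_def by (intro continuous_intros)
    have g01: "0 \<le> g n x" "g n x \<le> 1" for n x
      by (auto simp: g_def infdist_nonneg)
    have "(\<lambda>n. LINT x|S7_volume. f x * g n x) \<longlonglongrightarrow> (LINT x|S7_volume. indicator C x * f x)"
    proof (rule integral_dominated_convergence[where w = "\<lambda>x. \<bar>f x\<bar>"])
      show "(\<lambda>x. indicator C x * f x) \<in> borel_measurable S7_volume"
      proof -
        have "(indicator C :: _ \<Rightarrow> real) \<in> borel_measurable S7_volume"
          using \<open>closed C\<close> by (intro borel_measurable_indicator_S7) simp
        then show ?thesis
          using int by (intro borel_measurable_times) auto
      qed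
      show "(\<lambda>x. f x * g n x) \<in> borel_measurable S7_volume" for n
        using int continuous_measurable_S7[OF continuous_on_subset[OF cont[of n]]] by auto
      show "integrable S7_volume (\<lambda>x. \<bar>f x\<bar>)" using int by simp
      show "AE x in S7_volume. (\<lambda>n. f x * g n x) \<longlonglongrightarrow> indicator C x * f x"
      proof (rule AE_I2)
        fix x
        have "(\<lambda>n. g n x) \<longlonglongrightarrow> indicator C x"
        proof (cases "x \<in> C")
          case True
          then have "g n x = 1" for n by (simp add: g_def)
          then show ?thesis using True by simp
        next
          case False
          then have pos: "0 < infdist x C"
            using \<open>closed C\<close> \<open>C \<noteq> {}\<close> infdist_pos_not_in_closed by blast
          obtain N where N: "1 < real N * infdist x C"
            using reals_Archimedean3[OF pos] by blast
          have "g n x = 0" if "N \<le> n" for n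
          proof -
            have "real N * infdist x C \<le> real n * infdist x C"
              using that pos by (intro mult_right_mono) auto
            then show ?thesis using N by (simp add: g_def)
          qed
          then have "\<forall>\<^sub>F n in sequentially. g n x = 0"
            by (auto simp: eventually_sequentially)
          then show ?thesis using False by (simp add: tendsto_eventually)
        qed
        then have "(\<lambda>n. f x * g n x) \<longlonglongrightarrow> f x * indicator C x"
          by (intro tendsto_intros)
        then show "(\<lambda>n. f x * g n x) \<longlonglongrightarrow> indicator C x * f x"
          by (simp add: mult.commute)
      qed
      show "AE x in S7_volume. norm (f x * g n x) \<le> \<bar>f x\<bar>" for n
        using g01[of n] by (intro AE_I2) (simp add: abs_mult mult_left_le)
    qed
    moreover have "(LINT x|S7_volume. f x * g n x) = 0" for n
      using orth[OF cont] .
    ultimately show ?thesis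
      by (simp add: LIMSEQ_const_iff)
  qed simp
  have borel_ind: "(\<lambda>x. indicator B x * f x) \<in> borel_measurable S7_volume"
      "integrable S7_volume (\<lambda>x. indicator B x * f x)" if "B \<in> sets borel" for B
  proof -
    have "(indicator B :: _ \<Rightarrow> real) \<in> borel_measurable S7_volume"
      using that by (rule borel_measurable_indicator_S7)
    then show "(\<lambda>x. indicator B x * f x) \<in> borel_measurable S7_volume"
      using int by (intro borel_measurable_times) auto
    then show "integrable S7_volume (\<lambda>x. indicator B x * f x)"
      by (intro Bochner_Integration.integrable_bound[OF int]) (auto simp: indicator_def)
  qed
  \<comment> \<open>Closed sets form an intersection-stable generator, so induction over the Dynkin
    system applies; complements are taken in \<open>UNIV\<close>, itself closed.\<close>
  have borel: "(LINT x|S7_volume. indicator B x * f x) = 0" if "B \<in> sets borel" for B :: "(real ^ 8) set"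
  proof -
    have "Int_stable (Collect closed :: (real ^ 8) set set)"
      by (auto simp: Int_stable_def)
    moreover have "Collect closed \<subseteq> Pow (UNIV :: (real ^ 8) set)" by simp
    moreover have "B \<in> sigma_sets UNIV (Collect closed)"
      using that by (simp add: borel_eq_closed)
    ultimately show ?thesis
    proof (induction rule: sigma_sets_induct_disjoint)
      case (basic A)
      then show ?case using closed by simp
    next
      case empty
      then show ?case by simp
    next
      case (compl A)
      then have A: "A \<in> sets borel" by (simp add: borel_eq_closed)
      have "(LINT x|S7_volume. indicator (UNIV - A) x * f x) =
          (LINT x|S7_volume. indicator UNIV x * f x - indicator A x * f x)"
        by (intro Bochner_Integration.integral_cong) (auto simp: indicator_def)
      also have "\<dots> = (LINT x|S7_volume. indicator UNIV x * f x) - (LINT x|S7_volume. indicator A x * f x)"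
        by (intro Bochner_Integration.integral_diff borel_ind) (auto intro: A)
      finally show ?case
        using compl closed[of UNIV] by simp
    next
      case (union A)
      then have A: "A n \<in> sets borel" for n
        by (auto simp: borel_eq_closed)
      have "(LINT x|S7_volume. indicator (\<Union>n. A n) x * f x) = (\<Sum>n. LINT x|S7_volume. indicator (A n) x * f x)"
      proof -
        \<comment> \<open>The sets are cut down to the sphere because only its subsets are
          measurable for \<open>S7_volume\<close>.\<close>
        have "(LINT x:(\<Union>n. (A n \<inter> sphere 0 1))|S7_volume. f x) = (\<Sum>n. LINT x:(A n \<inter> sphere 0 1)|S7_volume. f x)"
        proof (rule lebesgue_integral_countable_add)
          show "A n \<inter> sphere 0 1 \<in> sets S7_volume" for n
            using A[of n] by (auto simp: sets_S7 sets_restrict_space)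
          show "A m \<inter> sphere 0 1 \<inter> (A n \<inter> sphere 0 1) = {}" if "m \<noteq> n" for m n
            using union(1) that by (auto simp: disjoint_family_on_def)
          show "set_integrable S7_volume (\<Union>n. A n \<inter> sphere 0 1) f"
            unfolding set_integrable_def
            using int A by (intro integrable_mult_indicator) (auto simp: sets_S7 sets_restrict_space)
        qed
        moreover have "(LINT x:(\<Union>n. (A n \<inter> sphere 0 1))|S7_volume. f x) =
            (LINT x|S7_volume. indicator (\<Union>n. A n) x * f x)"
          unfolding set_lebesgue_integral_def
          by (intro Bochner_Integration.integral_cong) (auto simp: indicator_def)
        moreover have "(LINT x:(A n \<inter> sphere 0 1)|S7_volume. f x) =
            (LINT x|S7_volume. indicator (A n) x * f x)" for n
          unfolding set_lebesgue_integral_def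
          by (intro Bochner_Integration.integral_cong) (auto simp: indicator_def)
        ultimately show ?thesis by simp
      qed
      then show ?case using union by simp
    qed
  qed
  fix A assume "A \<in> sets S7_volume"
  then obtain B where B: "B \<in> sets borel" "A = sphere 0 1 \<inter> B"
    by (auto simp: sets_S7 sets_restrict_space)
  have "(LINT x:A|S7_volume. f x) = (LINT x|S7_volume. indicator B x * f x)"
    unfolding set_lebesgue_integral_def
    by (intro Bochner_Integration.integral_cong) (auto simp: indicator_def B)
  then show "(LINT x:A|S7_volume. f x) = (LINT x:A|S7_volume. 0)"
    using borel[OF B(1)] by simp
qed

text \<open>Stone-Weierstrass replaces a continuous \<open>g\<close> by a polynomial within
  \<epsilon> on the sphere, which changes the integral against \<open>f\<close> by at most
  \<epsilon> times the integral of \<open>\<bar>f x\<bar>\<close>.\<close>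

lemma L2_orthogonal_polynomials:
  assumes f: "L2_fun f"
    and orth: "\<And>p. real_polynomial_function p \<Longrightarrow> (LINT x|S7_volume. f x * p x) = 0"
  shows "AE x in S7_volume. f x = 0"
proof (rule L2_orthogonal_continuous[OF f])
  fix g :: "real ^ 8 \<Rightarrow> real" assume "continuous_on UNIV g"
  then have g: "continuous_on (sphere 0 1) g" by (rule continuous_on_subset) simp
  have int: "integrable S7_volume f" using f by (rule L2_fun_integrable)
  define K where "K = (LINT x|S7_volume. \<bar>f x\<bar>)"
  have "\<bar>LINT x|S7_volume. f x * g x\<bar> \<le> \<epsilon> * K" if "0 < \<epsilon>" for \<epsilon>
  proof -
    obtain p where p: "real_polynomial_function p" "\<And>x. x \<in> sphere 0 1 \<Longrightarrow> \<bar>g x - p x\<bar> < \<epsilon>"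
      using Stone_Weierstrass_real_polynomial_function[OF compact_sphere g \<open>0 < \<epsilon>\<close>] by metis
    have pc: "continuous_on (sphere 0 1) p"
      using p(1) by (simp add: continuous_on_polymonial_function real_polynomial_function_eq)
    have fg: "integrable S7_volume (\<lambda>x. f x * g x)" "integrable S7_volume (\<lambda>x. f x * p x)"
      by (intro L2_fun_mult f continuous_L2_fun g pc)+
    have "(LINT x|S7_volume. f x * g x) = (LINT x|S7_volume. f x * g x - f x * p x)"
      using orth[OF p(1)] fg by simp
    also have "\<bar>\<dots>\<bar> \<le> (LINT x|S7_volume. \<bar>f x * g x - f x * p x\<bar>)"
      by (rule integral_abs_bound)
    also have "\<dots> \<le> (LINT x|S7_volume. \<epsilon> * \<bar>f x\<bar>)"
    proof (rule integral_mono)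
      show "integrable S7_volume (\<lambda>x. \<bar>f x * g x - f x * p x\<bar>)" using fg by simp
      show "integrable S7_volume (\<lambda>x. \<epsilon> * \<bar>f x\<bar>)" using int by simp
      fix x assume "x \<in> space S7_volume"
      then have "\<bar>g x - p x\<bar> \<le> \<epsilon>" using p(2)[of x] by simp
      then have "\<bar>f x\<bar> * \<bar>g x - p x\<bar> \<le> \<bar>f x\<bar> * \<epsilon>"
        by (intro mult_left_mono) auto
      then show "\<bar>f x * g x - f x * p x\<bar> \<le> \<epsilon> * \<bar>f x\<bar>"
        by (simp add: mult.commute flip: right_diff_distrib abs_mult)
    qed
    finally show ?thesis by (simp add: K_def)
  qed
  moreover have "((\<lambda>\<epsilon>. \<epsilon> * K) \<longlongrightarrow> 0 * K) (at_right 0)"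
    by (intro tendsto_intros)
  moreover have "\<forall>\<^sub>F \<epsilon> in at_right (0::real). 0 < \<epsilon>"
    by (rule eventually_at_right_less)
  ultimately have "\<bar>LINT x|S7_volume. f x * g x\<bar> \<le> 0 * K"
    by (intro tendsto_lowerbound[of "\<lambda>\<epsilon>. \<epsilon> * K" _ "at_right (0::real)"]) (auto elim: eventually_mono)
  then show "(LINT x|S7_volume. f x * g x) = 0" by simp
qed

section \<open>Completeness of the space of square-integrable functions\<close>

lemma L2_eq_refl: "L2_fun f \<Longrightarrow> L2_eq f f"
  by (simp add: L2_eq_def)

lemma L2_fun_rep: "L2_fun (L2_rep u)"
  using Quotient_rep_reflp[OF Quotient_L2_S7, of u] by (simp add: L2_eq_def)

lemma L2_class_rep: "L2_class (L2_rep u) = u"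
  by (rule Quotient_abs_rep[OF Quotient_L2_S7])

lemma L2_class_eqI: "L2_eq f g \<Longrightarrow> L2_class f = L2_class g"
  by (rule Quotient_rel_abs[OF Quotient_L2_S7])

lemma L2_class_zero: "L2_class (\<lambda>_. 0) = 0"
  by (simp add: zero_L2_S7_def)

lemma L2_class_add: "L2_fun f \<Longrightarrow> L2_fun g \<Longrightarrow> L2_class f + L2_class g = L2_class (\<lambda>x. f x + g x)"
  by (rule plus_L2_S7.abs_eq) (simp_all add: L2_eq_refl)

lemma L2_class_scaleR: "L2_fun f \<Longrightarrow> c *\<^sub>R L2_class f = L2_class (\<lambda>x. c * f x)"
  by (rule scaleR_L2_S7.abs_eq) (simp_all add: L2_eq_refl)

lemma L2_class_diff:
  assumes f: "L2_fun f" and g: "L2_fun g"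
  shows "L2_class f - L2_class g = L2_class (\<lambda>x. f x - g x)"
proof -
  have "L2_class f - L2_class g = L2_class f + (- 1) *\<^sub>R L2_class g" by simp
  also have "\<dots> = L2_class (\<lambda>x. f x + (- 1) * g x)"
    by (simp only: L2_class_scaleR[OF g] L2_class_add[OF f L2_fun_scale[OF g]])
  finally show ?thesis by simp
qed

lemma L2_class_inner: "L2_fun f \<Longrightarrow> L2_fun g \<Longrightarrow> L2_class f \<bullet> L2_class g = (LINT x|S7_volume. f x * g x)"
  by (rule inner_L2_S7.abs_eq) (simp_all add: L2_eq_refl)

lemma L2_fun_diff: "L2_fun f \<Longrightarrow> L2_fun g \<Longrightarrow> L2_fun (\<lambda>x. f x - g x)"
  using L2_fun_add[of f "\<lambda>x. - 1 * g x"] L2_fun_scale[of g "- 1"] by simp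

lemma norm_L2_class: "L2_fun f \<Longrightarrow> (norm (L2_class f))\<^sup>2 = (LINT x|S7_volume. (f x)\<^sup>2)"
  unfolding power2_norm_eq_inner by (simp add: L2_class_inner flip: power2_eq_square)

text \<open>Geometrically small steps make the increments of the representatives summable almost
  everywhere, so the representatives converge almost everywhere; Fatou's lemma shows that this
  pointwise limit is also the limit in norm.\<close>

lemma L2_fast_Cauchy_converges:
  fixes u :: "nat \<Rightarrow> L2_S7"
  assumes u: "\<And>k. norm (u (Suc k) - u k) \<le> (1 / 2) ^ k"
  shows "convergent u"
proof -
  interpret finite_measure S7_volume by (rule finite_measure_S7)
  define f where "f k = L2_rep (u k)" for k
  have f: "L2_fun (f k)" "L2_class (f k) = u k" for k
    by (simp_all add: f_def L2_fun_rep L2_class_rep)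
  have meas [measurable]: "f k \<in> borel_measurable S7_volume" for k
    using f(1)[of k] by (simp add: L2_fun_def)
  define d where "d k x = \<bar>f (Suc k) x - f k x\<bar>" for k x
  have diff_L2: "L2_fun (\<lambda>x. f m x - f n x)" for m n
    by (intro L2_fun_diff f)
  have norm_diff: "(LINT x|S7_volume. (f m x - f n x)\<^sup>2) = (norm (u m - u n))\<^sup>2" for m n
    using norm_L2_class[OF diff_L2] L2_class_diff[OF f(1) f(1)] by (simp add: f(2))
  have d_meas [measurable]: "d k \<in> borel_measurable S7_volume" for k
    unfolding d_def by measurable
  have d_nonneg: "0 \<le> d k x" for k x
    by (simp add: d_def)
  have d_int: "integrable S7_volume (d k)" for k
    unfolding d_def using L2_fun_integrable[OF diff_L2] by auto
  define C where "C = measure S7_volume (space S7_volume)"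
  have d_bound: "(LINT x|S7_volume. d k x) \<le> (1 + C) * (1 / 2) ^ k" for k
  proof -
    have sq: "integrable S7_volume (\<lambda>x. (f (Suc k) x - f k x)\<^sup>2)"
      using diff_L2 by (simp add: L2_fun_def)
    \<comment> \<open>The inequality \<open>2 * p \<le> p\<^sup>2 + 1\<close> at
      \<open>p = 2 ^ k * d k x\<close>. The weight balances a squared norm of at most
      \<open>(1 / 4) ^ k\<close>, so both terms integrate to multiples of
      \<open>(1 / 2) ^ k\<close>.\<close>
    have "d k x \<le> 2 ^ k * (f (Suc k) x - f k x)\<^sup>2 + (1 / 2) ^ k" for x
    proof -
      have "2 * p \<le> p\<^sup>2 + 1" for p :: real
        using sum_squares_bound[of p 1] by simp
      from this[of "2 ^ k * d k x"]
      have "2 * (2 ^ k * d k x) \<le> 2 ^ k * (2 ^ k * (d k x)\<^sup>2) + 1"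
        by (simp add: power2_eq_square mult_ac)
      moreover have "0 \<le> 2 ^ k * d k x" by (simp add: d_def)
      ultimately have "2 ^ k * d k x \<le> 2 ^ k * (2 ^ k * (d k x)\<^sup>2) + 1" by linarith
      then have "2 ^ k * d k x \<le> 2 ^ k * (2 ^ k * (d k x)\<^sup>2 + (1 / 2) ^ k)"
        by (simp add: distrib_left power_one_over)
      then show ?thesis by (simp add: d_def)
    qed
    then have "(LINT x|S7_volume. d k x) \<le> (LINT x|S7_volume. 2 ^ k * (f (Suc k) x - f k x)\<^sup>2 + (1 / 2) ^ k)"
      using d_int sq by (intro integral_mono) auto
    also have "\<dots> = 2 ^ k * (norm (u (Suc k) - u k))\<^sup>2 + C * (1 / 2) ^ k"
      using sq by (simp add: norm_diff C_def)
    also have "\<dots> \<le> 2 ^ k * ((1 / 2) ^ k)\<^sup>2 + C * (1 / 2) ^ k"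
      using u by (intro add_right_mono mult_left_mono power_mono) auto
    also have "\<dots> = (1 + C) * (1 / 2) ^ k"
      by (simp add: power2_eq_square power_one_over add_divide_distrib)
    finally show ?thesis .
  qed
  have "(\<integral>\<^sup>+ x. (\<Sum>k. ennreal (d k x)) \<partial>S7_volume) = (\<Sum>k. ennreal (LINT x|S7_volume. d k x))"
    using nn_integral_eq_integral[OF d_int] by (simp add: nn_integral_suminf d_nonneg)
  also have "\<dots> \<le> (\<Sum>k. ennreal ((1 + C) * (1 / 2) ^ k))"
    using d_bound by (intro suminf_le ennreal_leI) auto
  also have "\<dots> = ennreal (\<Sum>k. (1 + C) * (1 / 2) ^ k)"
    by (intro suminf_ennreal2 summable_mult) (auto simp: C_def)
  also have "\<dots> < \<infinity>" by simp
  finally have "AE x in S7_volume. (\<Sum>k. ennreal (d k x)) \<noteq> \<infinity>"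
    by (intro nn_integral_PInf_AE) auto
  then have conv: "AE x in S7_volume. (\<lambda>k. f k x) \<longlonglongrightarrow> lim (\<lambda>k. f k x)"
  proof eventually_elim
    case (elim x)
    have "summable (\<lambda>k. d k x)"
      by (rule summable_suminf_not_top[OF d_nonneg]) (use elim in simp)
    then have "summable (\<lambda>k. norm (f (Suc k) x - f k x))"
      by (simp add: d_def)
    then have "summable (\<lambda>k. f (Suc k) x - f k x)"
      by (rule summable_norm_cancel)
    then have "convergent (\<lambda>n. \<Sum>k<n. f (Suc k) x - f k x)"
      by (simp add: summable_iff_convergent)
    then have "convergent (\<lambda>n. f n x - f 0 x)"
      by (simp only: sum_lessThan_telescope[of "\<lambda>k. f k x"])
    then have "convergent (\<lambda>n. f n x - f 0 x + f 0 x)"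
      by (intro convergent_add convergent_const)
    then show ?case by (simp add: convergent_LIMSEQ_iff)
  qed
  \<comment> \<open>\<open>lim\<close> is unspecified where the sequence diverges, which by
    \<open>conv\<close> happens only on a null set.\<close>
  define g where "g x = lim (\<lambda>k. f k x)" for x
  have g_meas [measurable]: "g \<in> borel_measurable S7_volume"
    unfolding g_def by measurable
  have step: "norm (u (k + m) - u k) \<le> 2 * (1 / 2) ^ k * (1 - (1 / 2) ^ m)" for k m
  proof (induction m)
    case (Suc m)
    have "norm (u (k + Suc m) - u k) \<le> norm (u (Suc (k + m)) - u (k + m)) + norm (u (k + m) - u k)"
      by (metis add_Suc_right norm_diff_triangle_le order_refl)
    also have "\<dots> \<le> (1 / 2) ^ (k + m) + 2 * (1 / 2) ^ k * (1 - (1 / 2) ^ m)"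
      using u[of "k + m"] Suc by simp
    also have "\<dots> = 2 * (1 / 2) ^ k * (1 - (1 / 2) ^ Suc m)"
      by (simp add: power_add field_simps)
    finally show ?case .
  qed simp
  have tail: "norm (u m - u k) \<le> 2 * (1 / 2) ^ k" if "k \<le> m" for k m
  proof -
    have "norm (u m - u k) \<le> 2 * (1 / 2) ^ k * (1 - (1 / 2) ^ (m - k))"
      using step[of k "m - k"] that by simp
    also have "\<dots> \<le> 2 * (1 / 2) ^ k * 1"
      by (intro mult_left_mono) auto
    finally show ?thesis by simp
  qed
  have fatou: "(\<integral>\<^sup>+ x. ennreal ((g x - f k x)\<^sup>2) \<partial>S7_volume) \<le> ennreal ((2 * (1 / 2) ^ k)\<^sup>2)" for k
  proof -
    have "AE x in S7_volume. ennreal ((g x - f k x)\<^sup>2) = liminf (\<lambda>m. ennreal ((f m x - f k x)\<^sup>2))"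
      using conv
    proof eventually_elim
      case (elim x)
      have "(\<lambda>m. ennreal ((f m x - f k x)\<^sup>2)) \<longlonglongrightarrow> ennreal ((g x - f k x)\<^sup>2)"
        unfolding g_def using elim by (intro tendsto_ennrealI tendsto_intros)
      then show ?case
        by (intro lim_imp_Liminf[symmetric]) auto
    qed
    then have "(\<integral>\<^sup>+ x. ennreal ((g x - f k x)\<^sup>2) \<partial>S7_volume) =
        (\<integral>\<^sup>+ x. liminf (\<lambda>m. ennreal ((f m x - f k x)\<^sup>2)) \<partial>S7_volume)"
      by (rule nn_integral_cong_AE)
    also have "\<dots> \<le> liminf (\<lambda>m. \<integral>\<^sup>+ x. ennreal ((f m x - f k x)\<^sup>2) \<partial>S7_volume)"
      by (intro nn_integral_liminf) measurable
    also have "\<dots> \<le> ennreal ((2 * (1 / 2) ^ k)\<^sup>2)"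
    proof (rule Liminf_le)
      have "(\<integral>\<^sup>+ x. ennreal ((f m x - f k x)\<^sup>2) \<partial>S7_volume) \<le> ennreal ((2 * (1 / 2) ^ k)\<^sup>2)"
        if "k \<le> m" for m
      proof -
        have "(\<integral>\<^sup>+ x. ennreal ((f m x - f k x)\<^sup>2) \<partial>S7_volume) = ennreal ((norm (u m - u k))\<^sup>2)"
          using diff_L2[of m k] norm_diff by (subst nn_integral_eq_integral) (auto simp: L2_fun_def)
        also have "\<dots> \<le> ennreal ((2 * (1 / 2) ^ k)\<^sup>2)"
          using tail[OF that] by (intro ennreal_leI power_mono) auto
        finally show ?thesis .
      qed
      then show "\<forall>\<^sub>F m in sequentially. (\<integral>\<^sup>+ x. ennreal ((f m x - f k x)\<^sup>2) \<partial>S7_volume) \<le> ennreal ((2 * (1 / 2) ^ k)\<^sup>2)"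
        by (auto simp: eventually_sequentially)
    qed simp
    finally show ?thesis .
  qed
  have diff_g: "L2_fun (\<lambda>x. g x - f k x)" for k
    unfolding L2_fun_def
  proof
    show "integrable S7_volume (\<lambda>x. (g x - f k x)\<^sup>2)"
    proof (rule integrableI_nonneg)
      show "(\<integral>\<^sup>+ x. ennreal ((g x - f k x)\<^sup>2) \<partial>S7_volume) < \<infinity>"
        using fatou[of k] by (rule le_less_trans) simp
    qed auto
  qed measurable
  have g: "L2_fun g"
    using L2_fun_add[OF diff_g[of 0] f(1)[of 0]] by simp
  have "norm (L2_class g - u k) \<le> 2 * (1 / 2) ^ k" for k
  proof (rule power2_le_imp_le)
    have "ennreal ((norm (L2_class g - u k))\<^sup>2) = (\<integral>\<^sup>+ x. ennreal ((g x - f k x)\<^sup>2) \<partial>S7_volume)"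
      using norm_L2_class[OF diff_g[of k]] L2_class_diff[OF g f(1)] diff_g[of k]
      by (subst nn_integral_eq_integral) (auto simp: L2_fun_def f(2))
    also have "\<dots> \<le> ennreal ((2 * (1 / 2) ^ k)\<^sup>2)"
      by (rule fatou)
    finally show "(norm (L2_class g - u k))\<^sup>2 \<le> (2 * (1 / 2) ^ k)\<^sup>2"
      by (subst (asm) ennreal_le_iff) auto
  qed simp
  then have "\<forall>\<^sub>F k in sequentially. norm (u k - L2_class g) \<le> 2 * (1 / 2) ^ k"
    by (simp add: norm_minus_commute)
  moreover have "(\<lambda>k. 2 * (1 / 2 :: real) ^ k) \<longlonglongrightarrow> 0"
    by (intro tendsto_mult_right_zero LIMSEQ_realpow_zero) auto
  ultimately have "(\<lambda>k. u k - L2_class g) \<longlonglongrightarrow> 0"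
    by (rule Lim_null_comparison)
  then have "u \<longlonglongrightarrow> L2_class g"
    by (rule LIM_zero_cancel)
  then show ?thesis
    by (rule convergentI)
qed

text \<open>A Cauchy sequence has a subsequence with steps below \<open>(1 / 2) ^ k\<close> and
  converges along with it.\<close>

instance L2_S7 :: banach
proof
  fix u :: "nat \<Rightarrow> L2_S7" assume u: "Cauchy u"
  have "\<exists>M. \<forall>m\<ge>M. \<forall>n\<ge>M. norm (u m - u n) < (1 / 2) ^ k" for k
    using CauchyD[OF u, of "(1 / 2) ^ k"] by simp
  then obtain M where M: "\<And>k m n. M k \<le> m \<Longrightarrow> M k \<le> n \<Longrightarrow> norm (u m - u n) < (1 / 2) ^ k"
    by metis
  define r where "r = rec_nat (M 0) (\<lambda>k m. max (Suc m) (M (Suc k)))"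
  have r: "r k < r (Suc k)" "M k \<le> r k" for k
    by (simp_all add: r_def) (cases k; simp)
  then have mono: "strict_mono r" by (simp add: strict_mono_Suc_iff)
  have "norm ((u \<circ> r) (Suc k) - (u \<circ> r) k) \<le> (1 / 2) ^ k" for k
    using M[of k "r (Suc k)" "r k"] r[of k] by simp
  then have "convergent (u \<circ> r)"
    by (rule L2_fast_Cauchy_converges)
  then obtain l where "(u \<circ> r) \<longlonglongrightarrow> l" by (auto simp: convergent_def)
  then have "u \<longlonglongrightarrow> l"
    using Cauchy_converges_subseq[OF u mono] by blast
  then show "convergent u" by (rule convergentI)
qed

section \<open>The frame and its flows\<close>

lemma UNIV_8: "(UNIV :: 8 set) = {0, 1, 2, 3, 4, 5, 6, 7}"
proof -
  have "x \<in> {0, 1, 2, 3, 4, 5, 6, 7}" for x :: 8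
  proof (cases x rule: bit0.cases)
    fix n assume "x = of_int n" "0 \<le> n" "n < int CARD(4 bit0)"
    then have "n < 8" by simp
    with \<open>0 \<le> n\<close> have "n \<in> {0, 1, 2, 3, 4, 5, 6, 7}" by auto
    then show ?thesis using \<open>x = of_int n\<close> by auto
  qed
  then show ?thesis by auto
qed

lemma sum_8: "(\<Sum>i\<in>UNIV. f i) = f 0 + f 1 + f 2 + f 3 + f 4 + f 5 + f 6 + f (7 :: 8)"
  for f :: "8 \<Rightarrow> 'a::comm_monoid_add"
  unfolding UNIV_8 by (simp add: ac_simps)

lemma all_8: "(\<forall>i. P i) \<longleftrightarrow> P 0 \<and> P 1 \<and> P 2 \<and> P 3 \<and> P 4 \<and> P 5 \<and> P 6 \<and> P (7 :: 8)"
  using UNIV_8 by (metis UNIV_I empty_iff insert_iff)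

lemma vec8_nth:
  "vec8 c $ 0 = c ! 0" "vec8 c $ 1 = c ! 1" "vec8 c $ 2 = c ! 2" "vec8 c $ 3 = c ! 3"
  "vec8 c $ 4 = c ! 4" "vec8 c $ 5 = c ! 5" "vec8 c $ 6 = c ! 6" "vec8 c $ 7 = c ! 7"
  by (simp_all add: vec8_def axis_def eval_nat_numeral)


lemma frame_index: "a \<in> {1..7} \<Longrightarrow> a = 1 \<or> a = 2 \<or> a = 3 \<or> a = 4 \<or> a = 5 \<or> a = 6 \<or> a = (7::nat)"
  by auto

lemma X_skew: "a \<in> {1..7} \<Longrightarrow> X a x \<bullet> y = - (x \<bullet> X a y)"
  by (drule frame_index, elim disjE) (simp_all add: X_def inner_vec_def sum_8 vec8_nth algebra_simps)

text \<open>Each frame field is a linear complex structure; this is why its flow is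
  \<open>cos s + sin s X a\<close> and why linear functions are eigenfunctions of
  \<open>X_square a\<close>.\<close>

lemma X_X: "a \<in> {1..7} \<Longrightarrow> X a (X a x) = - x"
  by (drule frame_index, elim disjE) (simp_all add: X_def vec_eq_iff all_8 vec8_nth)

lemma X_add: "a \<in> {1..7} \<Longrightarrow> X a (x + y) = X a x + X a y"
  by (drule frame_index, elim disjE) (simp_all add: X_def vec_eq_iff all_8 vec8_nth)

lemma X_scaleR: "a \<in> {1..7} \<Longrightarrow> X a (c *\<^sub>R x) = c *\<^sub>R X a x"
  by (drule frame_index, elim disjE) (simp_all add: X_def vec_eq_iff all_8 vec8_nth)

lemma sum_frame: "(\<Sum>a = 1..7. f a) = f 1 + f 2 + f 3 + f 4 + f 5 + f 6 + f (7::nat)"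
  for f :: "nat \<Rightarrow> 'a::comm_monoid_add"
  by (simp add: eval_nat_numeral ac_simps)

text \<open>For a unit vector \<open>x\<close>, the eight vectors \<open>x\<close> and
  \<open>X a x\<close> are an orthonormal basis, and this is Parseval without the radial term. The
  homogeneous form holds on the whole space and can therefore be differentiated.\<close>

lemma frame_squares: "(\<Sum>a = 1..7. (X a x \<bullet> u)\<^sup>2) = (norm x)\<^sup>2 * (norm u)\<^sup>2 - (x \<bullet> u)\<^sup>2"
  unfolding power2_norm_eq_inner sum_frame
  by (simp add: X_def inner_vec_def sum_8 vec8_nth) algebra

text \<open>Polarisation of \<open>frame_squares\<close>.\<close>

lemma frame_products:
  "(\<Sum>a = 1..7. (X a x \<bullet> u) * (X a x \<bullet> v)) = (norm x)\<^sup>2 * (u \<bullet> v) - (x \<bullet> u) * (x \<bullet> v)"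
proof -
  have "(\<Sum>a = 1..7. (X a x \<bullet> (u + v))\<^sup>2) =
      (\<Sum>a = 1..7. (X a x \<bullet> u)\<^sup>2) + (\<Sum>a = 1..7. (X a x \<bullet> v)\<^sup>2) + 2 * (\<Sum>a = 1..7. (X a x \<bullet> u) * (X a x \<bullet> v))"
    by (simp add: inner_add_right power2_sum sum.distrib sum_distrib_left mult.assoc)
  moreover have "(norm (u + v))\<^sup>2 = (norm u)\<^sup>2 + (norm v)\<^sup>2 + 2 * (u \<bullet> v)"
    by (simp add: power2_norm_eq_inner inner_add_left inner_add_right inner_commute)
  ultimately show ?thesis
    unfolding frame_squares by (simp add: inner_add_right power2_sum algebra_simps)
qed

section \<open>Calculus of smooth functions and of derivatives along the frame\<close>

lemma has_derivative_imp_frechet: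
  "(F has_derivative F') (at x) \<Longrightarrow> frechet_derivative F (at x) = F'"
  by (metis frechet_derivative_at)

lemma Ck_Suc_has_derivative: "Ck (Suc k) F \<Longrightarrow> (F has_derivative frechet_derivative F (at x)) (at x)"
  by (simp flip: frechet_derivative_works)

lemma Ck_Suc_imp_Ck: "Ck (Suc k) F \<Longrightarrow> Ck k F"
proof (induction k arbitrary: F)
  case 0
  then show ?case
    by (auto simp: continuous_on_eq_continuous_at intro: differentiable_imp_continuous_within)
qed auto

lemma Ck_const: "Ck k (\<lambda>_. c)"
proof (induction k arbitrary: c)
  case (Suc k)
  then show ?case by simp
qed simp

lemma Ck_add: "Ck k F \<Longrightarrow> Ck k G \<Longrightarrow> Ck k (\<lambda>x. F x + G x)"
proof (induction k arbitrary: F G)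
  case 0
  then show ?case by (auto intro: continuous_intros)
next
  case (Suc k)
  have "frechet_derivative (\<lambda>x. F x + G x) (at x) = (\<lambda>v. frechet_derivative F (at x) v + frechet_derivative G (at x) v)" for x
    by (intro has_derivative_imp_frechet has_derivative_add Suc.prems[THEN Ck_Suc_has_derivative])
  then show ?case
    using Suc by simp
qed

lemma Ck_mult: "Ck k F \<Longrightarrow> Ck k G \<Longrightarrow> Ck k (\<lambda>x. F x * G x)"
proof (induction k arbitrary: F G)
  case 0
  then show ?case by (auto intro: continuous_intros)
next
  case (Suc k)
  have "frechet_derivative (\<lambda>x. F x * G x) (at x) =
      (\<lambda>v. F x * frechet_derivative G (at x) v + frechet_derivative F (at x) v * G x)" for x
    by (intro has_derivative_imp_frechet has_derivative_mult Suc.prems[THEN Ck_Suc_has_derivative])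
  then show ?case
    using Suc Ck_Suc_imp_Ck[OF Suc.prems(1)] Ck_Suc_imp_Ck[OF Suc.prems(2)] by (auto intro!: Ck_add)
qed

lemma Ck_inner: "Ck k (\<lambda>x. x \<bullet> u)"
proof (cases k)
  case 0
  then show ?thesis by (auto intro: continuous_intros)
next
  case (Suc m)
  have "((\<lambda>x. x \<bullet> u) has_derivative (\<lambda>v. v \<bullet> u)) (at x)" for x
    by (auto intro!: derivative_eq_intros)
  then have "frechet_derivative (\<lambda>x. x \<bullet> u) (at x) = (\<lambda>v. v \<bullet> u)" "(\<lambda>x. x \<bullet> u) differentiable (at x)" for x
    by (auto simp: has_derivative_imp_frechet differentiable_def)
  then show ?thesis
    using Suc Ck_const by simp
qed

lemma smooth_const: "smooth (\<lambda>_. c)"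
  by (simp add: smooth_def Ck_const)

lemma smooth_add: "smooth F \<Longrightarrow> smooth G \<Longrightarrow> smooth (\<lambda>x. F x + G x)"
  by (simp add: smooth_def Ck_add)

lemma smooth_mult: "smooth F \<Longrightarrow> smooth G \<Longrightarrow> smooth (\<lambda>x. F x * G x)"
  by (simp add: smooth_def Ck_mult)

lemma smooth_inner: "smooth (\<lambda>x. x \<bullet> u)"
  by (simp add: smooth_def Ck_inner)

lemma smooth_sum: "(\<And>i. i \<in> I \<Longrightarrow> smooth (F i)) \<Longrightarrow> smooth (\<lambda>x. \<Sum>i\<in>I. F i x)"
proof (induction I rule: infinite_finite_induct)
  case (insert i I)
  then show ?case using smooth_add[of "F i" "\<lambda>x. \<Sum>i\<in>I. F i x"] by simp
qed (simp_all add: smooth_const)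

lemma smooth_derivative: "smooth F \<Longrightarrow> smooth (\<lambda>x. frechet_derivative F (at x) v)"
  unfolding smooth_def by (metis Ck.simps(2))

lemma smooth_has_derivative: "smooth F \<Longrightarrow> (F has_derivative frechet_derivative F (at x)) (at x)"
  unfolding smooth_def by (metis Ck_Suc_has_derivative)

lemma smooth_continuous: "smooth F \<Longrightarrow> continuous_on S F"
  unfolding smooth_def by (metis Ck.simps(1) continuous_on_subset subset_UNIV)

lemma smooth_L2_fun: "smooth F \<Longrightarrow> L2_fun F"
  by (intro continuous_L2_fun smooth_continuous)

lemma axis_eq_inner: "x $ i = x \<bullet> axis i (1 :: real)"
  by (simp add: inner_axis)

lemma vec_expand: "(\<Sum>i\<in>UNIV. x $ i *\<^sub>R axis i (1 :: real)) = x"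
  by (rule basis_expansion[of x, unfolded scalar_mult_eq_scaleR])

lemma derivative_expand:
  assumes "smooth F"
  shows "frechet_derivative F (at x) v = (\<Sum>i\<in>UNIV. v $ i * frechet_derivative F (at x) (axis i 1))"
proof -
  interpret bounded_linear "frechet_derivative F (at x)"
    using smooth_has_derivative[OF assms] by (rule has_derivative_bounded_linear)
  have "frechet_derivative F (at x) v = frechet_derivative F (at x) (\<Sum>i\<in>UNIV. v $ i *\<^sub>R axis i 1)"
    by (simp only: vec_expand)
  then show ?thesis by (simp only: sum scaleR real_scaleR_def)
qed

text \<open>The minus sign goes inside so that the right side again has the shape
  \<open>x \<bullet> u\<close>: coefficients of the fields and derivatives of linear functions stay
  linear functions in this form.\<close>

lemma X_inner: "a \<in> {1..7} \<Longrightarrow> X a x \<bullet> u = x \<bullet> (- X a u)"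
  by (simp add: X_skew)

lemma X_deriv_expand:
  assumes "smooth F"
  shows "X_deriv a F x = (\<Sum>i\<in>UNIV. X a x $ i * frechet_derivative F (at x) (axis i 1))"
  unfolding X_deriv_def by (rule derivative_expand[OF assms])

lemma smooth_X_deriv:
  assumes F: "smooth F" and a: "a \<in> {1..7}"
  shows "smooth (X_deriv a F)"
proof -
  have "X_deriv a F = (\<lambda>x. \<Sum>i\<in>UNIV. (x \<bullet> (- X a (axis i 1))) * frechet_derivative F (at x) (axis i 1))"
    by (rule ext) (simp only: X_deriv_expand[OF F] axis_eq_inner X_inner[OF a])
  then show ?thesis
    by (simp only:) (intro smooth_sum smooth_mult smooth_inner smooth_derivative F)
qed

lemma smooth_X_square: "smooth F \<Longrightarrow> a \<in> {1..7} \<Longrightarrow> smooth (X_square a F)"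
  by (simp add: X_square_def smooth_X_deriv)

lemma X_deriv_const: "X_deriv a (\<lambda>_. c) = (\<lambda>_. 0)"
  by (simp add: X_deriv_def fun_eq_iff)

lemma X_deriv_add: "smooth F \<Longrightarrow> smooth G \<Longrightarrow> X_deriv a (\<lambda>x. F x + G x) = (\<lambda>x. X_deriv a F x + X_deriv a G x)"
  unfolding X_deriv_def fun_eq_iff
  by (intro allI fun_cong[OF has_derivative_imp_frechet] has_derivative_add smooth_has_derivative)

lemma X_deriv_mult:
  "smooth F \<Longrightarrow> smooth G \<Longrightarrow> X_deriv a (\<lambda>x. F x * G x) = (\<lambda>x. F x * X_deriv a G x + X_deriv a F x * G x)"
  unfolding X_deriv_def fun_eq_iff
  by (intro allI fun_cong[OF has_derivative_imp_frechet] has_derivative_mult smooth_has_derivative)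

lemma X_deriv_scale: "smooth F \<Longrightarrow> X_deriv a (\<lambda>x. c * F x) = (\<lambda>x. c * X_deriv a F x)"
  using X_deriv_mult[OF smooth_const, of F a c] by (simp add: X_deriv_const)

lemma X_deriv_sum:
  "(\<And>i. i \<in> I \<Longrightarrow> smooth (F i)) \<Longrightarrow> X_deriv a (\<lambda>x. \<Sum>i\<in>I. F i x) = (\<lambda>x. \<Sum>i\<in>I. X_deriv a (F i) x)"
proof (induction I rule: infinite_finite_induct)
  case (insert i I)
  then show ?case
    using X_deriv_add[of "F i" "\<lambda>x. \<Sum>i\<in>I. F i x" a] smooth_sum[of I F] by simp
qed (simp_all add: X_deriv_const)

lemma X_deriv_inner: "a \<in> {1..7} \<Longrightarrow> X_deriv a (\<lambda>x. x \<bullet> u) = (\<lambda>x. x \<bullet> (- X a u))"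
proof -
  assume a: "a \<in> {1..7}"
  have "((\<lambda>x. x \<bullet> u) has_derivative (\<lambda>v. v \<bullet> u)) (at x)" for x
    by (auto intro!: derivative_eq_intros)
  then have "frechet_derivative (\<lambda>x. x \<bullet> u) (at x) = (\<lambda>v. v \<bullet> u)" for x
    by (rule has_derivative_imp_frechet)
  then show ?thesis
    by (simp only: X_deriv_def fun_eq_iff X_inner[OF a]) simp
qed

section \<open>Integration by parts along the frame\<close>

lemma norm_X: "a \<in> {1..7} \<Longrightarrow> norm (X a x) = norm x"
  using X_skew[of a x "X a x"] X_X[of a x] by (simp add: norm_eq_sqrt_inner)

lemma X_orthogonal: "a \<in> {1..7} \<Longrightarrow> x \<bullet> X a x = 0"
  using X_skew[of a x x] by (simp add: inner_commute)

lemma frame_flow_orthogonal: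
  assumes a: "a \<in> {1..7}"
  shows "orthogonal_transformation (\<lambda>x. cos s *\<^sub>R x + sin s *\<^sub>R X a x)"
proof (subst orthogonal_transformation, intro conjI allI)
  show "linear (\<lambda>x. cos s *\<^sub>R x + sin s *\<^sub>R X a x)"
    by (rule linearI) (simp_all add: X_add[OF a] X_scaleR[OF a] algebra_simps)
  fix x
  have "(norm (cos s *\<^sub>R x + sin s *\<^sub>R X a x))\<^sup>2 =
      (cos s)\<^sup>2 * (norm x)\<^sup>2 + (sin s)\<^sup>2 * (norm x)\<^sup>2"
  proof -
    have "X a x \<bullet> x = 0" "X a x \<bullet> X a x = x \<bullet> x"
      using X_orthogonal[OF a, of x] norm_X[OF a, of x] by (simp_all add: inner_commute norm_eq)
    then show ?thesis
      unfolding power2_norm_eq_inner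
      by (simp add: inner_add_left inner_add_right inner_commute[of x "X a x"] power2_eq_square algebra_simps)
  qed
  also have "\<dots> = (norm x)\<^sup>2"
    by (simp flip: distrib_right)
  finally show "norm (cos s *\<^sub>R x + sin s *\<^sub>R X a x) = norm x"
    by (simp add: power2_eq_iff_nonneg)
qed

text \<open>The flow of \<open>X a\<close> consists of the rotations \<open>cos s + sin s X a\<close>, which preserve the volume.\<close>

lemma integral_X_deriv:
  assumes F: "smooth F" and a: "a \<in> {1..7}"
  shows "(LINT x|S7_volume. X_deriv a F x) = 0"
proof -
  define \<phi> where "\<phi> s x = cos s *\<^sub>R x + sin s *\<^sub>R X a x" for s x
  have \<phi>: "orthogonal_transformation (\<phi> s)" for s
    unfolding \<phi>_def[abs_def] by (rule frame_flow_orthogonal[OF a])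
  have sphere: "\<phi> s x \<in> sphere 0 1" if "x \<in> sphere 0 1" for s x
    using that orthogonal_transformation_norm[OF \<phi>] by simp
  have deriv: "((\<lambda>s. F (\<phi> s x)) has_real_derivative X_deriv a F (\<phi> s x)) (at s)" for s x
  proof -
    have "((\<lambda>s. \<phi> s x) has_vector_derivative X a (\<phi> s x)) (at s)"
      unfolding \<phi>_def X_add[OF a] X_scaleR[OF a] X_X[OF a]
      by (auto intro!: derivative_eq_intros simp: has_vector_derivative_def algebra_simps)
    then show ?thesis
      using vector_derivative_diff_chain_within[OF _ has_derivative_at_withinI[OF smooth_has_derivative[OF F]]]
      by (simp add: o_def X_deriv_def has_real_derivative_iff_has_vector_derivative)
  qed
  obtain K where K: "0 < K" "\<And>x. x \<in> sphere 0 1 \<Longrightarrow> \<bar>X_deriv a F x\<bar> \<le> K"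
    using continuous_bounded_S7[OF smooth_continuous[OF smooth_X_deriv[OF F a]]] by metis
  have meas: "F \<in> borel_measurable S7_volume"
    by (intro continuous_measurable_S7 smooth_continuous F)
  have meas': "(\<lambda>x. F (\<phi> s x)) \<in> borel_measurable S7_volume" for s
    by (rule measurable_compose[OF orthogonal_measurable_S7[OF \<phi>] meas])
  have int: "integrable S7_volume F"
    using smooth_L2_fun[OF F] by (rule L2_fun_integrable)
  have int': "integrable S7_volume (\<lambda>x. F (\<phi> s x))" for s
  proof -
    obtain C where "\<And>x. x \<in> sphere 0 1 \<Longrightarrow> \<bar>F x\<bar> \<le> C"
      using continuous_bounded_S7[OF smooth_continuous[OF F]] by metis
    then show ?thesis using meas' sphere by (intro integrable_S7) auto
  qed
  \<comment> \<open>Each difference quotient along the flow has integral zero because rotations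
    preserve the volume; dominated convergence hands this on to \<open>X_deriv a F\<close>.\<close>
  define q where "q n x = (F (\<phi> (1 / Suc n) x) - F x) / (1 / Suc n)" for n x
  have "(\<lambda>n. LINT x|S7_volume. q n x) \<longlonglongrightarrow> (LINT x|S7_volume. X_deriv a F x)"
  proof (rule integral_dominated_convergence[where w = "\<lambda>_. K"])
    show "X_deriv a F \<in> borel_measurable S7_volume"
      by (intro continuous_measurable_S7 smooth_continuous smooth_X_deriv F a)
    show "q n \<in> borel_measurable S7_volume" for n
      unfolding q_def using meas meas' by measurable
    show "integrable S7_volume (\<lambda>_. K)"
      by (rule integrable_S7[of _ "\<bar>K\<bar>"]) auto
    show "AE x in S7_volume. (\<lambda>n. q n x) \<longlonglongrightarrow> X_deriv a F x"
    proof (rule AE_I2)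
      fix x
      have "((\<lambda>h. (F (\<phi> h x) - F (\<phi> 0 x)) / h) \<longlongrightarrow> X_deriv a F (\<phi> 0 x)) (at_right 0)"
        by (rule has_real_derivative_at_right_quotient[OF deriv])
      moreover have "filterlim (\<lambda>n. 1 / real (Suc n)) (at_right 0) sequentially"
        using LIMSEQ_inverse_real_of_nat by (auto simp: filterlim_at inverse_eq_divide)
      ultimately have "(\<lambda>n. (F (\<phi> (1 / real (Suc n)) x) - F (\<phi> 0 x)) / (1 / real (Suc n))) \<longlonglongrightarrow> X_deriv a F (\<phi> 0 x)"
        by (rule filterlim_compose)
      then show "(\<lambda>n. q n x) \<longlonglongrightarrow> X_deriv a F x"
        by (simp add: q_def \<phi>_def)
    qed
    show "AE x in S7_volume. norm (q n x) \<le> K" for n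
    proof (rule AE_I2)
      fix x assume "x \<in> space S7_volume"
      then have x: "x \<in> sphere 0 1" by simp
      \<comment> \<open>The mean value theorem bounds the quotient by a value of
        \<open>X_deriv a F\<close> at another point of the orbit, which stays on the sphere; this
        supplies the dominating constant.\<close>
      have "\<exists>z. 0 < z \<and> z < 1 / Suc n \<and> F (\<phi> (1 / Suc n) x) - F (\<phi> 0 x) = (1 / Suc n - 0) * X_deriv a F (\<phi> z x)"
        by (rule MVT2) (use deriv in auto)
      then obtain z where "F (\<phi> (1 / Suc n) x) - F (\<phi> 0 x) = (1 / Suc n) * X_deriv a F (\<phi> z x)" by auto
      then have "q n x = X_deriv a F (\<phi> z x)"
        by (simp add: q_def \<phi>_def)
      then show "norm (q n x) \<le> K"
        using K(2)[OF sphere[OF x]] by simp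
    qed
  qed
  moreover have "(LINT x|S7_volume. q n x) = 0" for n
    unfolding q_def using int int' integral_S7_orthogonal[OF \<phi> meas] by simp
  ultimately show ?thesis
    by (simp add: LIMSEQ_const_iff)
qed

text \<open>The derivative of the product \<open>F x * G x\<close> along a frame field integrates to
  zero.\<close>

lemma integral_X_deriv_skew:
  assumes F: "smooth F" and G: "smooth G" and a: "a \<in> {1..7}"
  shows "(LINT x|S7_volume. X_deriv a F x * G x) = - (LINT x|S7_volume. F x * X_deriv a G x)"
proof -
  have "integrable S7_volume (\<lambda>x. F x * X_deriv a G x)" "integrable S7_volume (\<lambda>x. X_deriv a F x * G x)"
    by (intro L2_fun_mult smooth_L2_fun smooth_X_deriv F G a)+
  moreover have "(LINT x|S7_volume. F x * X_deriv a G x + X_deriv a F x * G x) = 0"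
    using integral_X_deriv[OF smooth_mult[OF F G] a] by (simp add: X_deriv_mult[OF F G])
  ultimately show ?thesis by simp
qed

lemma integral_X_square_form:
  assumes F: "smooth F" and G: "smooth G" and a: "a \<in> {1..7}"
  shows "(LINT x|S7_volume. X_square a F x * G x) = - (LINT x|S7_volume. X_deriv a F x * X_deriv a G x)"
  unfolding X_square_def by (rule integral_X_deriv_skew[OF smooth_X_deriv[OF F a] G a])

section \<open>The Laplace-Beltrami operator as a sum of squares\<close>

abbreviation (input) partial :: "8 \<Rightarrow> (real ^ 8 \<Rightarrow> real) \<Rightarrow> real ^ 8 \<Rightarrow> real" where
  "partial i F x \<equiv> frechet_derivative F (at x) (axis i 1)"

definition hess :: "(real ^ 8 \<Rightarrow> real) \<Rightarrow> real ^ 8 \<Rightarrow> real ^ 8 \<Rightarrow> real ^ 8 \<Rightarrow> real" where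
  "hess F x u v = (\<Sum>i\<in>UNIV. \<Sum>j\<in>UNIV. u $ i * v $ j * partial j (partial i F) x)"

text \<open>The hypothesis says that the squares of the vectors \<open>u k\<close> sum to
  \<open>c\<close> times the identity minus the square of \<open>y\<close>; the Hessian then yields
  \<open>c\<close> times the flat Laplacian minus the second derivative along \<open>y\<close>. It
  is applied both to the frame and to the projected coordinate vectors, which is how the two
  Laplacians are compared.\<close>

lemma hess_weighted_sum:
  assumes "\<And>i j. (\<Sum>k\<in>I. u k $ i * u k $ j) = c * axis i 1 $ j - y $ i * y $ j"
  shows "(\<Sum>k\<in>I. hess F x (u k) (u k)) = c * (\<Sum>i\<in>UNIV. partial i (partial i F) x) - hess F x y y"
proof -
  have diag: "(\<Sum>j\<in>UNIV. c * axis i 1 $ j * partial j (partial i F) x) = c * partial i (partial i F) x" for i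
  proof -
    have "(\<Sum>j\<in>UNIV. c * axis i 1 $ j * partial j (partial i F) x) =
        (\<Sum>j\<in>UNIV. if j = i then c * partial i (partial i F) x else 0)"
      by (intro sum.cong refl) (auto simp: axis_def)
    then show ?thesis by simp
  qed
  have "(\<Sum>k\<in>I. hess F x (u k) (u k)) =
      (\<Sum>i\<in>UNIV. \<Sum>j\<in>UNIV. (\<Sum>k\<in>I. u k $ i * u k $ j) * partial j (partial i F) x)"
    unfolding hess_def sum_distrib_right
    by (subst sum.swap, intro sum.cong refl, subst sum.swap, rule refl)
  also have "\<dots> = (\<Sum>i\<in>UNIV. \<Sum>j\<in>UNIV. c * axis i 1 $ j * partial j (partial i F) x) - hess F x y y"
    unfolding assms hess_def by (simp add: left_diff_distrib sum_subtractf)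
  finally show ?thesis by (simp only: diag sum_distrib_left)
qed

text \<open>The Hessian term comes from differentiating \<open>F\<close> twice. Differentiating the
  linear coefficients of \<open>X a\<close> instead gives \<open>X a (X a x) = - x\<close>, hence
  the radial first-order term.\<close>

lemma X_square_eq:
  assumes F: "smooth F" and a: "a \<in> {1..7}"
  shows "X_square a F x = hess F x (X a x) (X a x) - frechet_derivative F (at x) x"
proof -
  have *: "X_deriv a F = (\<lambda>x. \<Sum>i\<in>UNIV. (x \<bullet> (- X a (axis i 1))) * partial i F x)"
    by (rule ext) (simp only: X_deriv_expand[OF F] axis_eq_inner X_inner[OF a])
  have "X_square a F x = (\<Sum>i\<in>UNIV. X_deriv a (\<lambda>x. (x \<bullet> (- X a (axis i 1))) * partial i F x) x)"
    unfolding X_square_def * 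
    by (subst X_deriv_sum) (rule refl | intro smooth_mult smooth_inner smooth_derivative F)+
  also have "\<dots> = (\<Sum>i\<in>UNIV. X a x $ i * X_deriv a (partial i F) x - x $ i * partial i F x)"
  proof (intro sum.cong refl)
    fix i
    have twice: "x \<bullet> (- X a (- X a (axis i 1))) = - (x $ i)"
      by (metis X_X[OF a] X_inner[OF a] axis_eq_inner inner_minus_left)
    have once: "x \<bullet> (- X a (axis i 1)) = X a x $ i"
      by (metis X_inner[OF a] axis_eq_inner)
    show "X_deriv a (\<lambda>x. (x \<bullet> (- X a (axis i 1))) * partial i F x) x =
        X a x $ i * X_deriv a (partial i F) x - x $ i * partial i F x"
      unfolding X_deriv_mult[OF smooth_inner smooth_derivative[OF F]] X_deriv_inner[OF a] twice once by simp
  qed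
  also have "\<dots> = hess F x (X a x) (X a x) - frechet_derivative F (at x) x"
    unfolding hess_def derivative_expand[OF F, of x x] sum_subtractf
      X_deriv_expand[OF smooth_derivative[OF F]]
    by (simp add: sum_distrib_left mult.assoc)
  finally show ?thesis .
qed

lemma sum_frame_squares:
  assumes F: "smooth F"
  shows "(\<Sum>a = 1..7. X_square a F x) =
    (norm x)\<^sup>2 * (\<Sum>i\<in>UNIV. partial i (partial i F) x) - hess F x x x - 7 * frechet_derivative F (at x) x"
proof -
  have "(\<Sum>a = 1..7. X a x $ i * X a x $ j) = (norm x)\<^sup>2 * axis i 1 $ j - x $ i * x $ j" for i j
    using frame_products[of x "axis i 1" "axis j 1"] by (simp add: inner_axis)
  from hess_weighted_sum[of "\<lambda>a. X a x" "{1..7}", OF this, of F x]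
  show ?thesis
    by (simp add: X_square_eq[OF F] sum_subtractf)
qed

lemma sum_Basis_vec8:
  fixes f :: "real ^ 8 \<Rightarrow> 'b::comm_monoid_add"
  shows "(\<Sum>b\<in>Basis. f b) = (\<Sum>i\<in>UNIV. f (axis i 1))"
proof -
  have Basis: "(Basis :: (real ^ 8) set) = range (\<lambda>i. axis i 1)"
    by (auto simp: Basis_vec_def)
  have inj: "inj (\<lambda>i. axis i 1 :: real ^ 8)"
    by (auto simp: inj_on_def axis_eq_axis)
  show ?thesis unfolding Basis sum.reindex[OF inj] by simp
qed

text \<open>On the sphere both sides equal the flat Laplacian minus the second radial derivative
  minus seven times the radial derivative. The seven is the number of fields on one side and the
  trace of the tangential projection on the other.\<close>

lemma laplace_beltrami_sphere:
  assumes F: "smooth F" and x: "x \<in> sphere 0 1"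
  shows "laplace_beltrami F x = (\<Sum>a = 1..7. X_square a F x)"
proof -
  have xx: "x \<bullet> x = 1" using x by (simp flip: power2_norm_eq_inner)
  define G where "G y = (\<Sum>i\<in>UNIV. partial i F y *\<^sub>R axis i (1 :: real))" for y
  define DG where "DG w = (\<Sum>i\<in>UNIV. frechet_derivative (partial i F) (at x) w *\<^sub>R axis i (1 :: real))" for w
  have G: "(G has_derivative DG) (at x)"
    unfolding G_def[abs_def] DG_def[abs_def]
    by (intro has_derivative_sum has_derivative_scaleR_left smooth_has_derivative smooth_derivative F)
  have grad: "sphere_grad F = (\<lambda>y. G y - (y \<bullet> G y) *\<^sub>R y)"
    by (simp add: fun_eq_iff sphere_grad_def tangential_def sum_Basis_vec8 G_def)
  have "((\<lambda>y. G y - (y \<bullet> G y) *\<^sub>R y) has_derivative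
      (\<lambda>w. DG w - ((x \<bullet> G x) *\<^sub>R w + (x \<bullet> DG w + w \<bullet> G x) *\<^sub>R x))) (at x)"
    by (intro has_derivative_diff has_derivative_scaleR has_derivative_inner G has_derivative_ident)
  then have D: "frechet_derivative (sphere_grad F) (at x) =
      (\<lambda>w. DG w - ((x \<bullet> G x) *\<^sub>R w + (x \<bullet> DG w + w \<bullet> G x) *\<^sub>R x))"
    unfolding grad by (rule has_derivative_imp_frechet)
  \<comment> \<open>The eight vectors \<open>P i\<close> are not a basis of the tangent space, but
    their squares sum to the tangential projection, so the trace may be computed with them. Being
    tangential, they kill the terms of the derivative along \<open>x\<close>.\<close>
  define P where "P i = tangential x (axis i 1)" for i
  have Px: "P i \<bullet> x = 0" for i
    using xx by (simp add: P_def tangential_def inner_diff_left inner_diff_right inner_commute)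
  have self_adjoint: "tangential x u \<bullet> axis i 1 = u \<bullet> P i" for u i
    by (simp add: P_def tangential_def inner_diff_left inner_diff_right inner_commute)
  have PP: "P i \<bullet> P i = 1 - (x $ i)\<^sup>2" for i
    using xx by (simp add: P_def tangential_def inner_diff_left inner_diff_right inner_commute
        inner_axis inner_axis_axis power2_eq_square)
  have "x \<bullet> G x = frechet_derivative F (at x) x"
    by (simp add: G_def inner_sum_right inner_axis derivative_expand[OF F, of x x] mult.commute)
  moreover have "DG (P i) \<bullet> P i = hess F x (P i) (P i)" for i
    unfolding DG_def hess_def inner_sum_left derivative_expand[OF smooth_derivative[OF F], of _ x "P i"]
    by (simp add: inner_axis' sum_distrib_left sum_distrib_right mult_ac)
  ultimately have "tangential x (frechet_derivative (sphere_grad F) (at x) (P i)) \<bullet> axis i 1 =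
      hess F x (P i) (P i) - frechet_derivative F (at x) x * (P i \<bullet> P i)" for i
    unfolding self_adjoint D using Px[of i]
    by (simp add: inner_diff_left inner_add_left inner_commute[of x "P i"])
  then have "laplace_beltrami F x =
      (\<Sum>i\<in>UNIV. hess F x (P i) (P i)) - frechet_derivative F (at x) x * (\<Sum>i\<in>UNIV. P i \<bullet> P i)"
    unfolding laplace_beltrami_def sphere_div_def sum_Basis_vec8 P_def[symmetric]
    by (simp add: sum_subtractf sum_distrib_left)
  also have "(\<Sum>i\<in>UNIV. P i \<bullet> P i) = 7"
    using xx unfolding PP by (simp add: sum_subtractf inner_vec_def power2_eq_square)
  also have "(\<Sum>i\<in>UNIV. hess F x (P i) (P i)) = 1 * (\<Sum>i\<in>UNIV. partial i (partial i F) x) - hess F x x x"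
  proof (rule hess_weighted_sum)
    fix i j
    have comp: "P k $ i = axis k 1 $ i - x $ k * x $ i" for k i
      by (simp add: P_def tangential_def inner_axis)
    have "(\<Sum>k\<in>UNIV. P k $ i * P k $ j) = (\<Sum>k\<in>UNIV. axis k 1 $ i * axis k 1 $ j)
        - (\<Sum>k\<in>UNIV. axis k 1 $ i * x $ k) * x $ j - (\<Sum>k\<in>UNIV. axis k 1 $ j * x $ k) * x $ i
        + (\<Sum>k\<in>UNIV. x $ k * x $ k) * (x $ i * x $ j)"
      unfolding comp by (simp add: algebra_simps sum.distrib sum_subtractf sum_distrib_left)
    moreover have "(\<Sum>k\<in>UNIV. axis k (1 :: real) $ i * x $ k) = x $ i" for i
      by (simp add: axis_def if_distrib[of "\<lambda>c. c * _"] cong: if_cong)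
    moreover have "(\<Sum>k\<in>UNIV. axis k (1 :: real) $ i * axis k 1 $ j) = axis i 1 $ j"
      by (simp add: axis_def if_distrib[of "\<lambda>c. c * _"] cong: if_cong)
    moreover have "(\<Sum>k\<in>UNIV. x $ k * x $ k) = 1"
      using xx by (simp add: inner_vec_def)
    ultimately show "(\<Sum>k\<in>UNIV. P k $ i * P k $ j) = 1 * axis i 1 $ j - x $ i * x $ j"
      by simp
  qed
  finally show ?thesis
    using xx unfolding sum_frame_squares[OF F] power2_norm_eq_inner by simp
qed

section \<open>Polynomials\<close>

text \<open>Polynomials of degree at most \<open>n\<close>, built one linear factor at a time with
  an arbitrary direction \<open>u\<close>: differentiation along a frame field replaces
  \<open>u\<close> by \<open>- X a u\<close> and keeps the shape.\<close>

inductive pol :: "nat \<Rightarrow> (real ^ 8 \<Rightarrow> real) \<Rightarrow> bool" where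
  pol_const: "pol n (\<lambda>_. c)"
| pol_add: "pol n f \<Longrightarrow> pol n g \<Longrightarrow> pol n (\<lambda>x. f x + g x)"
| pol_inner: "pol n g \<Longrightarrow> pol (Suc n) (\<lambda>x. (x \<bullet> u) * g x)"

lemma pol_smooth: "pol n f \<Longrightarrow> smooth f"
  by (induction rule: pol.induct) (auto intro: smooth_const smooth_add smooth_mult smooth_inner)

lemma pol_Suc: "pol n f \<Longrightarrow> pol (Suc n) f"
  by (induction rule: pol.induct) (auto intro: pol.intros)

lemma pol_mono: "pol m f \<Longrightarrow> m \<le> n \<Longrightarrow> pol n f"
  by (induction n) (auto simp: le_Suc_eq intro: pol_Suc)

lemma pol_scale: "pol n f \<Longrightarrow> pol n (\<lambda>x. c * f x)"
proof (induction rule: pol.induct)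
  case (pol_add n f g)
  then show ?case by (simp add: distrib_left pol.pol_add)
next
  case (pol_inner n g u)
  from pol_inner.IH have "pol (Suc n) (\<lambda>x. (x \<bullet> u) * (c * g x))" by (rule pol.pol_inner)
  then show ?case by (simp add: mult.left_commute)
qed (rule pol.pol_const)

lemma pol_mult: "pol m f \<Longrightarrow> pol n g \<Longrightarrow> pol (m + n) (\<lambda>x. f x * g x)"
proof (induction rule: pol.induct)
  case (pol_const m c)
  then show ?case by (intro pol_scale) (rule pol_mono, auto)
next
  case (pol_add m f h)
  then show ?case by (simp add: distrib_right pol.pol_add)
next
  case (pol_inner m h u)
  then have "pol (Suc (m + n)) (\<lambda>x. (x \<bullet> u) * (h x * g x))"
    by (intro pol.pol_inner)
  then show ?case by (simp add: mult.assoc)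
qed

text \<open>Connects \<open>pol\<close> with the class of polynomials for which Stone-Weierstrass
  density is stated.\<close>

lemma real_polynomial_function_imp_pol: "real_polynomial_function p \<Longrightarrow> \<exists>n. pol n p"
proof (induction rule: real_polynomial_function.induct)
  case (linear f)
  interpret bounded_linear f by fact
  define u where "u = (\<Sum>i\<in>UNIV. f (axis i 1) *\<^sub>R axis i (1 :: real))"
  have "f x = (x \<bullet> u) * 1" for x
  proof -
    have "f x = f (\<Sum>i\<in>UNIV. x $ i *\<^sub>R axis i 1)" by (simp only: vec_expand)
    also have "\<dots> = (\<Sum>i\<in>UNIV. x $ i * f (axis i 1))" by (simp only: sum scaleR real_scaleR_def)
    finally show ?thesis by (simp add: u_def inner_sum_right inner_axis mult.commute)
  qed
  then have "f = (\<lambda>x. (x \<bullet> u) * 1)" by blast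
  then have "pol (Suc 0) f" using pol_inner[OF pol_const] by metis
  then show ?case by blast
next
  case (const c)
  show ?case using pol_const by blast
next
  case (add f g)
  then obtain m n where "pol m f" "pol n g" by blast
  then have "pol (max m n) (\<lambda>x. f x + g x)"
    by (intro pol_add) (auto elim: pol_mono)
  then show ?case by blast
next
  case (mult f g)
  then show ?case using pol_mult by blast
qed

lemma pol_X_deriv: "pol n f \<Longrightarrow> a \<in> {1..7} \<Longrightarrow> pol n (X_deriv a f)"
proof (induction rule: pol.induct)
  case (pol_const n c)
  show ?case unfolding X_deriv_const by (rule pol.pol_const)
next
  case (pol_add n f g)
  then show ?case
    by (simp add: X_deriv_add pol_smooth pol.pol_add)
next
  case (pol_inner n g u)
  have "X_deriv a (\<lambda>x. (x \<bullet> u) * g x) = (\<lambda>x. (x \<bullet> u) * X_deriv a g x + (x \<bullet> (- X a u)) * g x)"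
    using pol_inner by (simp only: X_deriv_mult[OF smooth_inner pol_smooth] X_deriv_inner)
  moreover have "pol (Suc n) (\<lambda>x. (x \<bullet> u) * X_deriv a g x + (x \<bullet> (- X a u)) * g x)"
    using pol_inner by (intro pol.pol_add pol.pol_inner)
  ultimately show ?case by simp
qed

lemma pol_X_square: "pol n f \<Longrightarrow> a \<in> {1..7} \<Longrightarrow> pol n (X_square a f)"
  unfolding X_square_def by (intro pol_X_deriv)

lemma pol_sum: "(\<And>i. i \<in> I \<Longrightarrow> pol n (f i)) \<Longrightarrow> pol n (\<lambda>x. \<Sum>i\<in>I. f i x)"
proof (induction I rule: infinite_finite_induct)
  case (insert i I)
  then show ?case using pol_add[of n "f i" "\<lambda>x. \<Sum>i\<in>I. f i x"] by simp
qed (simp_all add: pol_const)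

section \<open>Commutation of the first frame field with the sum of squares\<close>

definition frame_laplacian :: "(real ^ 8 \<Rightarrow> real) \<Rightarrow> real ^ 8 \<Rightarrow> real" where
  "frame_laplacian F x = (\<Sum>a = 1..7. X_square a F x)"

text \<open>Carre du champ of \<open>F\<close> with the linear function \<open>x \<mapsto> x \<bullet> w\<close>.\<close>

definition carre :: "real ^ 8 \<Rightarrow> (real ^ 8 \<Rightarrow> real) \<Rightarrow> real ^ 8 \<Rightarrow> real" where
  "carre w F x = (\<Sum>a = 1..7. (X a x \<bullet> w) * X_deriv a F x)"

lemma carre_eq: "carre w F x = (\<Sum>a = 1..7. (x \<bullet> (- X a w)) * X_deriv a F x)"
  unfolding carre_def by (intro sum.cong refl) (simp only: X_inner)

lemma smooth_carre: "smooth F \<Longrightarrow> smooth (carre w F)"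
  unfolding carre_eq[abs_def] by (intro smooth_sum smooth_mult smooth_inner smooth_X_deriv)

lemma smooth_frame_laplacian: "smooth F \<Longrightarrow> smooth (frame_laplacian F)"
  unfolding frame_laplacian_def[abs_def] by (intro smooth_sum smooth_X_square)

lemma X_square_add:
  "smooth F \<Longrightarrow> smooth G \<Longrightarrow> a \<in> {1..7} \<Longrightarrow> X_square a (\<lambda>x. F x + G x) = (\<lambda>x. X_square a F x + X_square a G x)"
  by (simp add: X_square_def X_deriv_add smooth_X_deriv)

lemma X_square_scale: "smooth F \<Longrightarrow> a \<in> {1..7} \<Longrightarrow> X_square a (\<lambda>x. c * F x) = (\<lambda>x. c * X_square a F x)"
  by (simp add: X_square_def X_deriv_scale smooth_X_deriv)

lemma frame_laplacian_add:
  "smooth F \<Longrightarrow> smooth G \<Longrightarrow> frame_laplacian (\<lambda>x. F x + G x) = (\<lambda>x. frame_laplacian F x + frame_laplacian G x)"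
  by (simp add: frame_laplacian_def fun_eq_iff X_square_add sum.distrib)

lemma frame_laplacian_const: "frame_laplacian (\<lambda>_. c) = (\<lambda>_. 0)"
  by (simp add: frame_laplacian_def fun_eq_iff X_square_def X_deriv_const)

lemma carre_const: "carre w (\<lambda>_. c) = (\<lambda>_. 0)"
  by (simp add: carre_def fun_eq_iff X_deriv_const)

lemma carre_add: "smooth F \<Longrightarrow> smooth G \<Longrightarrow> carre w (\<lambda>x. F x + G x) x = carre w F x + carre w G x"
  by (simp add: carre_def X_deriv_add sum.distrib distrib_left)

lemma carre_mult_inner:
  assumes F: "smooth F"
  shows "carre w (\<lambda>x. (x \<bullet> u) * F x) x =
    ((norm x)\<^sup>2 * (w \<bullet> u) - (x \<bullet> w) * (x \<bullet> u)) * F x + (x \<bullet> u) * carre w F x"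
proof -
  have "carre w (\<lambda>x. (x \<bullet> u) * F x) x =
      (\<Sum>a = 1..7. (X a x \<bullet> w) * ((x \<bullet> u) * X_deriv a F x + (X a x \<bullet> u) * F x))"
    unfolding carre_def
    by (intro sum.cong refl) (simp only: X_deriv_mult[OF smooth_inner F] X_deriv_inner X_inner)
  also have "\<dots> = (\<Sum>a = 1..7. (X a x \<bullet> w) * (X a x \<bullet> u)) * F x + (x \<bullet> u) * carre w F x"
    unfolding carre_def
    by (simp add: distrib_left sum.distrib sum_distrib_left sum_distrib_right mult_ac)
  finally show ?thesis by (simp only: frame_products)
qed

text \<open>Second-order product rule: each of the seven squares maps the linear function to its
  negative, and the cross terms add up to twice the carre du champ.\<close>

lemma frame_laplacian_mult_inner:
  assumes F: "smooth F"
  shows "frame_laplacian (\<lambda>x. (x \<bullet> u) * F x) x =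
    - 7 * ((x \<bullet> u) * F x) + 2 * carre u F x + (x \<bullet> u) * frame_laplacian F x"
proof -
  have "X_square a (\<lambda>x. (x \<bullet> u) * F x) x =
      - ((x \<bullet> u) * F x) + 2 * ((X a x \<bullet> u) * X_deriv a F x) + (x \<bullet> u) * X_square a F x"
    if a: "a \<in> {1..7}" for a
  proof -
    have "X_deriv a (\<lambda>x. (x \<bullet> u) * F x) = (\<lambda>x. (x \<bullet> u) * X_deriv a F x + (x \<bullet> (- X a u)) * F x)"
      by (simp only: X_deriv_mult[OF smooth_inner F] X_deriv_inner[OF a])
    then have "X_square a (\<lambda>x. (x \<bullet> u) * F x) x =
        X_deriv a (\<lambda>x. (x \<bullet> u) * X_deriv a F x + (x \<bullet> (- X a u)) * F x) x"
      by (simp only: X_square_def)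
    also have "\<dots> = X_deriv a (\<lambda>x. (x \<bullet> u) * X_deriv a F x) x + X_deriv a (\<lambda>x. (x \<bullet> (- X a u)) * F x) x"
      by (subst X_deriv_add) (rule refl | intro smooth_mult smooth_inner smooth_X_deriv F a)+
    also have "\<dots> = (x \<bullet> u) * X_deriv a (X_deriv a F) x + (x \<bullet> (- X a u)) * X_deriv a F x
        + ((x \<bullet> (- X a u)) * X_deriv a F x + (x \<bullet> (- X a (- X a u))) * F x)"
      by (simp only: X_deriv_mult[OF smooth_inner F] X_deriv_mult[OF smooth_inner smooth_X_deriv[OF F a]]
          X_deriv_inner[OF a])
    also have "x \<bullet> (- X a (- X a u)) = - (x \<bullet> u)"
      by (metis X_X[OF a] X_inner[OF a] inner_minus_left)
    finally show ?thesis
      by (simp add: X_square_def X_inner[OF a])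
  qed
  then show ?thesis
    by (simp add: frame_laplacian_def carre_def sum.distrib sum_subtractf sum_distrib_left sum_negf)
qed

text \<open>Infinitesimal invariance of the carre du champ under the rotations generated by
  \<open>X 1\<close>: differentiation acts on each of its two arguments, and on the linear one it
  replaces \<open>w\<close> by \<open>- X 1 w\<close>.\<close>

lemma X_deriv_carre:
  assumes "pol n F"
  shows "X_deriv 1 (carre w F) x = carre w (X_deriv 1 F) x + carre (- X 1 w) F x"
  using assms
proof (induction arbitrary: w x rule: pol.induct)
  case (pol_const n c)
  show ?case by (simp add: X_deriv_const carre_const)
next
  case (pol_add n F G)
  have F: "smooth F" "smooth G" using pol_add by (auto intro: pol_smooth)
  have "carre w (\<lambda>x. F x + G x) = (\<lambda>x. carre w F x + carre w G x)" for w
    using F by (simp add: fun_eq_iff carre_add)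
  then show ?case
    using pol_add.IH F
    by (simp add: X_deriv_add carre_add smooth_carre smooth_X_deriv)
next
  case (pol_inner n F u)
  have F: "smooth F" using pol_inner by (auto intro: pol_smooth)
  have one: "(1::nat) \<in> {1..7}" by simp
  have XF: "smooth (X_deriv 1 F)" by (rule smooth_X_deriv[OF F one])
  \<comment> \<open>The carre du champ of the two linear functions \<open>x \<bullet> w\<close> and
    \<open>x \<bullet> u\<close>, in the explicit form given by
    \<open>frame_products\<close>.\<close>
  define q where "q w u x = (norm x)\<^sup>2 * (w \<bullet> u) - (x \<bullet> w) * (x \<bullet> u)" for w u x :: "real ^ 8"
  have q: "q w u = (\<lambda>x. (\<Sum>i\<in>UNIV. (x \<bullet> axis i 1) * (x \<bullet> axis i 1)) * (w \<bullet> u) + (- 1) * ((x \<bullet> w) * (x \<bullet> u)))" for w u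
    unfolding q_def power2_norm_eq_inner by (simp add: fun_eq_iff inner_axis) (simp add: inner_vec_def)
  have smooth_q: "smooth (q w u)" for w u
    unfolding q by (intro smooth_add smooth_mult smooth_sum smooth_inner smooth_const)
  \<comment> \<open>The field annihilates the norm, and by skewness the terms
    \<open>(- X 1 w) \<bullet> u\<close> and \<open>w \<bullet> (- X 1 u)\<close> cancel.\<close>
  have Xq: "X_deriv 1 (q w u) x = q (- X 1 w) u x + q w (- X 1 u) x" for w u x
  proof -
    have deriv: "(q w u has_derivative (\<lambda>v. 2 * (x \<bullet> v) * (w \<bullet> u) - ((x \<bullet> w) * (v \<bullet> u) + (v \<bullet> w) * (x \<bullet> u)))) (at x)"
      unfolding q_def[abs_def] power2_norm_eq_inner
      by (auto intro!: derivative_eq_intros simp: inner_commute)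
    show ?thesis
      unfolding X_deriv_def has_derivative_imp_frechet[OF deriv] q_def
      using X_orthogonal[OF one, of x] X_skew[OF one, of x u] X_skew[OF one, of x w] X_skew[OF one, of w u]
      by (simp add: algebra_simps)
  qed
  have c: "carre w (\<lambda>x. (x \<bullet> u) * F x) = (\<lambda>x. q w u x * F x + (x \<bullet> u) * carre w F x)" for w u
    by (simp only: fun_eq_iff carre_mult_inner[OF F] q_def) simp
  have cX: "carre w (\<lambda>x. (x \<bullet> u) * X_deriv 1 F x) = (\<lambda>x. q w u x * X_deriv 1 F x + (x \<bullet> u) * carre w (X_deriv 1 F) x)"
    by (simp only: fun_eq_iff carre_mult_inner[OF XF] q_def) simp
  have X: "X_deriv 1 (\<lambda>x. (x \<bullet> u) * F x) = (\<lambda>x. (x \<bullet> u) * X_deriv 1 F x + (x \<bullet> (- X 1 u)) * F x)"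
    by (simp only: X_deriv_mult[OF smooth_inner F] X_deriv_inner[OF one])
  have "X_deriv 1 (carre w (\<lambda>x. (x \<bullet> u) * F x)) x =
      X_deriv 1 (\<lambda>x. q w u x * F x) x + X_deriv 1 (\<lambda>x. (x \<bullet> u) * carre w F x) x"
    unfolding c by (subst X_deriv_add) (rule refl | intro smooth_mult smooth_q smooth_inner smooth_carre F)+
  also have "\<dots> = q w u x * X_deriv 1 F x + (q (- X 1 w) u x + q w (- X 1 u) x) * F x
      + ((x \<bullet> u) * (carre w (X_deriv 1 F) x + carre (- X 1 w) F x) + (x \<bullet> (- X 1 u)) * carre w F x)"
    by (simp only: X_deriv_mult[OF smooth_q F] X_deriv_mult[OF smooth_inner smooth_carre[OF F]]
        X_deriv_inner[OF one] Xq pol_inner.IH)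
  finally have left: "X_deriv 1 (carre w (\<lambda>x. (x \<bullet> u) * F x)) x = \<dots>" .
  have "carre w (X_deriv 1 (\<lambda>x. (x \<bullet> u) * F x)) x =
      carre w (\<lambda>x. (x \<bullet> u) * X_deriv 1 F x) x + carre w (\<lambda>x. (x \<bullet> (- X 1 u)) * F x) x"
    unfolding X by (rule carre_add) (intro smooth_mult smooth_inner XF F)+
  also have "\<dots> = q w u x * X_deriv 1 F x + (x \<bullet> u) * carre w (X_deriv 1 F) x
      + (q w (- X 1 u) x * F x + (x \<bullet> (- X 1 u)) * carre w F x)"
    by (simp only: c cX)
  finally have middle: "carre w (X_deriv 1 (\<lambda>x. (x \<bullet> u) * F x)) x = \<dots>" .
  have right: "carre (- X 1 w) (\<lambda>x. (x \<bullet> u) * F x) x =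
      q (- X 1 w) u x * F x + (x \<bullet> u) * carre (- X 1 w) F x"
    by (simp only: c)
  show ?case
    unfolding left middle right by (simp only: distrib_right distrib_left ac_simps)
qed

text \<open>In the product rule for a linear factor, the terms containing \<open>- X 1 u\<close>
  that come from differentiating the factor are exactly those that \<open>X_deriv_carre\<close> and
  the derivative of the outer factor produce on the other side.\<close>

lemma X_deriv_frame_laplacian:
  assumes "pol n F"
  shows "X_deriv 1 (frame_laplacian F) x = frame_laplacian (X_deriv 1 F) x"
  using assms
proof (induction arbitrary: x rule: pol.induct)
  case (pol_const n c)
  show ?case by (simp add: X_deriv_const frame_laplacian_const)
next
  case (pol_add n F G)
  then show ?case
    by (simp add: pol_smooth X_deriv_add frame_laplacian_add smooth_frame_laplacian smooth_X_deriv)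
next
  case (pol_inner n F u)
  have F: "smooth F" using pol_inner by (auto intro: pol_smooth)
  have one: "(1::nat) \<in> {1..7}" by simp
  have XF: "smooth (X_deriv 1 F)" by (rule smooth_X_deriv[OF F one])
  have L: "frame_laplacian (\<lambda>x. (x \<bullet> u) * F x) =
      (\<lambda>x. (- 7 * ((x \<bullet> u) * F x) + 2 * carre u F x) + (x \<bullet> u) * frame_laplacian F x)" for u
    by (simp only: fun_eq_iff frame_laplacian_mult_inner[OF F]) simp
  have X: "X_deriv 1 (\<lambda>x. (x \<bullet> u) * F x) = (\<lambda>x. (x \<bullet> u) * X_deriv 1 F x + (x \<bullet> (- X 1 u)) * F x)"
    by (simp only: X_deriv_mult[OF smooth_inner F] X_deriv_inner[OF one])
  have sm: "smooth (\<lambda>x. (x \<bullet> u) * F x)" "smooth (\<lambda>x. - 7 * ((x \<bullet> u) * F x))" "smooth (\<lambda>x. 2 * carre u F x)"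
    "smooth (\<lambda>x. (x \<bullet> u) * frame_laplacian F x)"
    by (intro smooth_mult smooth_inner smooth_const smooth_carre smooth_frame_laplacian F)+
  have "X_deriv 1 (frame_laplacian (\<lambda>x. (x \<bullet> u) * F x)) x =
      - 7 * X_deriv 1 (\<lambda>x. (x \<bullet> u) * F x) x + 2 * X_deriv 1 (carre u F) x + X_deriv 1 (\<lambda>x. (x \<bullet> u) * frame_laplacian F x) x"
    unfolding L
    by (simp only: X_deriv_add[OF smooth_add[OF sm(2,3)] sm(4)] X_deriv_add[OF sm(2,3)]
        X_deriv_scale[OF sm(1)] X_deriv_scale[OF smooth_carre[OF F]])
  also have "\<dots> = - 7 * ((x \<bullet> u) * X_deriv 1 F x + (x \<bullet> (- X 1 u)) * F x)
      + 2 * (carre u (X_deriv 1 F) x + carre (- X 1 u) F x)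
      + ((x \<bullet> u) * frame_laplacian (X_deriv 1 F) x + (x \<bullet> (- X 1 u)) * frame_laplacian F x)"
    by (simp only: X X_deriv_carre[OF pol_inner.hyps] X_deriv_mult[OF smooth_inner smooth_frame_laplacian[OF F]]
        X_deriv_inner[OF one] pol_inner.IH)
  finally have left: "X_deriv 1 (frame_laplacian (\<lambda>x. (x \<bullet> u) * F x)) x = \<dots>" .
  have "frame_laplacian (X_deriv 1 (\<lambda>x. (x \<bullet> u) * F x)) x =
      frame_laplacian (\<lambda>x. (x \<bullet> u) * X_deriv 1 F x) x + frame_laplacian (\<lambda>x. (x \<bullet> (- X 1 u)) * F x) x"
    unfolding X by (subst frame_laplacian_add) (rule refl | intro smooth_mult smooth_inner XF F)+
  also have "\<dots> = - 7 * ((x \<bullet> u) * X_deriv 1 F x) + 2 * carre u (X_deriv 1 F) x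
      + (x \<bullet> u) * frame_laplacian (X_deriv 1 F) x
      + (- 7 * ((x \<bullet> (- X 1 u)) * F x) + 2 * carre (- X 1 u) F x + (x \<bullet> (- X 1 u)) * frame_laplacian F x)"
    by (simp only: frame_laplacian_mult_inner[OF F] frame_laplacian_mult_inner[OF XF])
  finally have right: "frame_laplacian (X_deriv 1 (\<lambda>x. (x \<bullet> u) * F x)) x = \<dots>" .
  show ?case
    unfolding left right by (simp only: distrib_right distrib_left ac_simps)
qed

section \<open>Sums of squares of frame fields\<close>

text \<open>One family for all three operators: \<open>{1}\<close> gives \<open>X_square 1\<close>,
  \<open>{2..7}\<close> the sub-Laplacian, and \<open>{1..7}\<close> agrees with the
  Laplace-Beltrami operator on the sphere.\<close>

definition frame_op :: "nat set \<Rightarrow> (real ^ 8 \<Rightarrow> real) \<Rightarrow> real ^ 8 \<Rightarrow> real" where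
  "frame_op I F x = (\<Sum>a\<in>I. X_square a F x)"

context
  fixes I :: "nat set"
  assumes I: "I \<subseteq> {1..7}"
begin

lemma smooth_frame_op: "smooth F \<Longrightarrow> smooth (frame_op I F)"
  unfolding frame_op_def[abs_def] using I by (intro smooth_sum smooth_X_square) auto

lemma frame_op_add:
  assumes "smooth F" "smooth G"
  shows "frame_op I (\<lambda>x. F x + G x) = (\<lambda>x. frame_op I F x + frame_op I G x)"
  unfolding frame_op_def[abs_def] fun_eq_iff sum.distrib[symmetric]
  by (intro allI sum.cong refl) (use I assms in \<open>simp add: X_square_add subset_iff\<close>)

lemma frame_op_scale:
  assumes "smooth F"
  shows "frame_op I (\<lambda>x. c * F x) = (\<lambda>x. c * frame_op I F x)"
  unfolding frame_op_def[abs_def] fun_eq_iff sum_distrib_left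
  by (intro allI sum.cong refl) (use I assms in \<open>simp add: X_square_scale subset_iff\<close>)

lemma pol_frame_op: "pol n p \<Longrightarrow> pol n (frame_op I p)"
  unfolding frame_op_def[abs_def] using I by (intro pol_sum pol_X_square) auto

text \<open>The right side is minus a symmetric nonnegative form, the source of both symmetry and
  sign of the operator.\<close>

lemma integral_frame_op:
  assumes F: "smooth F" and G: "smooth G"
  shows "(LINT x|S7_volume. frame_op I F x * G x) = - (\<Sum>a\<in>I. LINT x|S7_volume. X_deriv a F x * X_deriv a G x)"
proof -
  have "(LINT x|S7_volume. frame_op I F x * G x) = (\<Sum>a\<in>I. LINT x|S7_volume. X_square a F x * G x)"
    unfolding frame_op_def sum_distrib_right
    by (rule Bochner_Integration.integral_sum)
      (use I in \<open>auto intro!: L2_fun_mult smooth_L2_fun smooth_X_square F G\<close>)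
  also have "\<dots> = (\<Sum>a\<in>I. - (LINT x|S7_volume. X_deriv a F x * X_deriv a G x))"
    using I by (intro sum.cong refl integral_X_square_form F G) auto
  finally show ?thesis by (simp add: sum_negf)
qed

lemma frame_op_symmetric:
  assumes F: "smooth F" and G: "smooth G"
  shows "L2_class (frame_op I F) \<bullet> L2_class G = L2_class F \<bullet> L2_class (frame_op I G)"
proof -
  have "(LINT x|S7_volume. frame_op I F x * G x) = (LINT x|S7_volume. frame_op I G x * F x)"
    unfolding integral_frame_op[OF F G] integral_frame_op[OF G F] by (simp add: mult.commute)
  then show ?thesis
    using F G by (simp add: L2_class_inner smooth_L2_fun smooth_frame_op mult.commute)
qed

lemma frame_op_nonpos:
  assumes F: "smooth F"
  shows "L2_class (frame_op I F) \<bullet> L2_class F \<le> 0"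
proof -
  have "0 \<le> (\<Sum>a\<in>I. LINT x|S7_volume. X_deriv a F x * X_deriv a F x)"
    by (intro sum_nonneg Bochner_Integration.integral_nonneg) simp
  then show ?thesis
    using F by (simp add: L2_class_inner smooth_L2_fun smooth_frame_op integral_frame_op)
qed

lemma subspace_smooth_graph: "subspace (smooth_graph (frame_op I))"
  unfolding subspace_def
proof (intro conjI ballI allI)
  have "frame_op I (\<lambda>_. 0) = (\<lambda>_. 0)"
    using frame_op_scale[OF smooth_const, of 0 0] by simp
  then have "(0, 0) = (L2_class (\<lambda>_. 0), L2_class (frame_op I (\<lambda>_. 0)))"
    by (simp add: L2_class_zero)
  then show "0 \<in> smooth_graph (frame_op I)"
    using smooth_const[of 0] unfolding smooth_graph_def zero_prod_def by blast
next
  fix x y assume "x \<in> smooth_graph (frame_op I)" "y \<in> smooth_graph (frame_op I)"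
  then obtain F G where F: "smooth F" "x = (L2_class F, L2_class (frame_op I F))"
    and G: "smooth G" "y = (L2_class G, L2_class (frame_op I G))"
    by (auto simp: smooth_graph_def)
  have "x + y = (L2_class (\<lambda>x. F x + G x), L2_class (frame_op I (\<lambda>x. F x + G x)))"
    using F G by (simp add: L2_class_add smooth_L2_fun smooth_frame_op frame_op_add)
  then show "x + y \<in> smooth_graph (frame_op I)"
    using smooth_add[OF F(1) G(1)] unfolding smooth_graph_def by blast
next
  fix c x assume "x \<in> smooth_graph (frame_op I)"
  then obtain F where F: "smooth F" "x = (L2_class F, L2_class (frame_op I F))"
    by (auto simp: smooth_graph_def)
  have "c *\<^sub>R x = (L2_class (\<lambda>x. c * F x), L2_class (frame_op I (\<lambda>x. c * F x)))"
    using F by (simp add: L2_class_scaleR smooth_L2_fun smooth_frame_op frame_op_scale)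
  then show "c *\<^sub>R x \<in> smooth_graph (frame_op I)"
    using smooth_mult[OF smooth_const F(1)] unfolding smooth_graph_def by blast
qed

end

section \<open>The operators on classes of polynomials\<close>

lemma L2_polynomials_total:
  assumes "\<And>n p. pol n p \<Longrightarrow> u \<bullet> L2_class p = 0"
  shows "u = 0"
proof -
  have f: "L2_fun (L2_rep u)" by (rule L2_fun_rep)
  have "(LINT x|S7_volume. L2_rep u x * p x) = 0" if poly: "real_polynomial_function p" for p
  proof -
    obtain n where p: "pol n p"
      using real_polynomial_function_imp_pol[OF poly] by blast
    have "L2_class (L2_rep u) \<bullet> L2_class p = 0"
      using assms[OF p] by (simp add: L2_class_rep)
    then show ?thesis
      by (simp add: L2_class_inner[OF f smooth_L2_fun[OF pol_smooth[OF p]]])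
  qed
  then have "AE x in S7_volume. L2_rep u x = 0"
    by (rule L2_orthogonal_polynomials[OF f])
  then have "L2_class (L2_rep u) = L2_class (\<lambda>_. 0)"
    using f by (intro L2_class_eqI) (simp add: L2_eq_def L2_fun_zero)
  then show ?thesis by (simp add: L2_class_rep L2_class_zero)
qed

definition L2_pol :: "nat \<Rightarrow> L2_S7 set" where
  "L2_pol n = {L2_class p | p. pol n p}"

text \<open>A class may contain several polynomials, such as 1 and the squared norm, so the value is
  chosen through some representative; \<open>L2_op_class\<close> removes the dependence.\<close>

definition L2_op :: "nat set \<Rightarrow> L2_S7 \<Rightarrow> L2_S7" where
  "L2_op I u = (SOME v. \<exists>n p. pol n p \<and> u = L2_class p \<and> v = L2_class (frame_op I p))"

text \<open>If \<open>p\<close> and \<open>q\<close> represent the same class, symmetry moves the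
  operator onto an arbitrary polynomial \<open>r\<close>, so the difference of the two images is
  orthogonal to all polynomials and vanishes.\<close>

lemma L2_op_class:
  assumes I: "I \<subseteq> {1..7}" and p: "pol n p"
  shows "L2_op I (L2_class p) = L2_class (frame_op I p)"
  unfolding L2_op_def
proof (rule some_equality)
  show "\<exists>n q. pol n q \<and> L2_class p = L2_class q \<and> L2_class (frame_op I p) = L2_class (frame_op I q)"
    using p by blast
  fix v assume "\<exists>n q. pol n q \<and> L2_class p = L2_class q \<and> v = L2_class (frame_op I q)"
  then obtain m q where q: "pol m q" "L2_class p = L2_class q" "v = L2_class (frame_op I q)" by blast
  have "v - L2_class (frame_op I p) = 0"
  proof (rule L2_polynomials_total)
    fix k r assume "pol k r"
    then show "(v - L2_class (frame_op I p)) \<bullet> L2_class r = 0"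
      using p q by (simp add: inner_diff_left frame_op_symmetric[OF I] pol_smooth)
  qed
  then show "v = L2_class (frame_op I p)" by simp
qed

lemma subspace_L2_pol: "subspace (L2_pol n)"
  unfolding subspace_def
proof (intro conjI ballI allI)
  show "0 \<in> L2_pol n"
    using pol_const[of n 0] unfolding L2_pol_def L2_class_zero[symmetric] by blast
next
  fix u v assume "u \<in> L2_pol n" "v \<in> L2_pol n"
  then obtain p q where p: "pol n p" "u = L2_class p" and q: "pol n q" "v = L2_class q"
    by (auto simp: L2_pol_def)
  then have "u + v = L2_class (\<lambda>x. p x + q x)"
    by (simp add: L2_class_add smooth_L2_fun pol_smooth)
  then show "u + v \<in> L2_pol n"
    using pol_add[OF p(1) q(1)] unfolding L2_pol_def by blast
next
  fix c u assume "u \<in> L2_pol n"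
  then obtain p where p: "pol n p" "u = L2_class p"
    by (auto simp: L2_pol_def)
  then have "c *\<^sub>R u = L2_class (\<lambda>x. c * p x)"
    by (simp add: L2_class_scaleR smooth_L2_fun pol_smooth)
  then show "c *\<^sub>R u \<in> L2_pol n"
    using pol_scale[OF p(1)] unfolding L2_pol_def by blast
qed

lemma symmetric_on_L2_op:
  assumes I: "I \<subseteq> {1..7}"
  shows "symmetric_on (L2_pol n) (L2_op I)"
  unfolding symmetric_on_def
proof (intro conjI ballI allI)
  fix u assume "u \<in> L2_pol n"
  then obtain p where p: "pol n p" and u: "u = L2_class p" by (auto simp: L2_pol_def)
  have sp: "smooth p" using p by (rule pol_smooth)
  show "L2_op I u \<in> L2_pol n"
    using pol_frame_op[OF I p] unfolding u L2_op_class[OF I p] L2_pol_def by blast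
  show "L2_op I (c *\<^sub>R u) = c *\<^sub>R L2_op I u" for c
  proof -
    have "c *\<^sub>R u = L2_class (\<lambda>x. c * p x)"
      unfolding u by (rule L2_class_scaleR[OF smooth_L2_fun[OF sp]])
    then show ?thesis
      unfolding u using L2_op_class[OF I p] L2_op_class[OF I pol_scale[OF p]]
      by (simp add: frame_op_scale[OF I sp] L2_class_scaleR smooth_L2_fun smooth_frame_op[OF I] sp)
  qed
  fix v assume "v \<in> L2_pol n"
  then obtain q where q: "pol n q" and v: "v = L2_class q" by (auto simp: L2_pol_def)
  have sq: "smooth q" using q by (rule pol_smooth)
  show "L2_op I (u + v) = L2_op I u + L2_op I v"
  proof -
    have "u + v = L2_class (\<lambda>x. p x + q x)"
      unfolding u v by (rule L2_class_add[OF smooth_L2_fun[OF sp] smooth_L2_fun[OF sq]])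
    then show ?thesis
      unfolding u v using L2_op_class[OF I p] L2_op_class[OF I q] L2_op_class[OF I pol_add[OF p q]]
      by (simp add: frame_op_add[OF I sp sq] L2_class_add smooth_L2_fun smooth_frame_op[OF I] sp sq)
  qed
  show "L2_op I u \<bullet> v = u \<bullet> L2_op I v"
    unfolding u v L2_op_class[OF I p] L2_op_class[OF I q] by (rule frame_op_symmetric[OF I sp sq])
qed

section \<open>Finite dimension of the spaces of polynomials, and commutation there\<close>

fun monomials :: "nat \<Rightarrow> (real ^ 8 \<Rightarrow> real) set" where
  "monomials 0 = {\<lambda>_. 1}"
| "monomials (Suc n) = monomials n \<union> (\<Union>i. (\<lambda>m x. x $ i * m x) ` monomials n)"

lemma finite_monomials: "finite (monomials n)"
  by (induction n) auto

lemma one_monomial: "(\<lambda>_. 1) \<in> monomials n"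
  by (induction n) auto

lemma L2_class_sum:
  "finite I \<Longrightarrow> (\<And>i. i \<in> I \<Longrightarrow> smooth (F i)) \<Longrightarrow> L2_class (\<lambda>x. \<Sum>i\<in>I. F i x) = (\<Sum>i\<in>I. L2_class (F i))"
proof (induction I rule: finite_induct)
  case (insert i I)
  have "L2_class (\<lambda>x. F i x + (\<Sum>i\<in>I. F i x)) = L2_class (F i) + L2_class (\<lambda>x. \<Sum>i\<in>I. F i x)"
    using insert.prems by (intro L2_class_add[symmetric] smooth_L2_fun smooth_sum) auto
  then show ?case using insert by simp
qed (simp add: L2_class_zero)

text \<open>The weight \<open>h\<close> lets the induction absorb the linear factors one at a time.\<close>

lemma weighted_pol_in_span:
  assumes "pol n p" "smooth h"
  shows "L2_class (\<lambda>x. h x * p x) \<in> span ((\<lambda>m. L2_class (\<lambda>x. h x * m x)) ` monomials n)"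
  using assms
proof (induction arbitrary: h rule: pol.induct)
  case (pol_const n c)
  have "L2_class (\<lambda>x. h x * c) = c *\<^sub>R L2_class (\<lambda>x. h x * 1)"
    using pol_const by (simp add: L2_class_scaleR smooth_L2_fun mult.commute)
  also have "\<dots> \<in> span ((\<lambda>m. L2_class (\<lambda>x. h x * m x)) ` monomials n)"
    by (intro span_scale span_base image_eqI[OF refl] one_monomial)
  finally show ?case .
next
  case (pol_add n p q)
  have "L2_class (\<lambda>x. h x * (p x + q x)) = L2_class (\<lambda>x. h x * p x) + L2_class (\<lambda>x. h x * q x)"
    using pol_add by (simp add: distrib_left L2_class_add smooth_L2_fun smooth_mult pol_smooth)
  then show ?case
    using pol_add by (simp add: span_add)
next
  case (pol_inner n p u)
  have sm: "smooth (\<lambda>x. h x * x $ i)" for i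
    unfolding axis_eq_inner by (intro smooth_mult smooth_inner pol_inner.prems)
  have "L2_class (\<lambda>x. h x * (x \<bullet> u * p x)) = L2_class (\<lambda>x. \<Sum>i\<in>UNIV. u $ i * ((h x * x $ i) * p x))"
    by (simp add: inner_vec_def sum_distrib_left sum_distrib_right mult_ac)
  also have "\<dots> = (\<Sum>i\<in>UNIV. L2_class (\<lambda>x. u $ i * ((h x * x $ i) * p x)))"
    by (intro L2_class_sum smooth_mult[OF smooth_const] smooth_mult[OF sm] pol_smooth[OF pol_inner.hyps]) simp
  also have "\<dots> = (\<Sum>i\<in>UNIV. u $ i *\<^sub>R L2_class (\<lambda>x. (h x * x $ i) * p x))"
    by (intro sum.cong refl L2_class_scaleR[symmetric] smooth_L2_fun smooth_mult[OF sm] pol_smooth[OF pol_inner.hyps])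
  also have "\<dots> \<in> span ((\<lambda>m. L2_class (\<lambda>x. h x * m x)) ` monomials (Suc n))"
  proof (intro span_sum span_scale)
    fix i
    have "(\<lambda>m. L2_class (\<lambda>x. (h x * x $ i) * m x)) ` monomials n
        \<subseteq> (\<lambda>m. L2_class (\<lambda>x. h x * m x)) ` monomials (Suc n)"
    proof (intro image_subsetI)
      fix m assume "m \<in> monomials n"
      then have "(\<lambda>x. x $ i * m x) \<in> monomials (Suc n)" by auto
      then show "L2_class (\<lambda>x. (h x * x $ i) * m x) \<in> (\<lambda>m. L2_class (\<lambda>x. h x * m x)) ` monomials (Suc n)"
        by (rule rev_image_eqI) (simp add: mult.assoc)
    qed
    then show "L2_class (\<lambda>x. (h x * x $ i) * p x) \<in> span ((\<lambda>m. L2_class (\<lambda>x. h x * m x)) ` monomials (Suc n))"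
      using pol_inner.IH[OF sm] span_mono by blast
  qed
  finally show ?case .
qed

lemma L2_pol_finite_dimensional: "\<exists>S. finite S \<and> L2_pol n \<subseteq> span S"
proof (intro exI conjI)
  show "finite (L2_class ` monomials n)" by (simp add: finite_monomials)
  show "L2_pol n \<subseteq> span (L2_class ` monomials n)"
    using weighted_pol_in_span[OF _ smooth_const, of n _ 1] by (auto simp: L2_pol_def)
qed

text \<open>\<open>X_deriv 1\<close> commutes with the sum of all seven squares on polynomials,
  hence so does \<open>X_square 1\<close>; subtracting \<open>X_square 1\<close> itself leaves
  commutation with the other six.\<close>

lemma L2_op_commute:
  assumes "u \<in> L2_pol n"
  shows "L2_op {1} (L2_op {2..7} u) = L2_op {2..7} (L2_op {1} u)"
proof -
  obtain p where p: "pol n p" and u: "u = L2_class p"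
    using assms by (auto simp: L2_pol_def)
  have one: "(1::nat) \<in> {1..7}" by simp
  have I: "{1} \<subseteq> {1..7::nat}" "{2..7} \<subseteq> {1..7::nat}" by auto
  have split: "frame_laplacian F x = X_square 1 F x + frame_op {2..7} F x" for F x
  proof -
    have "{1..7::nat} = insert 1 {2..7}" by auto
    then show ?thesis by (simp add: frame_laplacian_def frame_op_def)
  qed
  have "X_square 1 (frame_laplacian p) = frame_laplacian (X_square 1 p)"
  proof -
    have "X_deriv 1 (frame_laplacian p) = frame_laplacian (X_deriv 1 p)"
      by (rule ext) (rule X_deriv_frame_laplacian[OF p])
    moreover have "X_deriv 1 (frame_laplacian (X_deriv 1 p)) = frame_laplacian (X_deriv 1 (X_deriv 1 p))"
      by (rule ext) (rule X_deriv_frame_laplacian[OF pol_X_deriv[OF p one]])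
    ultimately show ?thesis
      by (simp only: X_square_def)
  qed
  moreover have "X_square 1 (frame_laplacian p) =
      (\<lambda>x. X_square 1 (X_square 1 p) x + X_square 1 (frame_op {2..7} p) x)"
    unfolding split[abs_def] using p
    by (intro X_square_add smooth_X_square smooth_frame_op I one) (auto intro: pol_smooth)
  ultimately have "X_square 1 (frame_op {2..7} p) = frame_op {2..7} (X_square 1 p)"
    by (simp add: split fun_eq_iff)
  moreover have "frame_op {1} F = X_square 1 F" for F
    by (simp add: frame_op_def fun_eq_iff)
  ultimately show ?thesis
    unfolding u using L2_op_class[OF I(1)] L2_op_class[OF I(2)] p pol_frame_op[OF I(1) p] pol_frame_op[OF I(2) p]
    by simp
qed

section \<open>The semigroups on the sphere\<close>

text \<open>Polynomial basis vectors have smooth representatives, so their pairs lie in the smooth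
  graph itself and not only in its closure.\<close>

locale polynomial_basis = orthonormal_basis E for E :: "L2_S7 set" +
  assumes polynomial: "E \<subseteq> (\<Union>n. L2_pol n)"
begin

lemma basis_polynomial: "e \<in> E \<Longrightarrow> \<exists>n p. pol n p \<and> e = L2_class p"
  using polynomial unfolding L2_pol_def by blast

text \<open>Symmetry moves the operator from a smooth \<open>F\<close> onto the basis vector
  \<open>e\<close>, which puts the smooth graph inside the diagonal one; the polynomial eigenvectors
  make it dense there.\<close>

lemma closure_smooth_graph:
  assumes I: "I \<subseteq> {1..7}" and eig: "\<And>e. e \<in> E \<Longrightarrow> L2_op I e = - c e *\<^sub>R e"
    and nonneg: "\<And>e. e \<in> E \<Longrightarrow> 0 \<le> c e"
  shows "closure (smooth_graph (frame_op I)) = diag_graph c"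
proof (rule closure_eq_diag_graph)
  show "0 \<le> c e" if "e \<in> E" for e
    using that by (rule nonneg)
  show "subspace (smooth_graph (frame_op I))"
    using I by (rule subspace_smooth_graph)
  show "smooth_graph (frame_op I) \<subseteq> diag_graph c"
  proof
    fix z assume "z \<in> smooth_graph (frame_op I)"
    then obtain F where F: "smooth F" "z = (L2_class F, L2_class (frame_op I F))"
      by (auto simp: smooth_graph_def)
    have "L2_class (frame_op I F) \<bullet> e = - c e * (L2_class F \<bullet> e)" if e: "e \<in> E" for e
    proof -
      obtain n p where p: "pol n p" "e = L2_class p"
        using basis_polynomial[OF e] by blast
      have "L2_class (frame_op I F) \<bullet> e = L2_class F \<bullet> L2_op I e"
        unfolding p(2) L2_op_class[OF I p(1)] using F(1) pol_smooth[OF p(1)] by (rule frame_op_symmetric[OF I])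
      then show ?thesis by (simp add: eig[OF e])
    qed
    then show "z \<in> diag_graph c" by (simp add: diag_graph_def F(2))
  qed
  show "(e, - c e *\<^sub>R e) \<in> smooth_graph (frame_op I)" if e: "e \<in> E" for e
  proof -
    obtain n p where p: "pol n p" "e = L2_class p"
      using basis_polynomial[OF e] by blast
    then have "(e, - c e *\<^sub>R e) = (L2_class p, L2_class (frame_op I p))"
      using eig[OF e] L2_op_class[OF I p(1)] by simp
    then show ?thesis
      using pol_smooth[OF p(1)] by (auto simp: smooth_graph_def)
  qed
qed

text \<open>The diagonal semigroup is a witness for the existential quantifier in
  \<open>exp_minus\<close>, and \<open>semigroup_eq_diag\<close> forces every other witness to agree
  with it.\<close>

lemma exp_minus_eq:
  assumes closure: "closure (smooth_graph D) = diag_graph c" and nonneg: "\<And>e. e \<in> E \<Longrightarrow> 0 \<le> c e"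
    and t: "0 \<le> t"
  shows "exp_minus t D = {(f, diag_semigroup c t f) | f. True}"
    "exp_minus (- t) D = {(diag_semigroup c t g, g) | g. True}"
proof -
  have C0: "C0_semigroup (diag_semigroup c)"
    by (rule C0_semigroup_diag[OF nonneg])
  have gen: "generator (diag_semigroup c) = closure (smooth_graph D)"
    unfolding closure by (rule generator_diag[OF nonneg])
  have unique: "T t f = diag_semigroup c t f"
    if "C0_semigroup T" "generator T = closure (smooth_graph D)" for T f
  proof (rule semigroup_eq_diag)
    show "C0_semigroup T" by fact
    show "generator T = diag_graph c" using that(2) unfolding closure .
  qed (use nonneg t in auto)
  have graph: "(\<exists>T. C0_semigroup T \<and> generator T = closure (smooth_graph D) \<and> g = T t f) \<longleftrightarrow>
      g = diag_semigroup c t f" for f g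
    using C0 gen unique by metis
  have "exp_minus t D = {(f, g). g = diag_semigroup c t f}"
    using t by (simp add: exp_minus_def graph)
  then show "exp_minus t D = {(f, diag_semigroup c t f) | f. True}"
    by auto
  have "exp_minus (- t) D = {(f, g). f = diag_semigroup c t g}"
  proof (cases "t = 0")
    \<comment> \<open>At time 0 the condition \<open>0 \<le> - t\<close> also holds and selects the
      forward branch; both branches give the identity.\<close>
    case True
    have "exp_minus 0 D = {(f, g). g = diag_semigroup c 0 f}"
      using True by (simp add: exp_minus_def graph[unfolded True])
    then show ?thesis
      using True C0 by (auto simp: C0_semigroup_def)
  next
    case False
    then show ?thesis using t by (simp add: exp_minus_def graph)
  qed
  then show "exp_minus (- t) D = {(diag_semigroup c t g, g) | g. True}"
    by auto
qed

end

text \<open>The two operators are compared only on the sphere, which is the whole space of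
  \<open>S7_volume\<close>, so their values have the same class.\<close>

lemma smooth_graph_laplace_beltrami: "smooth_graph laplace_beltrami = smooth_graph (frame_op {1..7})"
proof -
  have "L2_class (laplace_beltrami F) = L2_class (frame_op {1..7} F)" if "smooth F" for F
  proof (rule L2_class_eqI[symmetric, OF L2_eq_sphere])
    show "L2_fun (frame_op {1..7} F)"
      using that by (intro smooth_L2_fun smooth_frame_op) auto
    show "frame_op {1..7} F x = laplace_beltrami F x" if "x \<in> sphere 0 1" for x
      using laplace_beltrami_sphere[OF \<open>smooth F\<close> that] by (simp add: frame_op_def)
  qed
  then show ?thesis unfolding smooth_graph_def by fastforce
qed

text \<open>\<open>exp_minus (- t) (X_square 1)\<close> is the graph of an inverse and is defined
  only on the range of a semigroup operator. The composite has that range as its domain, and its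
  closure carries the equality. As \<open>O\<close> applies its left argument first, the heat
  operator of the Laplacian acts after the inverse.\<close>

theorem corollary4:
  fixes t :: real
  assumes "0 \<le> t"
  shows "exp_minus t sub_laplacian =
    closure (exp_minus (- t) (X_square 1) O exp_minus t laplace_beltrami)"
proof -
  have I: "{1} \<subseteq> {1..7::nat}" "{2..7} \<subseteq> {1..7::nat}" "{1..7} \<subseteq> {1..7::nat}" by auto
  have ops: "sub_laplacian = frame_op {2..7}" "X_square 1 = frame_op {1}"
    by (simp_all add: fun_eq_iff sub_laplacian_def frame_op_def)
  obtain E where E: "E \<subseteq> (\<Union>n. L2_pol n)" "orthonormal E"
    and eig: "\<And>e. e \<in> E \<Longrightarrow> eigenvector (L2_op {1}) e \<and> eigenvector (L2_op {2..7}) e"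
    and span: "(\<Union>n. L2_pol n) \<subseteq> span E"
  proof (rule exists_joint_eigenbasis[of L2_pol "L2_op {1}" "L2_op {2..7}"])
    show "L2_pol n \<subseteq> L2_pol (Suc n)" for n
      using pol_Suc by (auto simp: L2_pol_def)
    show "L2_op {1} (L2_op {2..7} u) = L2_op {2..7} (L2_op {1} u)" if "u \<in> L2_pol n" for n u
      using that by (rule L2_op_commute)
  qed (auto intro: symmetric_on_L2_op subspace_L2_pol L2_pol_finite_dimensional)
  interpret polynomial_basis E
  proof
    show "E \<subseteq> (\<Union>n. L2_pol n)" by fact
    show "norm e = 1" if "e \<in> E" for e
      using E(2) that by (simp add: orthonormal_def)
    show "d \<bullet> e = 0" if "d \<in> E" "e \<in> E" "d \<noteq> e" for d e
      using E(2) that by (simp add: orthonormal_def)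
    \<comment> \<open>Every class of a polynomial is a finite combination of basis vectors, so
      orthogonality to \<open>E\<close> passes to all polynomials.\<close>
    show "f = 0" if "\<And>e. e \<in> E \<Longrightarrow> f \<bullet> e = 0" for f
    proof (rule L2_polynomials_total)
      fix n p assume "pol n p"
      then have "L2_class p \<in> span E"
        using span by (auto simp: L2_pol_def)
      then show "f \<bullet> L2_class p = 0"
        using orthogonal_to_span[OF that] by blast
    qed
  qed
  \<comment> \<open>Minus the Rayleigh quotient at a unit vector: the eigenvalue up to sign,
    nonnegative as the convention of \<open>diag_graph\<close> wants.\<close>
  define c where "c I e = - (L2_op I e \<bullet> e)" for I e
  have c_eig: "L2_op I e = - c I e *\<^sub>R e" if "eigenvector (L2_op I) e" "e \<in> E" for I e
    using that norm_E[OF that(2)] by (auto simp: eigenvector_def c_def norm_eq_1)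
  have c_nonneg: "0 \<le> c I e" if I: "I \<subseteq> {1..7}" and e: "e \<in> E" for I e
  proof -
    obtain n p where p: "pol n p" "e = L2_class p"
      using basis_polynomial[OF e] by blast
    then show ?thesis
      using frame_op_nonpos[OF I pol_smooth[OF p(1)]] by (simp add: c_def L2_op_class[OF I p(1)])
  qed
  \<comment> \<open>The basis diagonalises the two summands, hence also their sum, and the
    eigenvalues add.\<close>
  have sum: "L2_op {1..7} e = - (c {2..7} e + c {1} e) *\<^sub>R e" if e: "e \<in> E" for e
  proof -
    obtain n p where p: "pol n p" "e = L2_class p"
      using basis_polynomial[OF e] by blast
    have "{1..7::nat} = insert 1 {2..7}" by auto
    then have "frame_op {1..7} p = (\<lambda>x. frame_op {1} p x + frame_op {2..7} p x)"
      by (simp add: frame_op_def fun_eq_iff)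
    then have "L2_op {1..7} e = L2_op {1} e + L2_op {2..7} e"
      unfolding p(2) L2_op_class[OF I(1) p(1)] L2_op_class[OF I(2) p(1)] L2_op_class[OF I(3) p(1)]
      using pol_smooth[OF p(1)] by (simp add: L2_class_add smooth_L2_fun smooth_frame_op I)
    then show ?thesis
      using c_eig[of "{1}" e] c_eig[of "{2..7}" e] eig[OF e] e by (simp add: algebra_simps)
  qed
  have "exp_minus t sub_laplacian = {(f, diag_semigroup (c {2..7}) t f) | f. True}"
    unfolding ops using eig
    by (intro exp_minus_eq closure_smooth_graph c_eig c_nonneg I assms) auto
  moreover have "exp_minus (- t) (X_square 1) = {(diag_semigroup (c {1}) t g, g) | g. True}"
    unfolding ops using eig
    by (intro exp_minus_eq closure_smooth_graph c_eig c_nonneg I assms) auto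
  moreover have "exp_minus t laplace_beltrami =
      {(f, diag_semigroup (\<lambda>e. c {2..7} e + c {1} e) t f) | f. True}"
  proof (rule exp_minus_eq)
    show "closure (smooth_graph laplace_beltrami) = diag_graph (\<lambda>e. c {2..7} e + c {1} e)"
      unfolding smooth_graph_laplace_beltrami
      by (intro closure_smooth_graph sum I add_nonneg_nonneg c_nonneg)
    show "0 \<le> c {2..7} e + c {1} e" if "e \<in> E" for e
      using that by (intro add_nonneg_nonneg c_nonneg I)
  qed (rule assms)
  \<comment> \<open>The second components of the left relation exhaust the space, so the
    intermediate vector \<open>h\<close> parametrises the composite freely.\<close>
  moreover have "{(diag_semigroup (c {1}) t g, g) | g. True} O
      {(f, diag_semigroup (\<lambda>e. c {2..7} e + c {1} e) t f) | f. True} =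
      {(diag_semigroup (c {1}) t h, diag_semigroup (\<lambda>e. c {2..7} e + c {1} e) t h) | h. True}"
    by auto
  ultimately show ?thesis
    using diag_semigroup_graph_closure[of "c {2..7}" "c {1}" t] c_nonneg I assms by simp
qed

end
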